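(* Let $L_o(2)$ denote the language of all finite words over the alphabet $\{0,1\}$ that contain an overlap as a subword. Then $L_o(2)$ is not unambiguously context-free.
   Context: An overlap is a word of the form $axaxa$, where $a$ is a single letter and $x$ is a (possibly empty) word. "Subword" means contiguous block (factor): $u$ is a subword of $w$ if $w = puq$ for some (possibly empty) words $p,q$. A language is unambiguously context-free if it is generated by some unambiguous context-free grammar, i.e. a context-free grammar in which every generated word has exactly one derivation tree (equivalently, exactly one leftmost derivation). *)

theory Defs
  imports "HOL-Library.Sublist"
begin

section \<open>Overlaps\<close>

definition overlap :: "'a list \<Rightarrow> bool" where
  "overlap w \<longleftrightarrow> (\<exists>a x. w = [a] @ x @ [a] @ x @ [a])"

text \<open>Words over the alphabet \<open>{0, \<dots>, k - 1}\<close> having an overlap as a contiguous factor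
  (\<^const>\<open>sublist\<close> is contiguous, as opposed to \<^const>\<open>subseq\<close>).\<close>

definition L_o :: "nat \<Rightarrow> nat list set" where
  "L_o k = {w. set w \<subseteq> {..<k} \<and> (\<exists>u. overlap u \<and> sublist u w)}"

section \<open>Context-free grammars\<close>

datatype ('n, 't) symbol = NT 'n | Tm 't

record ('n, 't) cfg =
  nonterminals :: "'n set"
  terminals :: "'t set"
  rules :: "('n \<times> ('n, 't) symbol list) set"
  start :: 'n

definition wf_cfg :: "('n, 't) cfg \<Rightarrow> bool" where
  "wf_cfg G \<longleftrightarrow> finite (nonterminals G) \<and> finite (terminals G) \<and> finite (rules G)
     \<and> start G \<in> nonterminals G
     \<and> (\<forall>(A, \<alpha>) \<in> rules G. A \<in> nonterminals G
          \<and> set \<alpha> \<subseteq> NT ` nonterminals G \<union> Tm ` terminals G)"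

definition derives1 :: "('n, 't) cfg \<Rightarrow> ('n, 't) symbol list \<Rightarrow> ('n, 't) symbol list \<Rightarrow> bool" where
  "derives1 G u v \<longleftrightarrow>
     (\<exists>p A \<alpha> s. (A, \<alpha>) \<in> rules G \<and> u = p @ [NT A] @ s \<and> v = p @ \<alpha> @ s)"

definition cfg_lang :: "('n, 't) cfg \<Rightarrow> 't list set" where
  "cfg_lang G = {w. (derives1 G)\<^sup>*\<^sup>* [NT (start G)] (map Tm w)}"

subsection \<open>Derivation trees and ambiguity\<close>

text \<open>A use of an empty rule \<open>A \<rightarrow> \<epsilon>\<close> is the childless inner node \<open>Node A []\<close>.\<close>

datatype ('n, 't) tree = Leaf 't | Node 'n "('n, 't) tree list"

fun root :: "('n, 't) tree \<Rightarrow> ('n, 't) symbol" where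
  "root (Leaf a) = Tm a"
| "root (Node A ts) = NT A"

fun frontier :: "('n, 't) tree \<Rightarrow> 't list" where
  "frontier (Leaf a) = [a]"
| "frontier (Node A ts) = concat (map frontier ts)"

fun conforms :: "('n, 't) cfg \<Rightarrow> ('n, 't) tree \<Rightarrow> bool" where
  "conforms G (Leaf a) \<longleftrightarrow> a \<in> terminals G"
| "conforms G (Node A ts) \<longleftrightarrow> (A, map root ts) \<in> rules G \<and> (\<forall>t \<in> set ts. conforms G t)"

definition derivation_tree :: "('n, 't) cfg \<Rightarrow> 't list \<Rightarrow> ('n, 't) tree \<Rightarrow> bool" where
  "derivation_tree G w t \<longleftrightarrow> conforms G t \<and> root t = NT (start G) \<and> frontier t = w"

definition unambiguous :: "('n, 't) cfg \<Rightarrow> bool" where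
  "unambiguous G \<longleftrightarrow> (\<forall>w \<in> cfg_lang G. \<exists>!t. derivation_tree G w t)"

text \<open>HOL cannot quantify existentially over types, so nonterminals are taken to be natural
  numbers. As a grammar has only finitely many nonterminals, this is no restriction; see
  \<open>unambiguously_context_freeI\<close> below.\<close>

definition unambiguously_context_free :: "'t list set \<Rightarrow> bool" where
  "unambiguously_context_free L \<longleftrightarrow>
     (\<exists>G :: (nat, 't) cfg. wf_cfg G \<and> unambiguous G \<and> cfg_lang G = L)"

subsection \<open>Derivations and derivation trees agree\<close>

lemma derives_append:
  assumes "(derives1 G)\<^sup>*\<^sup>* u v"
  shows "(derives1 G)\<^sup>*\<^sup>* (p @ u @ s) (p @ v @ s)"
  using assms
proof (induction rule: rtranclp_induct)
  case (step y z)
  from step.hyps(2) have "derives1 G (p @ y @ s) (p @ z @ s)"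
  proof -
    from step.hyps(2) obtain q A \<alpha> r where
      "(A, \<alpha>) \<in> rules G" "y = q @ [NT A] @ r" "z = q @ \<alpha> @ r"
      unfolding derives1_def by blast
    then show ?thesis
      unfolding derives1_def
      by (intro exI[of _ "p @ q"] exI[of _ A] exI[of _ \<alpha>] exI[of _ "r @ s"]) simp
  qed
  with step.IH show ?case by (rule rtranclp.rtrancl_into_rtrancl)
qed simp

lemma derives_concat:
  assumes "\<And>t. t \<in> set ts \<Longrightarrow> (derives1 G)\<^sup>*\<^sup>* [f t] (g t)"
  shows "(derives1 G)\<^sup>*\<^sup>* (map f ts) (concat (map g ts))"
  using assms
proof (induction ts)
  case (Cons t ts)
  have "(derives1 G)\<^sup>*\<^sup>* ([] @ [f t] @ map f ts) ([] @ g t @ map f ts)"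
    using Cons.prems by (intro derives_append) simp
  moreover have "(derives1 G)\<^sup>*\<^sup>* (g t @ map f ts @ []) (g t @ concat (map g ts) @ [])"
    using Cons by (intro derives_append) simp
  ultimately show ?case by simp
qed simp

lemma conforms_derives:
  "conforms G t \<Longrightarrow> (derives1 G)\<^sup>*\<^sup>* [root t] (map Tm (frontier t))"
proof (induction t)
  case (Node A ts)
  have "derives1 G [NT A] (map root ts)"
    using Node.prems unfolding derives1_def
    by (intro exI[of _ "[]"] exI[of _ A] exI[of _ "map root ts"]) simp
  moreover have "(derives1 G)\<^sup>*\<^sup>* (map root ts) (concat (map (\<lambda>t. map Tm (frontier t)) ts))"
    using Node by (intro derives_concat) auto
  ultimately show ?case
    by (simp add: map_concat comp_def converse_rtranclp_into_rtranclp)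
qed simp

lemma derives_conforms:
  assumes "(derives1 G)\<^sup>*\<^sup>* u v" "v = map Tm w" "set w \<subseteq> terminals G"
  shows "\<exists>ts. map root ts = u \<and> (\<forall>t \<in> set ts. conforms G t) \<and> concat (map frontier ts) = w"
  using assms
proof (induction rule: converse_rtranclp_induct)
  case base
  then show ?case
    by (intro exI[of _ "map Leaf w"]) (auto simp: comp_def)
next
  case (step u u')
  then obtain ts where ts: "map root ts = u'" "\<forall>t \<in> set ts. conforms G t"
      "concat (map frontier ts) = w" by blast
  from step.hyps(1) obtain p A \<alpha> s where r: "(A, \<alpha>) \<in> rules G" "u = p @ [NT A] @ s" "u' = p @ \<alpha> @ s"
    unfolding derives1_def by blast
  from ts(1) r(3) obtain tp tr where sp1: "ts = tp @ tr" "map root tp = p" "map root tr = \<alpha> @ s"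
    by (auto simp: map_eq_append_conv[of root ts])
  from sp1(3) obtain ta tl where sp2: "tr = ta @ tl" "map root ta = \<alpha>" "map root tl = s"
    by (auto simp: map_eq_append_conv[of root tr])
  show ?case
    using ts sp1 sp2 r by (intro exI[of _ "tp @ [Node A ta] @ tl"]) auto
qed

lemma derives_terminals:
  assumes "(derives1 G)\<^sup>*\<^sup>* u v" "wf_cfg G"
    "set u \<subseteq> NT ` nonterminals G \<union> Tm ` terminals G"
  shows "set v \<subseteq> NT ` nonterminals G \<union> Tm ` terminals G"
  using assms
proof (induction rule: rtranclp_induct)
  case (step y z)
  then obtain p A \<alpha> s where r: "(A, \<alpha>) \<in> rules G" "y = p @ [NT A] @ s" "z = p @ \<alpha> @ s"
    unfolding derives1_def by blast
  then have "set \<alpha> \<subseteq> NT ` nonterminals G \<union> Tm ` terminals G"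
    using \<open>wf_cfg G\<close> by (auto simp: wf_cfg_def)
  with step r show ?case by simp
qed simp

lemma cfg_lang_terminals:
  assumes "wf_cfg G" "w \<in> cfg_lang G"
  shows "set w \<subseteq> terminals G"
proof -
  have "set [NT (start G)] \<subseteq> NT ` nonterminals G \<union> Tm ` terminals G"
    using assms(1) by (simp add: wf_cfg_def)
  with assms(2) have "set (map Tm w) \<subseteq> NT ` nonterminals G \<union> Tm ` terminals G"
    using derives_terminals[OF _ assms(1)] unfolding cfg_lang_def by blast
  then show ?thesis by auto
qed

lemma cfg_lang_iff_derivation_tree:
  assumes "wf_cfg G"
  shows "w \<in> cfg_lang G \<longleftrightarrow> (\<exists>t. derivation_tree G w t)"
proof
  assume w: "w \<in> cfg_lang G"
  then have "(derives1 G)\<^sup>*\<^sup>* [NT (start G)] (map Tm w)"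
    by (simp add: cfg_lang_def)
  from derives_conforms[OF this refl cfg_lang_terminals[OF assms w]]
  show "\<exists>t. derivation_tree G w t"
    by (auto simp: derivation_tree_def)
next
  assume "\<exists>t. derivation_tree G w t"
  then show "w \<in> cfg_lang G"
    unfolding derivation_tree_def cfg_lang_def by (metis conforms_derives mem_Collect_eq)
qed

subsection \<open>Independence of the type of nonterminals\<close>

definition map_cfg :: "('n \<Rightarrow> 'm) \<Rightarrow> ('n, 't) cfg \<Rightarrow> ('m, 't) cfg" where
  "map_cfg f G = \<lparr>nonterminals = f ` nonterminals G, terminals = terminals G,
     rules = (\<lambda>(A, \<alpha>). (f A, map (map_symbol f id) \<alpha>)) ` rules G, start = f (start G)\<rparr>"

lemma root_map_tree: "root (map_tree f id t) = map_symbol f id (root t)"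
  by (cases t) auto

lemma frontier_map_tree: "frontier (map_tree f id t) = frontier t"
  by (induction t) (auto intro!: arg_cong[of _ _ concat])

lemma conforms_map_tree: "conforms G t \<Longrightarrow> conforms (map_cfg f G) (map_tree f id t)"
proof (induction t)
  case (Node A ts)
  have "(f A, map (map_symbol f id) (map root ts)) \<in> rules (map_cfg f G)"
    using Node.prems unfolding map_cfg_def by (auto intro!: rev_image_eqI)
  then show ?case
    using Node by (simp add: comp_def root_map_tree[unfolded id_def] id_def)
qed (simp add: map_cfg_def)

lemma wf_map_cfg:
  assumes "wf_cfg G"
  shows "wf_cfg (map_cfg f G)"
proof -
  have "map_symbol f id ` set (snd r) \<subseteq> NT ` f ` nonterminals G \<union> Tm ` terminals G"
    if "r \<in> rules G" for r
  proof -
    have "set (snd r) \<subseteq> NT ` nonterminals G \<union> Tm ` terminals G"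
      using assms that by (simp add: wf_cfg_def case_prod_unfold)
    then show ?thesis by (fastforce simp: subset_iff)
  qed
  then show ?thesis
    using assms unfolding wf_cfg_def map_cfg_def by (simp add: case_prod_unfold)
qed

lemma map_cfg_inverse:
  assumes "wf_cfg G" "\<And>A. A \<in> nonterminals G \<Longrightarrow> g (f A) = A"
  shows "map_cfg g (map_cfg f G) = G"
proof -
  have 1: "(case (case r of (A, \<alpha>) \<Rightarrow> (f A, map (map_symbol f id) \<alpha>)) of
      (A, \<alpha>) \<Rightarrow> (g A, map (map_symbol g id) \<alpha>)) = r" if r: "r \<in> rules G" for r
  proof -
    obtain A \<alpha> where r': "r = (A, \<alpha>)" by (cases r)
    have "A \<in> nonterminals G" "set \<alpha> \<subseteq> NT ` nonterminals G \<union> Tm ` terminals G"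
      using assms(1) r r' unfolding wf_cfg_def by auto
    then show ?thesis
      using assms(2) unfolding r' by (auto simp: subset_iff intro!: map_idI)
  qed
  have 2: "(\<lambda>x. g (f x)) ` nonterminals G = nonterminals G" "g (f (start G)) = start G"
    using assms by (auto simp: wf_cfg_def)
  show ?thesis
    using 1 2 unfolding map_cfg_def by (cases G) (simp add: image_image)
qed

lemma map_tree_inverse:
  assumes "wf_cfg G" "conforms G t" "\<And>A. A \<in> nonterminals G \<Longrightarrow> g (f A) = A"
  shows "map_tree g id (map_tree f id t) = t"
  using assms(2)
proof (induction t)
  case (Node A ts)
  then have "A \<in> nonterminals G" using assms(1) by (auto simp: wf_cfg_def)
  with Node assms(3) show ?case by (auto intro!: map_idI)
qed simp

lemma unambiguously_context_freeI:
  fixes G :: "('n, 't) cfg"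
  assumes "wf_cfg G" "unambiguous G"
  shows "unambiguously_context_free (cfg_lang G)"
proof -
  obtain f :: "'n \<Rightarrow> nat" where inj: "inj_on f (nonterminals G)"
    using assms(1) finite_imp_inj_to_nat_seg unfolding wf_cfg_def by metis
  define g where "g = inv_into (nonterminals G) f"
  have gf: "g (f A) = A" if "A \<in> nonterminals G" for A
    using inj that by (simp add: g_def)
  define H where "H = map_cfg f G"
  have wfH: "wf_cfg H" using assms(1) by (simp add: H_def wf_map_cfg)
  have GH: "map_cfg g H = G"
    unfolding H_def using assms(1) gf by (rule map_cfg_inverse)
  have fg: "f (g B) = B" if "B \<in> nonterminals H" for B
    using that gf by (auto simp: H_def map_cfg_def)
  have to: "derivation_tree H w (map_tree f id t)" if "derivation_tree G w t" for w t
    using that conforms_map_tree[of G t f]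
    by (simp add: derivation_tree_def root_map_tree frontier_map_tree H_def) (simp add: map_cfg_def)
  have from_H: "derivation_tree G w (map_tree g id t)" if "derivation_tree H w t" for w t
  proof -
    have "start G = g (start H)" using GH by (metis cfg.select_convs(4) map_cfg_def)
    then show ?thesis
      using that conforms_map_tree[of H t g]
      by (simp add: derivation_tree_def root_map_tree frontier_map_tree GH)
  qed
  have lang: "cfg_lang H = cfg_lang G"
    using to from_H cfg_lang_iff_derivation_tree[OF assms(1)] cfg_lang_iff_derivation_tree[OF wfH]
    by blast
  have "\<exists>!t. derivation_tree H w t" if "w \<in> cfg_lang H" for w
  proof -
    have ex: "\<exists>t. derivation_tree H w t"
      using that cfg_lang_iff_derivation_tree[OF wfH] by blast
    have "t = u" if tu: "derivation_tree H w t" "derivation_tree H w u" for t u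
    proof -
      have "map_tree g id t = map_tree g id u"
        using assms(2) \<open>w \<in> cfg_lang H\<close> from_H tu unfolding lang unambiguous_def by blast
      then have "map_tree f id (map_tree g id t) = map_tree f id (map_tree g id u)" by simp
      then show ?thesis
        using map_tree_inverse[where f = g and g = f, OF wfH _ fg] tu by (simp add: derivation_tree_def)
    qed
    with ex show ?thesis by blast
  qed
  then have "unambiguous H" by (simp add: unambiguous_def)
  with wfH lang show ?thesis unfolding unambiguously_context_free_def by blast
qed

end

theory Submission
  imports Defs "HOL-Analysis.Analysis" "HOL-Computational_Algebra.Formal_Laurent_Series"
begin

text \<open>Let \<open>u\<close> be the generating function of the overlap-free binary words. An unambiguous
  grammar for the words with an overlap gives a polynomial system for the generating functions of
  its nonterminals. A derivation that kills the variable kills every solution of this system, as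
  the Jacobian is unipotent modulo the variable; so \<open>u\<close> is algebraic (Chomsky and
  Schuetzenberger). As \<open>u\<close> has integer coefficients and converges in the unit disc, it is even
  rational (Fatou), so \<open>u(r)\<close> grows like an integral power of \<open>1 / (1 - r)\<close> as \<open>r\<close> tends to \<open>1\<close>.

  On the other hand, a long overlap-free word is \<open>x \<mu>(y) z\<close> with \<open>\<mu>\<close> the Thue--Morse morphism,
  \<open>y\<close> overlap-free and \<open>x\<close>, \<open>z\<close> of length at most two. Weights that depend only on the two ends
  of a word show that \<open>u(r)\<close> grows, when \<open>1 - r\<close> is halved, by an average factor between \<open>2.1^2\<close>
  and \<open>2.8^2\<close>, which would have to be a power of two.\<close>

unbundle no vec_syntax
unbundle fps_syntax

section \<open>The Thue--Morse morphism and overlaps\<close>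

text \<open>Only the fact that the growth exponent of \<open>u(r)\<close> is not an integer matters,
  not its value. Each end of a word contributes one factor of the eigenvalue when
  \<open>1 - r\<close> is halved, so the square of the eigenvalue has to be kept strictly between 4
  and 8; 441/100 and 196/25 do this. The obstacle is that the two ends of a word are not
  independent: a left and a right extension may each be possible without being possible together.
  For the upper bound this is harmless, since forgetting a constraint only adds words. For the lower
  bound the sums run over words whose ends do not interact, and only ends of length at most one are
  used, which keeps this class stable and makes the parametrisation of its words injective. On the
  algebraic side, testing with derivations takes the place of elimination in the polynomial system.
  It requires division, hence Laurent series as ambient field; the base ring consists of integer
  polynomials because Fatou's argument lives on integrality.\<close>

definition overlap_at :: "'a list \<Rightarrow> nat \<Rightarrow> nat \<Rightarrow> bool" where
  "overlap_at w i p \<longleftrightarrow> 0 < p \<and> i + 2 * p < length w \<and> (\<forall>j\<le>p. w ! (i + j) = w ! (i + j + p))"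

definition overlap_free :: "'a list \<Rightarrow> bool" where
  "overlap_free w \<longleftrightarrow> (\<forall>i p. \<not> overlap_at w i p)"

lemma overlap_at_append1: "i + 2 * p < length u \<Longrightarrow> overlap_at (u @ v) i p \<longleftrightarrow> overlap_at u i p"
  by (auto simp: overlap_at_def nth_append)

lemma overlap_at_append2: "overlap_at (u @ v) (length u + i) p \<longleftrightarrow> overlap_at v i p"
  by (auto simp: overlap_at_def nth_append algebra_simps)

lemma overlap_at_Cons: "overlap_at (a # v) (Suc i) p \<longleftrightarrow> overlap_at v i p"
  using overlap_at_append2[of "[a]" v i p] by simp

lemma overlap_free_appendD1: "overlap_free (u @ v) \<Longrightarrow> overlap_free u"
  using overlap_at_append1 by (metis overlap_free_def overlap_at_def)

lemma overlap_free_appendD2: "overlap_free (u @ v) \<Longrightarrow> overlap_free v"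
  using overlap_at_append2 by (metis overlap_free_def)

lemma overlap_free_ConsD: "overlap_free (a # v) \<Longrightarrow> overlap_free v"
  using overlap_free_appendD2[of "[a]" v] by simp

lemma overlap_at_rev:
  assumes "overlap_at w i p"
  shows "overlap_at (rev w) (length w - 1 - i - 2 * p) p"
proof -
  have 1: "0 < p" "i + 2 * p < length w" and 2: "\<And>j. j \<le> p \<Longrightarrow> w ! (i + j) = w ! (i + j + p)"
    using assms by (auto simp: overlap_at_def)
  have "rev w ! (length w - 1 - i - 2 * p + j) = rev w ! (length w - 1 - i - 2 * p + j + p)"
    if "j \<le> p" for j
  proof -
    have "rev w ! (length w - 1 - i - 2 * p + j) = w ! (i + (p - j) + p)"
      using 1 that by (subst rev_nth) (auto intro!: arg_cong[of _ _ "(!) w"])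
    moreover have "rev w ! (length w - 1 - i - 2 * p + j + p) = w ! (i + (p - j))"
      using 1 that by (subst rev_nth) (auto intro!: arg_cong[of _ _ "(!) w"])
    ultimately show ?thesis using 2[of "p - j"] by simp
  qed
  then show ?thesis using 1 by (auto simp: overlap_at_def)
qed

lemma overlap_free_rev [simp]: "overlap_free (rev w) \<longleftrightarrow> overlap_free w"
  using overlap_at_rev by (metis overlap_free_def rev_rev_ident)

lemma overlap_free_map_inj:
  assumes "inj f"
  shows "overlap_free (map f w) \<longleftrightarrow> overlap_free w"
proof -
  have "overlap_at (map f w) i p \<longleftrightarrow> overlap_at w i p" for i p
    using inj_eq[OF assms] by (auto simp: overlap_at_def)
  then show ?thesis by (simp add: overlap_free_def)
qed

lemma inj_Not: "inj Not"
  by (rule injI) simp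

lemma overlap_free_map_Not [simp]: "overlap_free (map Not w) \<longleftrightarrow> overlap_free w"
  by (rule overlap_free_map_inj[OF inj_Not])

lemma overlap_free_iff_no_overlap: "overlap_free w \<longleftrightarrow> \<not> (\<exists>u. overlap u \<and> sublist u w)"
proof -
  have "\<exists>u. overlap u \<and> sublist u w" if "overlap_at w i p" for i p
  proof -
    have 1: "0 < p" "i + 2 * p < length w" and 2: "\<And>j. j \<le> p \<Longrightarrow> w ! (i + j) = w ! (i + j + p)"
      using that by (auto simp: overlap_at_def)
    define u where "u = take (2 * p + 1) (drop i w)"
    define x where "x = take (p - 1) (drop (i + 1) w)"
    have "u = [w ! i] @ x @ [w ! i] @ x @ [w ! i]"
    proof (rule nth_equalityI)
      show "length u = length ([w ! i] @ x @ [w ! i] @ x @ [w ! i])"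
        using 1 by (simp add: u_def x_def)
      fix j assume j: "j < length u"
      then have j2: "j \<le> 2 * p" by (simp add: u_def)
      have lx: "length x = p - 1" using 1 by (simp add: x_def)
      have uj: "u ! j = w ! (i + j)" using j 1 by (simp add: u_def)
      have xj: "x ! k = w ! (i + 1 + k)" if "k < p - 1" for k using that 1 by (simp add: x_def)
      consider "j = 0" | "0 < j" "j < p" | "j = p" | "p < j" "j < 2 * p" | "j = 2 * p"
        using j2 by linarith
      then show "u ! j = ([w ! i] @ x @ [w ! i] @ x @ [w ! i]) ! j"
      proof cases
        case 1 then show ?thesis using uj by simp
      next
        case 2
        then have "j - Suc 0 < p - Suc 0" by linarith
        then show ?thesis using uj xj[of "j - 1"] lx 2 by (simp add: nth_Cons' nth_append)
      next
        case 3
        then show ?thesis using uj lx 2[of 0] 1 by (simp add: nth_Cons' nth_append)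
      next
        case 4
        then obtain k where k: "j = p + 1 + k" by (auto simp: less_iff_Suc_add)
        then have "x ! k = w ! (i + 1 + k)" using 4 by (intro xj) simp
        moreover have "k < p - Suc 0" "\<not> k + p < p - Suc 0" "\<not> p < p - Suc 0" using 4 k by auto
        ultimately show ?thesis using uj lx 2[of "k + 1"] 4 1 k
          by (simp add: nth_Cons' nth_append add_ac)
      next
        case 5
        moreover have "\<not> p + p - Suc 0 < p - Suc 0" by auto
        ultimately show ?thesis using uj lx 2[of 0] 2[of p] 1
          by (simp add: nth_Cons' nth_append mult_2 add.assoc)
      qed
    qed
    then have "overlap u" unfolding overlap_def by blast
    moreover have "sublist u w" unfolding u_def
      by (metis append_take_drop_id sublist_appendI)
    ultimately show ?thesis by blast
  qed
  moreover have "\<not> overlap_free w" if u: "overlap u" "sublist u w" for u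
  proof -
    obtain a x where ax: "u = [a] @ x @ [a] @ x @ [a]" using u by (auto simp: overlap_def)
    obtain ps ss where w: "w = ps @ u @ ss" using u by (auto simp: sublist_def)
    have "overlap_at u 0 (length x + 1)"
      unfolding overlap_at_def ax by (auto simp: nth_append nth_Cons')
    then have "\<not> overlap_free u" by (auto simp: overlap_free_def)
    then show ?thesis using w overlap_free_appendD1 overlap_free_appendD2 by blast
  qed
  ultimately show ?thesis unfolding overlap_free_def by blast
qed

section \<open>Overlaps in a word and in its image under the Thue--Morse morphism\<close>

primrec mu :: "bool list \<Rightarrow> bool list" where
  "mu [] = []"
| "mu (b # w) = b # (\<not> b) # mu w"

lemma length_mu [simp]: "length (mu w) = 2 * length w"
  by (induction w) auto

lemma mu_append [simp]: "mu (u @ v) = mu u @ mu v"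
  by (induction u) auto

lemma rev_mu: "rev (mu w) = mu (map Not (rev w))"
  by (induction w) auto

lemma mu_nth: "i < length w \<Longrightarrow> mu w ! (2 * i) = w ! i \<and> mu w ! (2 * i + 1) = (\<not> w ! i)"
proof (induction w arbitrary: i)
  case (Cons b w)
  then show ?case by (cases i) auto
qed simp

lemma mu_nth_even: "i < length w \<Longrightarrow> mu w ! (2 * i) = w ! i"
  and mu_nth_odd: "i < length w \<Longrightarrow> mu w ! (2 * i + 1) = (\<not> w ! i)"
  using mu_nth by blast+

lemma mu_nth_neq:
  assumes "even m" "m < 2 * length w"
  shows "mu w ! (m + 1) = (\<not> mu w ! m)"
  using assms mu_nth[of "m div 2" w] by auto

lemma mu_inj: "mu u = mu v \<Longrightarrow> u = v"
proof (induction u arbitrary: v)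
  case Nil then show ?case by (cases v) auto
next
  case (Cons a u) then show ?case by (cases v) auto
qed

text \<open>An odd period would make the letters of the repetition alternate: a block boundary of one
  occurrence of the period lies inside a block of the next one.\<close>

lemma overlap_at_mu:
  assumes "overlap_at (mu w) i p"
  shows "even p" "overlap_at w (i div 2) (p div 2)"
proof -
  have 1: "0 < p" "i + 2 * p < 2 * length w"
    and 2: "\<And>j. j \<le> p \<Longrightarrow> mu w ! (i + j) = mu w ! (i + j + p)"
    using assms by (auto simp: overlap_at_def)
  show e: "even p"
  proof (rule ccontr)
    assume o: "odd p"
    have step: "mu w ! (i + j + 1) = (\<not> mu w ! (i + j))" if "j < p" for j
    proof (cases "even (i + j)")
      case True
      then show ?thesis using mu_nth_neq[of "i + j" w] 1 that by simp
    next
      case False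
      then have "mu w ! (i + j + p + 1) = (\<not> mu w ! (i + j + p))"
        using mu_nth_neq[of "i + j + p" w] 1 o that by simp
      then show ?thesis using 2[of j] 2[of "j + 1"] that by (simp add: algebra_simps)
    qed
    have "mu w ! (i + j) = (if even j then mu w ! i else \<not> mu w ! i)" if "j \<le> p" for j
      using that
    proof (induction j)
      case (Suc j)
      then show ?case using step[of j] by auto
    qed simp
    from this[of p] o 2[of 0] show False by simp
  qed
  define q where "q = p div 2"
  have p: "p = 2 * q" using e by (simp add: q_def)
  define k where "k = i div 2"
  have "w ! (k + j) = w ! (k + j + q)" if "j \<le> q" for j
  proof (cases "even i")
    case True
    then have i: "i = 2 * k" by (simp add: k_def)
    have "mu w ! (2 * (k + j)) = mu w ! (2 * (k + j + q))"
      using 2[of "2 * j"] that by (simp add: p i algebra_simps)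
    moreover have "k + j + q < length w" using 1 that by (simp add: p i)
    ultimately show ?thesis using mu_nth_even[of "k + j" w] mu_nth_even[of "k + j + q" w] by simp
  next
    case False
    then have i: "i = 2 * k + 1" by (simp add: k_def)
    have "mu w ! (2 * (k + j) + 1) = mu w ! (2 * (k + j + q) + 1)"
      using 2[of "2 * j"] that by (simp add: p i algebra_simps)
    moreover have "k + j + q < length w" using 1 that by (simp add: p i)
    ultimately show ?thesis using mu_nth_odd[of "k + j" w] mu_nth_odd[of "k + j + q" w] by simp
  qed
  moreover have "k + 2 * q < length w" using 1 by (simp add: k_def p)
  ultimately show "overlap_at w (i div 2) (p div 2)"
    unfolding k_def[symmetric] q_def[symmetric] using 1 p by (auto simp: overlap_at_def)
qed

text \<open>The image of an overlap of period \<open>q\<close> has length \<open>4 * q + 2\<close>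
  and period \<open>2 * q\<close>, one letter more than an overlap needs. The second of the two
  overlaps in it survives the loss of the first letter.\<close>

lemma overlap_at_mu_lift:
  assumes "overlap_at w k q"
  shows "overlap_at (mu w) (2 * k) (2 * q)" "overlap_at (mu w) (2 * k + 1) (2 * q)"
proof -
  have 1: "0 < q" "k + 2 * q < length w" and 2: "\<And>j. j \<le> q \<Longrightarrow> w ! (k + j) = w ! (k + j + q)"
    using assms by (auto simp: overlap_at_def)
  have 3: "mu w ! (2 * k + j) = mu w ! (2 * k + j + 2 * q)" if j: "j \<le> 2 * q + 1" for j
  proof (cases "even j")
    case True
    then obtain l where l: "j = 2 * l" by blast
    then show ?thesis using mu_nth_even[of "k + l" w] mu_nth_even[of "k + l + q" w] 1 2[of l] j
      by (simp add: algebra_simps)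
  next
    case False
    then obtain l where l: "j = 2 * l + 1" by (rule oddE)
    then show ?thesis using mu_nth_odd[of "k + l" w] mu_nth_odd[of "k + l + q" w] 1 2[of l] j
      by (simp add: algebra_simps)
  qed
  show "overlap_at (mu w) (2 * k) (2 * q)" "overlap_at (mu w) (2 * k + 1) (2 * q)"
    using 1 3 3[of "Suc _"] by (auto simp: overlap_at_def)
qed

lemma overlap_free_mu: "overlap_free (mu w) \<longleftrightarrow> overlap_free w"
  using overlap_at_mu(2) overlap_at_mu_lift(1) unfolding overlap_free_def by blast

text \<open>The word \<open>a # mu y\<close> is \<open>mu ((\<not> a) # y)\<close> without its first
  letter, and the overlap that starts at the odd place of an image does not use that letter.\<close>

lemma overlap_free_Cons_mu: "overlap_free (a # mu y) \<longleftrightarrow> overlap_free ((\<not> a) # y)"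
proof
  assume a: "overlap_free (a # mu y)"
  show "overlap_free ((\<not> a) # y)"
    unfolding overlap_free_def
  proof (intro allI notI)
    fix i p assume "overlap_at ((\<not> a) # y) i p"
    from overlap_at_mu_lift(2)[OF this] have "overlap_at ((\<not> a) # a # mu y) (Suc (2 * i)) (2 * p)"
        by simp
    then have "overlap_at (a # mu y) (2 * i) (2 * p)" by (simp only: overlap_at_Cons)
    with a show False by (auto simp: overlap_free_def)
  qed
next
  assume "overlap_free ((\<not> a) # y)"
  then have "overlap_free (mu ((\<not> a) # y))" by (simp only: overlap_free_mu)
  then have "overlap_free ((\<not> a) # a # mu y)" by simp
  then show "overlap_free (a # mu y)" by (rule overlap_free_ConsD)
qed

text \<open>Mirror image of \<open>overlap_free_Cons_mu\<close>: reversal turns \<open>mu y\<close>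
  into \<open>mu\<close> of the complemented reversal.\<close>

lemma overlap_free_mu_snoc: "overlap_free (mu y @ [c]) \<longleftrightarrow> overlap_free (y @ [c])"
proof -
  have "overlap_free (mu y @ [c]) \<longleftrightarrow> overlap_free (rev (mu y @ [c]))" by (simp only:
      overlap_free_rev)
  also have "\<dots> \<longleftrightarrow> overlap_free ((\<not> c) # map Not (rev y))" by (simp add: rev_mu overlap_free_Cons_mu)
  also have "\<dots> \<longleftrightarrow> overlap_free (map Not (rev (y @ [c])))" by simp
  finally show ?thesis by (simp only: overlap_free_map_Not overlap_free_rev)
qed

text \<open>The word is \<open>mu ((\<not> a) # y @ [c])\<close> without its two outer letters. An
  overlap in it pulls back to one in \<open>(\<not> a) # y @ [c]\<close>. By the length bound the
  latter cannot cover both end letters, so it lies in one of the two words assumed to be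
  overlap-free.\<close>

lemma overlap_free_Cons_mu_snoc:
  assumes "overlap_free ((\<not> a) # y)" "overlap_free (y @ [c])"
  shows "overlap_free (a # mu y @ [c])"
  unfolding overlap_free_def
proof (intro allI notI)
  fix i p assume ovl: "overlap_at (a # mu y @ [c]) i p"
  then have len: "i + 2 * p < 2 * length y + 2" by (simp add: overlap_at_def)
  have "overlap_at (((\<not> a) # a # mu y @ [c]) @ [\<not> c]) (Suc i) p"
    using ovl len by (subst overlap_at_append1) (auto simp: overlap_at_Cons)
  then have "overlap_at (mu ((\<not> a) # y @ [c])) (Suc i) p" by simp
  note * = overlap_at_mu[OF this]
  define q where "q = p div 2"
  have p: "p = 2 * q" using *(1) by (simp add: q_def)
  have o: "overlap_at ((\<not> a) # y @ [c]) (Suc i div 2) q" using *(2) by (simp add: q_def)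
  show False
  proof (cases "Suc i div 2")
    case 0
    then have "2 * q < Suc (length y)" using len p by simp
    then have "overlap_at ((\<not> a) # y) 0 q" using o 0 overlap_at_append1[of 0 q "(\<not> a) # y" "[c]"]
        by simp
    then show False using assms by (auto simp: overlap_free_def)
  next
    case (Suc k)
    then have "overlap_at (y @ [c]) k q" using o by (simp add: overlap_at_Cons)
    then show False using assms by (auto simp: overlap_free_def)
  qed
qed

section \<open>Attaching short ends to a Thue--Morse image\<close>

lemma not_overlap_at_double:
  assumes y: "take 3 y = [\<not> a, a, \<not> a]" and len: "4 \<le> length y" "length z \<le> 2"
  shows "\<not> overlap_at (a # a # mu y @ z) 0 p"
proof
  define w where "w = a # a # mu y @ z"
  assume "overlap_at (a # a # mu y @ z) 0 p"
  then have 1: "0 < p" "2 * p < length w" and 2: "\<And>j. j \<le> p \<Longrightarrow> w ! j = w ! (j + p)"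
    by (auto simp: overlap_at_def w_def)
  have lw: "length w = 2 * length y + 2 + length z" by (simp add: w_def)
  define t where "t = drop 3 y"
  have "y = [\<not> a, a, \<not> a] @ t" using y by (metis append_take_drop_id t_def)
  then have w: "w = a # a # (\<not> a) # a # a # (\<not> a) # (\<not> a) # a # mu t @ z" by (simp add: w_def)
  have blocks: "w ! (m + 1) = (\<not> w ! m)" if m: "even m" "2 \<le> m" "m < 2 + 2 * length y" for m
  proof -
    obtain l where "m = 2 * l" using m by blast
    then obtain k where k: "m = 2 * k + 2" using m by (cases l) auto
    then have "k < length y" using m by simp
    then show ?thesis using mu_nth[of k y] by (simp add: k w_def nth_append)
  qed
  \<comment> \<open>Periods up to 5 fail on the explicit prefix. A longer period moves a pair of
    equal letters, the one at 0 or the one at 3 according to the parity of \<open>p\<close>, onto a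
    block, whose two letters differ.\<close>
  consider "p = 1" | "p = 2" | "p = 3" | "p = 4" | "p = 5" | "6 \<le> p" using 1 by linarith
  then show False
  proof cases
    case 1 then show False using 2[of 1] by (simp add: w)
  next
    case 2 then show False using \<open>\<And>j. j \<le> p \<Longrightarrow> w ! j = w ! (j + p)\<close>[of 0] by (simp add: w)
  next
    case 3 then show False using 2[of 3] by (simp add: w)
  next
    case 4 then show False using 2[of 1] by (simp add: w)
  next
    case 5 then show False using 2[of 0] by (simp add: w)
  next
    case 6
    show False
    proof (cases "even p")
      case True
      then show False using blocks[of p] 2[of 0] 2[of 1] 6 1 lw len by (simp add: w)
    next
      case False
      have e: "w ! 3 = w ! 4" by (simp add: w)
      have "w ! (p + 3 + 1) = (\<not> w ! (p + 3))" using False 6 1 lw len by (intro blocks) auto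
      then show False using e 2[of 3] 2[of 4] 6 by (simp add: add.commute)
    qed
  qed
qed

definition edge :: "bool list \<Rightarrow> bool" where
  "edge x \<longleftrightarrow> x = [] \<or> (\<exists>a. x = [a] \<or> x = [a, a])"

text \<open>For \<open>y\<close> overlap-free and long enough, this is the condition for
  \<open>x\<close> to be an admissible left end of \<open>mu y\<close>: see
  \<open>overlap_free_edges\<close> and \<open>left_ok_necessary\<close>. The pattern required by a
  double letter is forced by overlaps of periods 1, 2 and 3.\<close>

definition left_ok :: "bool list \<Rightarrow> bool list \<Rightarrow> bool" where
  "left_ok x y \<longleftrightarrow> x = [] \<or>
     (\<exists>a. overlap_free ((\<not> a) # y) \<and> (x = [a] \<or> x = [a, a] \<and> take 3 y = [\<not> a, a, \<not> a]))"

text \<open>The complement enters because \<open>rev (mu y)\<close> is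
  \<open>mu (map Not (rev y))\<close>.\<close>

definition right_ok :: "bool list \<Rightarrow> bool list \<Rightarrow> bool" where
  "right_ok z y \<longleftrightarrow> left_ok (rev z) (map Not (rev y))"

lemma edgeI:
  assumes "length x \<in> {0, 1, 2}" "length x = 2 \<Longrightarrow> x ! 0 = x ! 1"
  shows "edge x"
proof -
  from assms(1) consider "x = []" | a where "x = [a]" | a b where "x = [a, b]"
    by (auto simp: length_Suc_conv eval_nat_numeral)
  then show ?thesis using assms(2) by cases (auto simp: edge_def)
qed

lemma left_ok_Nil [simp]: "left_ok [] y"
  and left_ok_single [simp]: "left_ok [a] y \<longleftrightarrow> overlap_free ((\<not> a) # y)"
  and left_ok_double: "left_ok [a, b] y \<longleftrightarrow> a = b \<and> overlap_free ((\<not> a) # y) \<and> take 3 y = [\<not> a, a, \<not>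
      a]"
  by (auto simp: left_ok_def)

lemma left_ok_length: "left_ok x y \<Longrightarrow> length x \<le> 2"
  by (auto simp: left_ok_def)

lemma right_ok_Nil [simp]: "right_ok [] y"
  by (simp add: right_ok_def)

lemma right_ok_single [simp]: "right_ok [c] y \<longleftrightarrow> overlap_free (y @ [c])"
proof -
  have "right_ok [c] y \<longleftrightarrow> overlap_free (map Not (rev (y @ [c])))" by (simp add: right_ok_def)
  then show ?thesis by (simp only: overlap_free_map_Not overlap_free_rev)
qed

lemma map_Not_Not: "map Not (map Not x) = x"
  by (induction x) auto

lemma right_ok_rev: "right_ok (rev x) (map Not (rev y)) \<longleftrightarrow> left_ok x y"
  by (simp only: right_ok_def rev_rev_ident rev_map map_Not_Not)

lemma overlap_free_add_double:
  assumes "overlap_free (a # mu y @ z)" "take 3 y = [\<not> a, a, \<not> a]" "4 \<le> length y" "length z \<le> 2"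
  shows "overlap_free (a # a # mu y @ z)"
  unfolding overlap_free_def
proof (intro allI notI)
  fix i p assume *: "overlap_at (a # a # mu y @ z) i p"
  show False
  proof (cases i)
    case 0
    then show False using * not_overlap_at_double[OF assms(2-4)] by simp
  next
    case (Suc k)
    then show False using * assms(1) by (simp add: overlap_at_Cons overlap_free_def)
  qed
qed

lemma overlap_free_edges_single:
  assumes "overlap_free y" "left_ok x y" "right_ok z y" "length x \<le> 1" "length z \<le> 1"
  shows "overlap_free (x @ mu y @ z)"
proof -
  have "x = [] \<or> (\<exists>a. x = [a])" using assms(4) by (cases x) auto
  moreover have "z = [] \<or> (\<exists>c. z = [c])" using assms(5) by (cases z) auto
  ultimately show ?thesis using assms(1-3)
    by (auto simp: overlap_free_mu overlap_free_Cons_mu overlap_free_mu_snoc intro: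
        overlap_free_Cons_mu_snoc)
qed

lemma overlap_free_edges_left:
  assumes "overlap_free y" "left_ok x y" "right_ok z y" "length z \<le> 1" "4 \<le> length y"
  shows "overlap_free (x @ mu y @ z)"
proof (cases "length x \<le> 1")
  case True
  then show ?thesis by (intro overlap_free_edges_single assms)
next
  case False
  with assms(2) have "\<exists>a. x = [a, a] \<and> take 3 y = [\<not> a, a, \<not> a] \<and> overlap_free ((\<not> a) # y)"
    unfolding left_ok_def by fastforce
  then obtain a where a: "x = [a, a]" "take 3 y = [\<not> a, a, \<not> a]" "overlap_free ((\<not> a) # y)"
    by blast
  have "overlap_free ([a] @ mu y @ z)"
    using a assms by (intro overlap_free_edges_single) auto
  then show ?thesis using overlap_free_add_double[of a y z] a assms by simp
qed

text \<open>The letters are attached one by one: single letters through the results on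
  \<open>mu\<close>, then a second letter on the left, and a second letter on the right after a
  reversal. Both ends are tested against \<open>y\<close> only, not against each other; this
  independence is what makes weights of the two ends multiply.\<close>

lemma overlap_free_edges:
  assumes "overlap_free y" "left_ok x y" "right_ok z y" "4 \<le> length y"
  shows "overlap_free (x @ mu y @ z)"
proof (cases "length z \<le> 1")
  case True
  then show ?thesis by (intro overlap_free_edges_left assms)
next
  case False
  define y' where "y' = map Not (rev y)"
  have z: "left_ok (rev z) y'" using assms(3) by (simp add: right_ok_def y'_def)
  with False have "\<exists>c. rev z = [c, c] \<and> take 3 y' = [\<not> c, c, \<not> c] \<and> overlap_free ((\<not> c) # y')"
    unfolding left_ok_def by fastforce
  then obtain c where c: "rev z = [c, c]" "take 3 y' = [\<not> c, c, \<not> c]" "overlap_free ((\<not> c) # y')"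
    by blast
  have z': "z = [c, c]" using c(1) by (simp add: rev_swap)
  have "right_ok [c] y" using c(3) by (simp add: right_ok_def y'_def)
  then have "overlap_free (x @ mu y @ [c])"
    using assms by (intro overlap_free_edges_left) auto
  then have "overlap_free (rev (x @ mu y @ [c]))" by (simp only: overlap_free_rev)
  then have "overlap_free (c # mu y' @ rev x)" by (simp add: rev_mu y'_def)
  then have "overlap_free (c # c # mu y' @ rev x)"
    using c assms left_ok_length[OF assms(2)] by (intro overlap_free_add_double) (auto simp: y'_def)
  then have "overlap_free (rev (x @ mu y @ z))" by (simp add: rev_mu y'_def z')
  then show ?thesis by (simp only: overlap_free_rev)
qed

section \<open>Necessary conditions on the ends, and the decomposition of overlap-free words\<close>

lemma not_overlap_free1: "\<not> overlap_free (a # a # a # t)"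
proof -
  have "overlap_at (a # a # a # t) 0 1" by (auto simp: overlap_at_def nth_Cons' le_Suc_eq)
  then show ?thesis by (auto simp: overlap_free_def)
qed

lemma not_overlap_free2: "\<not> overlap_free (a # b # a # b # a # t)"
proof -
  have "overlap_at (a # b # a # b # a # t) 0 2" by (auto simp: overlap_at_def nth_Cons' le_Suc_eq
      numeral_2_eq_2)
  then show ?thesis by (auto simp: overlap_free_def)
qed

lemma not_overlap_free3: "\<not> overlap_free (a # b # c # a # b # c # a # t)"
proof -
  have "overlap_at (a # b # c # a # b # c # a # t) 0 3"
    by (auto simp: overlap_at_def nth_Cons' le_Suc_eq numeral_3_eq_3)
  then show ?thesis by (auto simp: overlap_free_def)
qed

text \<open>Each wrong letter of \<open>y\<close> creates a short overlap: first letter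
  \<open>a\<close> one of period 1, second letter \<open>\<not> a\<close> one of period 2, third
  letter \<open>a\<close> one of period 3.\<close>

lemma overlap_free_double_pattern:
  assumes "overlap_free (a # a # mu y @ z)" "3 \<le> length y"
  shows "take 3 y = [\<not> a, a, \<not> a]"
proof -
  from assms(2) obtain b c d t where y: "y = b # c # d # t"
    by (metis Suc_le_length_iff numeral_3_eq_3)
  have f: "overlap_free (a # a # b # (\<not> b) # c # (\<not> c) # d # (\<not> d) # mu t @ z)"
    using assms(1) by (simp add: y)
  have b: "b = (\<not> a)" using f not_overlap_free1[of a] by (cases "b = a") auto
  have c: "c = a"
  proof (rule ccontr)
    assume "c \<noteq> a"
    then have c': "c = (\<not> a)" by simp
    have "overlap_free (a # (\<not> a) # a # (\<not> a) # a # d # (\<not> d) # mu t @ z)"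
      using overlap_free_ConsD[OF f] by (simp add: b c')
    then show False using not_overlap_free2[of a] by blast
  qed
  have d: "d = (\<not> a)"
  proof (rule ccontr)
    assume "d \<noteq> (\<not> a)"
    then have "d = a" by auto
    then show False using f b c not_overlap_free3[of a a "\<not> a" "(\<not> d) # mu t @ z"] by auto
  qed
  show ?thesis by (simp add: y b c d)
qed

lemma left_ok_necessary:
  assumes "overlap_free (x @ mu y @ z)" "edge x" "3 \<le> length y"
  shows "left_ok x y"
proof -
  from assms(2) consider "x = []" | a where "x = [a]" | a where "x = [a, a]" by (auto simp:
      edge_def)
  then show ?thesis
  proof cases
    case 2
    then have "overlap_free (a # mu y)" using assms(1) overlap_free_appendD1[of "a # mu y" z] by
        simp
    then show ?thesis using 2 by (simp add: overlap_free_Cons_mu)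
  next
    case 3
    then have "overlap_free (a # a # mu y @ z)" using assms(1) by simp
    note p = overlap_free_double_pattern[OF this assms(3)]
    have "overlap_free (a # mu y)"
      using overlap_free_ConsD[OF \<open>overlap_free (a # a # mu y @ z)\<close>] overlap_free_appendD1[of "a #
          mu y" z] by simp
    then show ?thesis using 3 p by (simp add: left_ok_double overlap_free_Cons_mu)
  qed simp
qed

text \<open>Inner squares of letters in an overlap-free word are at even distance, so the blocks of a
  Thue--Morse decomposition can be placed at the positions of the other parity.\<close>

lemma inner_squares_parity:
  fixes w :: "bool list"
  assumes f: "overlap_free w"
    and i: "1 \<le> i" "w ! i = w ! (i + 1)"
    and j: "i < j" "j + 2 < length w" "w ! j = w ! (j + 1)"
  shows "even (j - i)"
  using i j
proof (induction "j - i" arbitrary: i rule: less_induct)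
  case less
  have nov: "\<not> overlap_at w m p" for m p using f by (auto simp: overlap_free_def)
  have n1: "w ! (i + 1) \<noteq> w ! (i + 2)"
    using nov[of i 1] less.prems by (auto simp: overlap_at_def le_Suc_eq)
  have n0: "w ! (i - 1) \<noteq> w ! i"
    using nov[of "i - 1" 1] less.prems by (auto simp: overlap_at_def le_Suc_eq)
  \<comment> \<open>With the letters around them, two squares at distance 3 would spell an overlap
    of period 3; these outer letters exist because the squares are inner ones.\<close>
  have n3: "\<not> (i + 3 \<le> j \<and> w ! (i + 2) \<noteq> w ! (i + 3) \<and> w ! (i + 3) = w ! (i + 4))"
  proof
    assume *: "i + 3 \<le> j \<and> w ! (i + 2) \<noteq> w ! (i + 3) \<and> w ! (i + 3) = w ! (i + 4)"
    obtain k where k: "i = Suc k" using less.prems(1) by (cases i) auto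
    have l: "k + 6 < length w" using * less.prems k by simp
    have "w ! (i + 5) \<noteq> w ! (i + 4)"
      using nov[of "i + 3" 1] * l k by (auto simp: overlap_at_def le_Suc_eq eval_nat_numeral)
    then have "overlap_at w k 3"
      using less.prems(2) n0 n1 * l unfolding overlap_at_def k
      by (auto simp: le_Suc_eq eval_nat_numeral)
    then show False using nov by blast
  qed
  \<comment> \<open>Without a further square up to distance 4 there are five alternating letters, an
    overlap of period 2. Hence the next square is at distance 2 or 4, and induction applies.\<close>
  have n4: "\<not> (i + 4 \<le> j \<and> w ! (i + 2) \<noteq> w ! (i + 3) \<and> w ! (i + 3) \<noteq> w ! (i + 4) \<and> w ! (i + 4) \<noteq> w
      ! (i + 5))"
  proof
    assume *: "i + 4 \<le> j \<and> w ! (i + 2) \<noteq> w ! (i + 3) \<and> w ! (i + 3) \<noteq> w ! (i + 4) \<and> w ! (i + 4) \<noteq> w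
        ! (i + 5)"
    then have "overlap_at w (i + 1) 2"
      using less.prems n1 unfolding overlap_at_def
      by (auto simp: le_Suc_eq eval_nat_numeral)
    then show False using nov by blast
  qed
  have IH: "even (j - i)" if k: "k = 2 \<or> k = 4" "i + k \<le> j" "w ! (i + k) = w ! (i + k + 1)" for k
  proof (cases "i + k = j")
    case True
    then show ?thesis using k by auto
  next
    case False
    then have "even (j - (i + k))" using k less.prems by (intro less.hyps) auto
    then show ?thesis using k by auto
  qed
  have c: "j \<noteq> i + 1" using n1 less.prems by auto
  show ?case
  proof (cases "w ! (i + 2) = w ! (i + 3)")
    case True
    then show ?thesis using IH[of 2] c less.prems by (auto simp: numeral_3_eq_3)
  next
    case False
    then have "j \<noteq> i + 2" using less.prems by (auto simp: numeral_3_eq_3)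
    then have "i + 3 \<le> j" using c less.prems by simp
    then have 4: "w ! (i + 3) \<noteq> w ! (i + 4)" using n3 False by blast
    then have "j \<noteq> i + 3" using less.prems by (auto simp: eval_nat_numeral)
    then have "i + 4 \<le> j" using \<open>i + 3 \<le> j\<close> by simp
    then have "w ! (i + 4) = w ! (i + 5)" using n4 False 4 by blast
    then show ?thesis using IH[of 4] \<open>i + 4 \<le> j\<close> by (simp add: eval_nat_numeral)
  qed
qed

lemma blocks_mu:
  assumes "length v = 2 * m" "\<And>k. k < m \<Longrightarrow> v ! (2 * k) \<noteq> v ! (2 * k + 1)"
  shows "\<exists>y. v = mu y"
  using assms
proof (induction m arbitrary: v)
  case 0
  then show ?case by (intro exI[of _ "[]"]) simp
next
  case (Suc m)
  then obtain a b v' where v: "v = a # b # v'" "length v' = 2 * m"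
    by (auto simp: length_Suc_conv)
  have "\<exists>y. v' = mu y"
    using v Suc.prems(2)[of "Suc _"] by (intro Suc.IH) auto
  then obtain y where "v' = mu y" by blast
  then show ?case using v Suc.prems(2)[of 0] by (intro exI[of _ "a # y"]) auto
qed

lemma overlap_free_decompose:
  assumes "overlap_free w"
  shows "\<exists>x y z. w = x @ mu y @ z \<and> edge x \<and> edge z \<and> overlap_free y"
proof -
  define n where "n = length w"
  define pair where "pair i \<longleftrightarrow> w ! i = w ! (i + 1)" for i
  have par: "even i \<longleftrightarrow> even j" if "1 \<le> i" "i + 2 < n" "pair i" "1 \<le> j" "j + 2 < n" "pair j" for i j
  proof (cases i j rule: linorder_cases)
    case less
    then show ?thesis using inner_squares_parity[OF assms, of i j] that
      by (auto simp: n_def pair_def)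
  next
    case greater
    then show ?thesis using inner_squares_parity[OF assms, of j i] that
      by (auto simp: n_def pair_def)
  qed simp
  obtain s where s: "\<And>i. 1 \<le> i \<Longrightarrow> i + 2 < n \<Longrightarrow> pair i \<Longrightarrow> even i = s"
  proof (cases "\<exists>i\<ge>1. i + 2 < n \<and> pair i")
    case True
    then obtain i where "1 \<le> i" "i + 2 < n" "pair i" by blast
    then show ?thesis using that[of "even i"] par by blast
  next
    case False
    then show ?thesis using that[of True] by blast
  qed
  \<comment> \<open>Blocks must start at the parity opposite to that of the inner squares. A square
    at the very beginning is not inner and may have the wrong parity; it is then cut off as a left
    end of length 2. The choice of \<open>e\<close> treats the right end in the same way.\<close>
  define a where "a = (if n = 0 then 0 else if s then 1 else if 2 \<le> n \<and> pair 0 then 2 else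
      (0::nat))"
  define r where "r = n - a"
  define e where "e = (if odd r then 1 else if 2 \<le> r \<and> pair (n - 2) then 2 else (0::nat))"
  define m where "m = (r - e) div 2"
  have an: "a \<le> n" by (auto simp: a_def)
  have "even (r - e)" "e \<le> r" by (auto simp: e_def elim: oddE)
  then have len: "n = a + 2 * m + e" using an by (auto simp: m_def r_def)
  define v where "v = take (2 * m) (drop a w)"
  have "\<exists>y. v = mu y"
  proof (rule blocks_mu)
    show "length v = 2 * m" using len by (simp add: v_def n_def[symmetric])
    fix k assume k: "k < m"
    define i where "i = a + 2 * k"
    have i: "i + 2 + e \<le> n" using k len by (simp add: i_def)
    have "\<not> pair i"
    proof (cases "i = 0 \<or> i + 2 = n")
      case True
      then show ?thesis
      proof
        assume "i = 0"
        then show ?thesis using i by (auto simp: i_def a_def split: if_splits)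
      next
        assume "i + 2 = n"
        moreover from this have "e = 0" "2 \<le> r" using i len k by (auto simp: r_def)
        ultimately show ?thesis by (auto simp: e_def split: if_splits)
      qed
    next
      case False
      then have "pair i \<Longrightarrow> even i = s" using s[of i] i by simp
      moreover have "even i \<noteq> s" using i by (auto simp: i_def a_def split: if_splits)
      ultimately show ?thesis by blast
    qed
    then show "v ! (2 * k) \<noteq> v ! (2 * k + 1)"
      using k len by (simp add: v_def pair_def i_def n_def)
  qed
  then obtain y where y: "v = mu y" by blast
  define x where "x = take a w"
  define z where "z = drop (2 * m) (drop a w)"
  have w: "w = x @ mu y @ z" unfolding x_def z_def y[symmetric] v_def by (simp only:
      append_take_drop_id)
  have "edge x"
  proof -
    have "length x = a" using an by (simp add: x_def n_def)
    moreover have "x ! 0 = x ! 1" if "a = 2"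
      using that an by (auto simp: x_def a_def pair_def split: if_splits)
    moreover have "a \<in> {0, 1, 2}" by (auto simp: a_def)
    ultimately show ?thesis by (intro edgeI) simp_all
  qed
  moreover have "edge z"
  proof -
    have lz: "length z = e" using len by (simp add: z_def n_def)
    moreover have "z ! 0 = z ! 1" if "e = 2"
    proof -
      have "pair (n - 2)" using that by (auto simp: e_def split: if_splits)
      moreover have "n - 2 = a + 2 * m" using that len by simp
      ultimately show ?thesis using len that by (simp add: z_def pair_def n_def add.commute[of a
          "2 * m"])
    qed
    moreover have "e \<in> {0, 1, 2}" by (auto simp: e_def)
    ultimately show ?thesis by (intro edgeI) simp_all
  qed
  moreover have "overlap_free y"
    using assms unfolding w by (metis overlap_free_appendD1 overlap_free_appendD2 overlap_free_mu)
  ultimately show ?thesis using w by blast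
qed

section \<open>Weights of overlap-free words\<close>

text \<open>Rounded sub- and superharmonic vectors of the matrix that describes how the left end of
  \<open>x @ mu y @ z\<close> arises from that of \<open>y\<close>; its eigenvalue lies between \<open>2.1\<close> and \<open>2.8\<close>.\<close>

definition upper_wt :: "bool list \<Rightarrow> real" where
  "upper_wt w = (if w ! 0 \<noteq> w ! 1 \<and> w ! 0 = w ! 2 then if overlap_free (w ! 0 # w) then 9 else 4
      else 5)"

definition lower_wt :: "bool list \<Rightarrow> real" where
  "lower_wt w = (let same = overlap_free (w ! 0 # w); other = overlap_free ((\<not> w ! 0) # w) in
     if w ! 0 = w ! 1 then if other then 10 else 0
     else if w ! 0 = w ! 2 then if same then if other then 16 else 11 else if other then 8 else 0
     else if other then 8 else if same then 7 else 0)"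

lemma list3E:
  assumes "3 \<le> length y"
  obtains b c d t where "y = b # c # d # t"
  using assms by (metis Suc_le_length_iff numeral_3_eq_3)

lemma upper_wt_map_Not:
  assumes "3 \<le> length w"
  shows "upper_wt (map Not w) = upper_wt w"
proof -
  obtain b c d t where w: "w = b # c # d # t" using assms by (rule list3E)
  show ?thesis
    using overlap_free_map_Not[of "True # w"] overlap_free_map_Not[of "False # w"]
    by (cases b; cases c; cases d) (simp_all add: upper_wt_def w)
qed

lemma lower_wt_map_Not:
  assumes "3 \<le> length w"
  shows "lower_wt (map Not w) = lower_wt w"
proof -
  obtain b c d t where w: "w = b # c # d # t" using assms by (rule list3E)
  show ?thesis
    using overlap_free_map_Not[of "True # w"] overlap_free_map_Not[of "False # w"]
    by (cases b; cases c; cases d) (simp_all add: lower_wt_def w)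
qed

lemma upper_wt_bounds: "4 \<le> upper_wt w" "upper_wt w \<le> 9"
  by (auto simp: upper_wt_def)

lemma lower_wt_bounds: "0 \<le> lower_wt w" "lower_wt w \<le> 16"
  by (auto simp: lower_wt_def Let_def)

section \<open>How the weights pass from \<open>y\<close> to \<open>x @ mu y @ z\<close>\<close>

definition edges :: "bool list set" where
  "edges = {[], [True], [False], [True, True], [False, False]}"

definition unit_edges :: "bool list set" where
  "unit_edges = {[], [True], [False]}"

lemma edge_iff: "edge x \<longleftrightarrow> x \<in> edges"
  by (auto simp: edge_def edges_def)

text \<open>A bound for the weight of \<open>x @ mu y @ z\<close> in terms of \<open>x\<close> and
  \<open>y\<close> alone. The first three letters of this word are determined by \<open>x\<close>
  and the first two letters of \<open>y\<close>; the question whether its first letter can be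
  repeated on the left is replaced by a necessary condition.\<close>

definition upper_child :: "bool list \<Rightarrow> bool list \<Rightarrow> real" where
  "upper_child x y =
     (if \<not> left_ok x y then 0
      else if x = [] then if y ! 0 = y ! 1 then 9 else 5
      else if length x = 1 then if hd x = y ! 0 then 5 else if take 3 y = [\<not> hd x, hd x, \<not> hd x]
          then 9 else 4
      else 5)"

text \<open>Counterpart for ends of length at most one: it counts only those left extensions of
  \<open>x @ mu y @ z\<close> that are guaranteed by extensions of \<open>y\<close> or by its first
  letters.\<close>

definition lower_child :: "bool list \<Rightarrow> bool list \<Rightarrow> real" where
  "lower_child x y =
     (if \<not> left_ok x y then 0
      else if x = [] then
        if y ! 0 = y ! 1 then if overlap_free ((\<not> y ! 0) # y) then 11 else 0
        else if overlap_free (y ! 0 # y) then 8 else if overlap_free ((\<not> y ! 0) # y) then 7 else 0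
      else if hd x = y ! 0 then 10 else if take 3 y = [\<not> hd x, hd x, \<not> hd x] then 16 else 8)"

lemma take3: "take 3 (b # c # d # t) = [b, c, d]"
  by (simp add: numeral_3_eq_3)

text \<open>The superharmonic inequality, a finite check over the first three letters of
  \<open>y\<close> and its possible left extensions. Only one relation between these data enters: a
  word that begins with a square cannot be preceded by the same letter. The square of 14/5 is just
  below 8.\<close>

lemma sum_upper_child:
  assumes "3 \<le> length y"
  shows "(\<Sum>x\<in>edges. upper_child x y) \<le> 14 / 5 * upper_wt y"
proof -
  obtain b c d t where y: "y = b # c # d # t" using assms by (rule list3E)
  have D: "b = c \<Longrightarrow> \<not> overlap_free (b # y)" using not_overlap_free1[of b] by (simp add: y)
  show ?thesis
    using D unfolding edges_def
    by (cases b; cases c; cases d) (simp_all add: upper_child_def upper_wt_def left_ok_double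
        take3 y)
qed

lemma sum_lower_child:
  assumes "3 \<le> length y"
  shows "21 / 10 * lower_wt y \<le> (\<Sum>x\<in>unit_edges. lower_child x y)"
proof -
  obtain b c d t where y: "y = b # c # d # t" using assms by (rule list3E)
  have D: "b = c \<Longrightarrow> \<not> overlap_free (b # y)" using not_overlap_free1[of b] by (simp add: y)
  show ?thesis
    using D unfolding unit_edges_def
    by (cases b; cases c; cases d) (simp_all add: lower_child_def lower_wt_def y Let_def take3)
qed

lemma upper_child_nonneg: "0 \<le> upper_child x y"
  by (auto simp: upper_child_def)

lemma lower_child_nonneg: "0 \<le> lower_child x y"
  by (auto simp: lower_child_def)

lemma upper_wt_child:
  assumes "overlap_free (x @ mu y @ z)" "edge x" "3 \<le> length y"
  shows "upper_wt (x @ mu y @ z) \<le> upper_child x y"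
proof -
  obtain b c d t where y: "y = b # c # d # t" using assms(3) by (rule list3E)
  have left_ok: "left_ok x y" using left_ok_necessary assms by blast
  from assms(2) consider "x = []" | a where "x = [a]" | a where "x = [a, a]" by (auto simp:
      edge_def)
  then show ?thesis
  proof cases
    case 1
    then show ?thesis using left_ok by (auto simp: upper_child_def upper_wt_def y)
  next
    case 2
    have "take 3 y = [\<not> a, a, \<not> a]" if "overlap_free (a # a # mu y @ z)"
      using overlap_free_double_pattern[OF that assms(3)] .
    then show ?thesis using left_ok 2
      by (cases a; cases b; cases c; cases d) (auto simp: upper_child_def upper_wt_def y take3)
  next
    case 3
    then show ?thesis using left_ok not_overlap_free1[of a] by (auto simp: upper_child_def
        upper_wt_def)
  qed
qed

text \<open>The only words that spoil the independence of the two ends are those of the form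
  \<open>x a x\<close> of a square \<open>a x a x\<close>; a regular word is not one of them.\<close>

definition regular_word :: "bool list \<Rightarrow> bool" where
  "regular_word y \<longleftrightarrow> (\<forall>a c. overlap_free (a # y) \<longrightarrow> overlap_free (y @ [c]) \<longrightarrow> overlap_free (a # y @
      [c]))"

lemma regular_wordD: "regular_word y \<Longrightarrow> overlap_free (a # y) \<Longrightarrow> overlap_free (y @ [c]) \<Longrightarrow>
    overlap_free (a # y @ [c])"
  by (auto simp: regular_word_def)

text \<open>An overlap in \<open>a # y @ [c]\<close> that lies in neither shorter word fills the
  whole word, whose length is even; but overlaps have odd length.\<close>

lemma regular_even:
  assumes "even (length y)"
  shows "regular_word y"
  unfolding regular_word_def
proof (intro allI impI)
  fix a c assume *: "overlap_free (a # y)" "overlap_free (y @ [c])"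
  show "overlap_free (a # y @ [c])"
    unfolding overlap_free_def
  proof (intro allI notI)
    fix i p assume ovl: "overlap_at (a # y @ [c]) i p"
    then have len: "i + 2 * p < length y + 2" by (simp add: overlap_at_def)
    show False
    proof (cases i)
      case (Suc k)
      then show False using ovl * by (auto simp: overlap_at_Cons overlap_free_def)
    next
      case 0
      then have "2 * p < length (a # y)" using len assms 0 by simp presburger
      then have "overlap_at (a # y) 0 p" using ovl 0 overlap_at_append1[of 0 p "a # y" "[c]"] by
          simp
      then show False using * by (auto simp: overlap_free_def)
    qed
  qed
qed

lemma regular_map_Not:
  assumes "regular_word y"
  shows "regular_word (map Not y)"
  unfolding regular_word_def
proof (intro allI impI)
  fix a c assume *: "overlap_free (a # map Not y)" "overlap_free (map Not y @ [c])"
  have "overlap_free ((\<not> a) # y)" "overlap_free (y @ [\<not> c])"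
    using * overlap_free_map_Not[of "(\<not> a) # y"] overlap_free_map_Not[of "y @ [\<not> c]"] by simp_all
  then have "overlap_free ((\<not> a) # y @ [\<not> c])" using regular_wordD[OF assms] by blast
  then show "overlap_free (a # map Not y @ [c])"
    using overlap_free_map_Not[of "(\<not> a) # y @ [\<not> c]"] by simp
qed

lemma regular_rev: "regular_word (rev y) \<longleftrightarrow> regular_word y"
proof -
  have 1: "overlap_free (a # rev y) \<longleftrightarrow> overlap_free (y @ [a])"
    and 2: "overlap_free (rev y @ [a]) \<longleftrightarrow> overlap_free (a # y)"
    and 3: "overlap_free (a # rev y @ [c]) \<longleftrightarrow> overlap_free (c # y @ [a])" for a c
    using overlap_free_rev[of "y @ [a]"] overlap_free_rev[of "a # y"] overlap_free_rev[of "c # y @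
        [a]"] by simp_all
  show ?thesis unfolding regular_word_def 1 2 3 by blast
qed

text \<open>The left extension by the complementary letter completes a block.\<close>

lemma overlap_free_complete_block:
  assumes y: "overlap_free y" "regular_word y" "5 \<le> length y"
    and a: "overlap_free ((\<not> a) # y)" and z: "right_ok z y"
  shows "overlap_free ((\<not> a) # a # mu y @ z)"
proof -
  \<comment> \<open>\<open>right_ok\<close> tests extensions of \<open>y\<close> on the right.
    Regularity transfers this test to the longer word \<open>(\<not> a) # y\<close>, whose image
    contains the completed block.\<close>
  have "right_ok z ((\<not> a) # y)"
  proof -
    define y' where "y' = map Not (rev y)"
    have z': "left_ok (rev z) y'" using z by (simp add: right_ok_def y'_def)
    have m: "map Not (rev ((\<not> a) # y)) = y' @ [a]" by (simp add: y'_def)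
    have reg: "regular_word y'" by (simp add: y'_def regular_map_Not regular_rev y)
    have "overlap_free (map Not (rev ((\<not> a) # y)))" using a by (simp only: overlap_free_map_Not
        overlap_free_rev)
    then have a': "overlap_free (y' @ [a])" by (simp add: y'_def)
    have t: "take 3 (y' @ [a]) = take 3 y'" using y(3) by (simp add: y'_def)
    have "left_ok (rev z) (y' @ [a])"
    proof (cases "rev z = []")
      case False
      then obtain c where c: "overlap_free ((\<not> c) # y')"
        "rev z = [c] \<or> rev z = [c, c] \<and> take 3 y' = [\<not> c, c, \<not> c]"
        using z' unfolding left_ok_def by blast
      then have "overlap_free ((\<not> c) # y' @ [a])" using regular_wordD[OF reg _ a'] by blast
      then show ?thesis using c(2) t unfolding left_ok_def by (metis append_Cons)
    qed simp
    then show ?thesis unfolding right_ok_def m .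
  qed
  then have "overlap_free ([] @ mu ((\<not> a) # y) @ z)"
    using a y by (intro overlap_free_edges) auto
  then show ?thesis by simp
qed

text \<open>For given first three letters, \<open>lower_wt\<close> grows with the set of possible
  left extensions, so it suffices that the extensions counted by \<open>lower_child\<close> exist.
  They come from \<open>overlap_free_edges\<close> with a longer left end, or from
  \<open>overlap_free_complete_block\<close>.\<close>

lemma lower_child_wt:
  assumes y: "overlap_free y" "regular_word y" "5 \<le> length y"
    and x: "x \<in> unit_edges" "left_ok x y" and z: "right_ok z y"
  shows "lower_child x y \<le> lower_wt (x @ mu y @ z)"
proof -
  obtain b c d t where yy: "y = b # c # d # t" by (rule list3E[of y]) (use y(3) in auto)
  have D: "b = c \<Longrightarrow> \<not> overlap_free (b # y)" using not_overlap_free1[of b] by (simp add: yy)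
  have ext: "overlap_free (x @ mu y @ z)" if "left_ok x y" for x
    using that y z by (intro overlap_free_edges) auto
  from x(1) consider "x = []" | a where "x = [a]" by (auto simp: unit_edges_def)
  then show ?thesis
  proof cases
    case 1
    have e: "overlap_free ((\<not> e) # y) \<Longrightarrow> overlap_free (e # mu y @ z)" for e using ext[of "[e]"] by
        simp
    show ?thesis
      using 1 e[of b] e[of "\<not> b"] D
      by (cases b; cases c; cases d) (auto simp: lower_child_def lower_wt_def Let_def yy take3)
  next
    case 2
    have a: "overlap_free ((\<not> a) # y)" using x 2 by simp
    have e: "overlap_free ((\<not> a) # a # mu y @ z)" using overlap_free_complete_block[OF y a z] .
    have p: "take 3 y = [\<not> a, a, \<not> a] \<Longrightarrow> overlap_free (a # a # mu y @ z)"
      using ext[of "[a, a]"] a by (simp add: left_ok_double)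
    show ?thesis
      using 2 e p a
      by (cases a; cases b; cases c; cases d)
        (auto simp: lower_child_def lower_wt_def Let_def yy take3)
  qed
qed

text \<open>A further letter \<open>a\<close> on the left makes a double end, which does not
  interact with the right end by \<open>overlap_free_edges\<close>. The other letter completes a
  block, and then the regularity of \<open>y\<close> applies.\<close>

lemma regular_child_one:
  assumes y: "overlap_free y" "regular_word y" "4 \<le> length y"
  shows "regular_word (a # mu y)"
  unfolding regular_word_def
proof (intro allI impI)
  fix e c assume e: "overlap_free (e # a # mu y)" and "overlap_free ((a # mu y) @ [c])"
  then have "overlap_free (mu y @ [c])" using overlap_free_ConsD[of a "mu y @ [c]"] by simp
  then have c: "overlap_free (y @ [c])" by (simp add: overlap_free_mu_snoc)
  show "overlap_free (e # (a # mu y) @ [c])"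
  proof (cases "e = a")
    case True
    have a: "overlap_free (a # mu y)" using overlap_free_ConsD[OF e] .
    then have "take 3 y = [\<not> a, a, \<not> a]"
      using overlap_free_double_pattern[of a y "[]"] e y True by simp
    then have "left_ok [a, a] y" using a by (simp add: left_ok_double overlap_free_Cons_mu)
    then have "overlap_free ([a, a] @ mu y @ [c])" using c y by (intro overlap_free_edges) auto
    then show ?thesis using True by simp
  next
    case False
    then have ea: "e = (\<not> a)" by auto
    then have "overlap_free (mu ((\<not> a) # y))" using e by simp
    then have "overlap_free ((\<not> a) # y)" by (simp only: overlap_free_mu)
    then have "overlap_free ((\<not> a) # y @ [c])" using c regular_wordD[OF y(2)] by blast
    then have "overlap_free (mu ((\<not> a) # y @ [c]))" by (simp only: overlap_free_mu)
    then have "overlap_free (((\<not> a) # a # mu y @ [c]) @ [\<not> c])" by simp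
    then have "overlap_free ((\<not> a) # a # mu y @ [c])" by (rule overlap_free_appendD1)
    then show ?thesis by (simp add: ea)
  qed
qed

text \<open>Two nonempty ends or none give even length; a single one is treated by
  \<open>regular_child_one\<close>, after a reversal if it is on the right.\<close>

lemma regular_child:
  assumes y: "overlap_free y" "regular_word y" "4 \<le> length y" and "x \<in> unit_edges" "z \<in> unit_edges"
  shows "regular_word (x @ mu y @ z)"
proof (cases "even (length x + length z)")
  case True
  then show ?thesis by (intro regular_even) simp
next
  case False
  then have "z = [] \<and> (\<exists>a. x = [a]) \<or> x = [] \<and> (\<exists>c. z = [c])"
    using assms(4,5) by (auto simp: unit_edges_def)
  then show ?thesis
  proof (elim disjE conjE exE)
    fix a assume "z = []" "x = [a]"
    then show ?thesis using regular_child_one[OF y] by simp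
  next
    fix c assume "x = []" "z = [c]"
    have "regular_word (rev (mu y @ [c]))"
      using regular_child_one[of "map Not (rev y)" c] y by (simp add: rev_mu regular_map_Not
          regular_rev)
    then show ?thesis using \<open>x = []\<close> \<open>z = [c]\<close> by (simp only: regular_rev append_Nil)
  qed
qed

lemma unit_edges_length: "x \<in> unit_edges \<Longrightarrow> length x \<le> 1"
  by (auto simp: unit_edges_def)

text \<open>If blocks fitted at both parities, neighbouring letters would differ all along the
  beginning, and five alternating letters are an overlap.\<close>

lemma child_shift_contra:
  assumes "overlap_free (mu y @ z)" "mu y @ z = a # mu y' @ z'" "4 \<le> length y" "4 \<le> length y'"
  shows False
proof -
  obtain b1 b2 b3 t where y: "y = b1 # b2 # b3 # t" by (rule list3E[of y]) (use assms(3) in auto)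
  obtain c1 c2 c3 t' where y': "y' = c1 # c2 # c3 # t'" by (rule list3E[of y']) (use assms(4) in
      auto)
  have "b1 = a" "c1 = (\<not> b1)" "b2 = (\<not> c1)" "c2 = (\<not> b2)" "b3 = (\<not> c2)"
    using assms(2) by (auto simp: y y')
  then show False using assms(1) not_overlap_free2[of a "\<not> a"] by (simp add: y)
qed

text \<open>The lower bound needs different triples to give different words. The upper bound, which
  only needs every long word to be reached, does without this.\<close>

lemma child_inj:
  assumes eq: "x @ mu y @ z = x' @ mu y' @ z'" and f: "overlap_free (x @ mu y @ z)"
    and e: "x \<in> unit_edges" "x' \<in> unit_edges" "z \<in> unit_edges" "z' \<in> unit_edges"
    and len: "4 \<le> length y" "4 \<le> length y'"
  shows "x = x' \<and> y = y' \<and> z = z'"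
proof -
  have lx: "length x = length x'"
  proof (rule ccontr)
    assume "length x \<noteq> length x'"
    then have "x = [] \<and> (\<exists>a. x' = [a]) \<or> x' = [] \<and> (\<exists>a. x = [a])"
      using e(1,2) by (auto simp: unit_edges_def)
    then show False
    proof (elim disjE conjE exE)
      fix a assume "x = []" "x' = [a]"
      with eq f have "mu y @ z = a # mu y' @ z'" "overlap_free (mu y @ z)" by simp_all
      then show False using child_shift_contra len by blast
    next
      fix a assume "x' = []" "x = [a]"
      with eq have "mu y' @ z' = a # mu y @ z" by simp
      moreover from this have "overlap_free (mu y' @ z')" using f \<open>x = [a]\<close> by simp
      ultimately show False using child_shift_contra len by blast
    qed
  qed
  have "length z \<le> 1" "length z' \<le> 1" using e unit_edges_length by blast+
  moreover have "length x + 2 * length y + length z = length x' + 2 * length y' + length z'"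
    using arg_cong[OF eq, of length] by simp
  ultimately have "length y = length y'" using lx by presburger
  then show ?thesis using eq lx mu_inj by auto
qed

section \<open>Growth of the number of overlap-free words\<close>

definition free_words :: "nat \<Rightarrow> bool list set" where
  "free_words N = {w. length w \<le> N \<and> overlap_free w}"

definition count_free :: "nat \<Rightarrow> nat" where
  "count_free n = card {w :: bool list. length w = n \<and> overlap_free w}"

lemma finite_bool_lists: "finite {w :: bool list. length w = n}" "card {w :: bool list. length w =
    n} = 2 ^ n"
  using finite_lists_length_eq[of "UNIV :: bool set" n] card_lists_length_eq[of "UNIV :: bool set"
      n]
  by simp_all

lemma finite_free_words: "finite (free_words N)"
proof -
  have "free_words N \<subseteq> (\<Union>n\<le>N. {w. length w = n})" by (auto simp: free_words_def)
  then show ?thesis by (rule finite_subset) (simp add: finite_bool_lists)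
qed

lemma count_free_le: "count_free n \<le> 2 ^ n"
proof -
  have "count_free n \<le> card {w :: bool list. length w = n}"
    unfolding count_free_def by (rule card_mono) (auto simp: finite_bool_lists)
  then show ?thesis by (simp add: finite_bool_lists)
qed

lemma sum_free_words: "(\<Sum>w\<in>free_words N. r ^ length w) = (\<Sum>n\<le>N. real (count_free n) * r ^ n)"
proof -
  have "(\<Sum>w\<in>free_words N. r ^ length w) = (\<Sum>n\<le>N. \<Sum>w\<in>{w \<in> free_words N. length w = n}. r ^ length w)"
    by (rule sum.group[symmetric, OF finite_free_words]) (auto simp: free_words_def)
  also have "\<dots> = (\<Sum>n\<le>N. real (count_free n) * r ^ n)"
  proof (rule sum.cong)
    fix n assume "n \<in> {..N}"
    then have "{w \<in> free_words N. length w = n} = {w. length w = n \<and> overlap_free w}"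
      by (auto simp: free_words_def)
    then show "(\<Sum>w\<in>{w \<in> free_words N. length w = n}. r ^ length w) = real (count_free n) * r ^ n"
      by (simp add: count_free_def)
  qed simp
  finally show ?thesis .
qed

lemma sum_product_mult:
  fixes f g :: "'a \<Rightarrow> real"
  shows "(\<Sum>x\<in>A. f x) * (\<Sum>z\<in>B. g z) * c = (\<Sum>x\<in>A. \<Sum>z\<in>B. f x * g z * c)"
  by (subst sum_product) (simp only: sum_distrib_right)

section \<open>Inequalities between the weighted sums at \<open>r\<close> and at
  \<open>r ^ 2\<close>\<close>

definition upper_sum :: "nat \<Rightarrow> real \<Rightarrow> real" where
  "upper_sum N r = (\<Sum>w\<in>free_words N. upper_wt w * upper_wt (rev w) * r ^ length w)"

lemma rev_edges: "z \<in> edges \<Longrightarrow> rev z = z"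
  by (auto simp: edges_def)

lemma rev_unit_edges: "z \<in> unit_edges \<Longrightarrow> rev z = z"
  by (auto simp: unit_edges_def)

text \<open>For fixed \<open>y\<close> the sum over the ends factors into a left and a right sum,
  each at most 14/5 times an end weight of \<open>y\<close>. Several decompositions of one word only
  enlarge the right-hand side. Truncation at length \<open>N\<close> keeps the sums finite before
  convergence is known.\<close>

lemma upper_sum_step:
  assumes r: "0 \<le> r" "r \<le> 1"
  shows "upper_sum N r \<le> upper_sum 9 1 + 196 / 25 * upper_sum N (r ^ 2)"
proof -
  define f where "f w = upper_wt w * upper_wt (rev w) * r ^ length w" for w
  define child where "child = (\<lambda>(x, y, z). x @ mu y @ z)"
  define Y where "Y = {y \<in> free_words N. 3 \<le> length y}"
  define T where "T = edges \<times> Y \<times> edges"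
  \<comment> \<open>The ends take at most four letters, so length 10 leaves at least three letters
    for \<open>y\<close>; the shorter words go into the constant
    \<open>upper_sum 9 1\<close>.\<close>
  define A where "A = {w \<in> free_words N. 10 \<le> length w}"
  define T' where "T' = {t \<in> T. child t \<in> A}"
  define g where "g = (\<lambda>(x, y, z). upper_child x y * upper_child z (map Not (rev y)) * (r ^ 2) ^
      length y)"
  have f0: "0 \<le> f w" for w
    using upper_wt_bounds(1)[of w] upper_wt_bounds(1)[of "rev w"] r by (auto simp: f_def)
  have fin: "finite edges" "finite Y" "finite T" "finite A" "finite T'"
    using finite_free_words by (auto simp: edges_def Y_def T_def A_def T'_def)
  have "A \<subseteq> child ` T'"
  proof
    fix w assume w: "w \<in> A"
    then obtain x y z where *: "w = x @ mu y @ z" "edge x" "edge z" "overlap_free y"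
      using overlap_free_decompose[of w] by (auto simp: A_def free_words_def)
    have "length x \<le> 2" "length z \<le> 2" using * by (auto simp: edge_def)
    then have "(x, y, z) \<in> T"
      using * w by (auto simp: T_def Y_def A_def free_words_def edge_iff)
    then show "w \<in> child ` T'"
      using * w by (intro image_eqI[of _ _ "(x, y, z)"]) (auto simp: T'_def child_def)
  qed
  then have "sum f A \<le> sum f (child ` T')"
    using fin f0 by (intro sum_mono2) auto
  also have "\<dots> \<le> (\<Sum>t\<in>T'. f (child t))"
    using sum_image_le[of T' f child] fin f0 by (simp add: comp_def)
  also have "\<dots> \<le> sum g T'"
  proof (rule sum_mono)
    fix t assume t: "t \<in> T'"
    obtain x y z where xyz: "t = (x, y, z)" by (cases t)
    have *: "x \<in> edges" "z \<in> edges" "3 \<le> length y" "overlap_free (x @ mu y @ z)"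
      using t by (auto simp: xyz T'_def T_def Y_def child_def A_def free_words_def)
    have 1: "upper_wt (x @ mu y @ z) \<le> upper_child x y"
      using * by (intro upper_wt_child) (auto simp: edge_iff)
    have rv: "rev (x @ mu y @ z) = z @ mu (map Not (rev y)) @ x"
      using * by (simp add: rev_mu rev_edges)
    have "overlap_free (rev (x @ mu y @ z))" using * by (simp only: overlap_free_rev)
    then have 2: "upper_wt (rev (x @ mu y @ z)) \<le> upper_child z (map Not (rev y))"
      unfolding rv using * by (intro upper_wt_child) (auto simp: edge_iff)
    have 3: "r ^ length (x @ mu y @ z) \<le> (r ^ 2) ^ length y"
      unfolding power_mult[symmetric] using r by (intro power_decreasing) auto
    have "f (child t) = upper_wt (x @ mu y @ z) * upper_wt (rev (x @ mu y @ z)) * r ^ length (x @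
        mu y @ z)"
      by (simp add: f_def xyz child_def)
    also have "\<dots> \<le> upper_child x y * upper_child z (map Not (rev y)) * (r ^ 2) ^ length y"
      using 1 2 3 r upper_wt_bounds(1)[of "x @ mu y @ z"] upper_wt_bounds(1)[of "rev (x @ mu y @
          z)"]
      by (intro mult_mono upper_child_nonneg mult_nonneg_nonneg) auto
    finally show "f (child t) \<le> g t" by (simp add: g_def xyz)
  qed
  also have "\<dots> \<le> sum g T"
    using fin r by (intro sum_mono2) (auto simp: T'_def g_def upper_child_nonneg)
  also have "\<dots> = (\<Sum>x\<in>edges. \<Sum>y\<in>Y. \<Sum>z\<in>edges. g (x, y, z))"
    unfolding T_def by (simp add: sum.cartesian_product)
  also have "\<dots> = (\<Sum>y\<in>Y. \<Sum>x\<in>edges. \<Sum>z\<in>edges. g (x, y, z))"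
    by (rule sum.swap)
  also have "\<dots> = (\<Sum>y\<in>Y. (\<Sum>x\<in>edges. upper_child x y) * (\<Sum>z\<in>edges. upper_child z (map Not (rev y)))
      * (r ^ 2) ^ length y)"
    by (simp only: g_def prod.case sum_product_mult)
  also have "\<dots> \<le> (\<Sum>y\<in>Y. (14 / 5 * upper_wt y) * (14 / 5 * upper_wt (rev y)) * (r ^ 2) ^ length y)"
  proof (intro sum_mono mult_right_mono mult_mono)
    fix y assume "y \<in> Y"
    then have y: "3 \<le> length y" by (simp add: Y_def)
    show "(\<Sum>x\<in>edges. upper_child x y) \<le> 14 / 5 * upper_wt y" using sum_upper_child[OF y] .
    show "(\<Sum>z\<in>edges. upper_child z (map Not (rev y))) \<le> 14 / 5 * upper_wt (rev y)"
      using sum_upper_child[of "map Not (rev y)"] y by (simp add: upper_wt_map_Not)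
    show "0 \<le> 14 / 5 * upper_wt y" using upper_wt_bounds(1)[of y] by simp
    show "0 \<le> (\<Sum>z\<in>edges. upper_child z (map Not (rev y)))" by (intro sum_nonneg upper_child_nonneg)
    show "0 \<le> (r\<^sup>2) ^ length y" by simp
  qed
  also have "\<dots> = 196 / 25 * (\<Sum>y\<in>Y. upper_wt y * upper_wt (rev y) * (r ^ 2) ^ length y)"
    by (simp add: sum_distrib_left mult_ac)
  also have "\<dots> \<le> 196 / 25 * upper_sum N (r ^ 2)"
    unfolding upper_sum_def
    using upper_wt_bounds(1) finite_free_words
    by (intro mult_left_mono sum_mono2)
       (auto simp: Y_def intro!: mult_nonneg_nonneg order_trans[OF _ upper_wt_bounds(1)])
  finally have 1: "sum f A \<le> 196 / 25 * upper_sum N (r ^ 2)" .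
  have "sum f (free_words N - A) \<le> (\<Sum>w\<in>free_words N - A. upper_wt w * upper_wt (rev w) * 1 ^
      length w)"
    unfolding f_def using r upper_wt_bounds(1)
    by (intro sum_mono mult_left_mono power_mono mult_nonneg_nonneg)
       (auto intro!: order_trans[OF _ upper_wt_bounds(1)])
  also have "\<dots> \<le> upper_sum 9 1"
    unfolding upper_sum_def using finite_free_words
    by (intro sum_mono2) (auto simp: A_def free_words_def intro!: mult_nonneg_nonneg
        order_trans[OF _ upper_wt_bounds(1)])
  finally have 2: "sum f (free_words N - A) \<le> upper_sum 9 1" .
  have "upper_sum N r = sum f (free_words N - A) + sum f A"
    unfolding upper_sum_def f_def[symmetric]
    by (intro sum.subset_diff finite_free_words) (auto simp: A_def)
  with 1 2 show ?thesis by simp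
qed

lemma lower_child_eq_0: "\<not> left_ok x y \<Longrightarrow> lower_child x y = 0"
  by (simp add: lower_child_def)

definition regular_words :: "nat \<Rightarrow> bool list set" where
  "regular_words N = {w \<in> free_words N. regular_word w \<and> 5 \<le> length w}"

definition lower_sum :: "nat \<Rightarrow> real \<Rightarrow> real" where
  "lower_sum N r = (\<Sum>w\<in>regular_words N. lower_wt w * lower_wt (rev w) * r ^ length w)"

text \<open>By \<open>child_inj\<close> and \<open>regular_child\<close> the children are distinct
  and again regular. A child of \<open>y\<close> has length at most \<open>2 * length y + 2\<close>,
  whence the factor \<open>r ^ 2\<close> and the cut-off \<open>2 * N + 2\<close>.\<close>

lemma lower_sum_step:
  assumes r: "0 \<le> r" "r \<le> 1"
  shows "441 / 100 * r ^ 2 * lower_sum N (r ^ 2) \<le> lower_sum (2 * N + 2) r"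
proof -
  define f where "f w = lower_wt w * lower_wt (rev w) * r ^ length w" for w
  define child where "child = (\<lambda>(x, y, z). x @ mu y @ z)"
  define Y where "Y = regular_words N"
  define T where "T = unit_edges \<times> Y \<times> unit_edges"
  define T' where "T' = {t \<in> T. case t of (x, y, z) \<Rightarrow> left_ok x y \<and> right_ok z y}"
  define g where "g = (\<lambda>(x, y, z). lower_child x y * lower_child z (map Not (rev y)) * r ^ (2 *
      length y + 2))"
  have f0: "0 \<le> f w" for w
    using r by (auto simp: f_def lower_wt_bounds)
  have fin: "finite unit_edges" "finite Y" "finite T" "finite T'"
    using finite_free_words by (auto simp: unit_edges_def Y_def T_def T'_def regular_words_def)
  have T': "x \<in> unit_edges \<and> z \<in> unit_edges \<and> left_ok x y \<and> right_ok z y \<and> overlap_free y \<and>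
      regular_word y \<and> 5 \<le> length y \<and> length y \<le> N"
    if "(x, y, z) \<in> T'" for x y z
    using that by (auto simp: T'_def T_def Y_def regular_words_def free_words_def)
  have free: "overlap_free (x @ mu y @ z)" if "(x, y, z) \<in> T'" for x y z
    using T'[OF that] by (intro overlap_free_edges) auto
  have "(\<Sum>y\<in>Y. (21 / 10 * lower_wt y) * (21 / 10 * lower_wt (rev y)) * r ^ (2 * length y + 2))
     \<le> (\<Sum>y\<in>Y. (\<Sum>x\<in>unit_edges. lower_child x y) * (\<Sum>z\<in>unit_edges. lower_child z (map Not (rev y)))
         * r ^ (2 * length y + 2))"
  proof (intro sum_mono mult_right_mono mult_mono)
    fix y assume "y \<in> Y"
    then have y: "3 \<le> length y" by (simp add: Y_def regular_words_def)
    show "21 / 10 * lower_wt y \<le> (\<Sum>x\<in>unit_edges. lower_child x y)" using sum_lower_child[OF y] .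
    show "21 / 10 * lower_wt (rev y) \<le> (\<Sum>z\<in>unit_edges. lower_child z (map Not (rev y)))"
      using sum_lower_child[of "map Not (rev y)"] y by (simp add: lower_wt_map_Not)
    show "0 \<le> 21 / 10 * lower_wt (rev y)" by (simp add: lower_wt_bounds)
    show "0 \<le> (\<Sum>x\<in>unit_edges. lower_child x y)" by (intro sum_nonneg lower_child_nonneg)
    show "0 \<le> r ^ (2 * length y + 2)" using r by simp
  qed
  also have "\<dots> = (\<Sum>y\<in>Y. \<Sum>x\<in>unit_edges. \<Sum>z\<in>unit_edges. g (x, y, z))"
    by (simp only: g_def prod.case sum_product_mult)
  also have "\<dots> = (\<Sum>x\<in>unit_edges. \<Sum>y\<in>Y. \<Sum>z\<in>unit_edges. g (x, y, z))"
    by (rule sum.swap)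
  also have "\<dots> = sum g T"
    unfolding T_def by (simp add: sum.cartesian_product)
  also have "\<dots> = sum g T'"
  proof (rule sum.mono_neutral_right)
    show "\<forall>t\<in>T - T'. g t = 0"
      by (auto simp: T'_def T_def g_def right_ok_def rev_unit_edges intro: lower_child_eq_0)
  qed (auto simp: fin T'_def)
  also have "\<dots> \<le> (\<Sum>t\<in>T'. f (child t))"
  proof (rule sum_mono)
    fix t assume t: "t \<in> T'"
    obtain x y z where xyz: "t = (x, y, z)" by (cases t)
    note * = T'[OF t[unfolded xyz]]
    have 1: "lower_child x y \<le> lower_wt (x @ mu y @ z)"
      using * by (intro lower_child_wt) auto
    have rv: "rev (x @ mu y @ z) = z @ mu (map Not (rev y)) @ x"
      using * by (simp add: rev_mu rev_unit_edges)
    have "rev z = z" using * rev_unit_edges by blast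
    then have lr: "left_ok z (map Not (rev y))" using * by (simp add: right_ok_def)
    have rl: "right_ok x (map Not (rev y))" using * right_ok_rev[of x y] by (simp add:
        rev_unit_edges)
    have 2: "lower_child z (map Not (rev y)) \<le> lower_wt (rev (x @ mu y @ z))"
      unfolding rv using * lr rl by (intro lower_child_wt) (auto intro: regular_map_Not simp:
          regular_rev)
    have "length x \<le> 1" "length z \<le> 1" using * unit_edges_length by blast+
    then have 3: "r ^ (2 * length y + 2) \<le> r ^ length (x @ mu y @ z)"
      using r by (intro power_decreasing) auto
    have "g t = lower_child x y * lower_child z (map Not (rev y)) * r ^ (2 * length y + 2)"
      by (simp add: g_def xyz)
    also have "\<dots> \<le> lower_wt (x @ mu y @ z) * lower_wt (rev (x @ mu y @ z)) * r ^ length (x @ mu y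
        @ z)"
      using 1 2 3 r by (intro mult_mono lower_child_nonneg mult_nonneg_nonneg lower_wt_bounds) auto
    finally show "g t \<le> f (child t)" by (simp add: f_def xyz child_def)
  qed
  also have "\<dots> = sum f (child ` T')"
  proof (rule sum.reindex_cong[symmetric])
    show "inj_on child T'"
    proof (rule inj_onI)
      fix s t assume st: "s \<in> T'" "t \<in> T'" "child s = child t"
      obtain x y z where s: "s = (x, y, z)" by (cases s)
      obtain x' y' z' where t: "t = (x', y', z')" by (cases t)
      show "s = t"
        using child_inj[of x y z x' y' z'] free[of x y z] T'[of x y z] T'[of x' y' z'] st
        by (simp add: s t child_def)
    qed
  qed simp_all
  also have "\<dots> \<le> sum f (regular_words (2 * N + 2))"
  proof (rule sum_mono2)
    show "child ` T' \<subseteq> regular_words (2 * N + 2)"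
    proof
      fix w assume "w \<in> child ` T'"
      then obtain x y z where w: "w = x @ mu y @ z" and t: "(x, y, z) \<in> T'" by (auto simp:
          child_def)
      note * = T'[OF t]
      have "length x \<le> 1" "length z \<le> 1" using * unit_edges_length by blast+
      moreover have "regular_word w" unfolding w using * by (intro regular_child) auto
      ultimately show "w \<in> regular_words (2 * N + 2)"
        using free[OF t] * by (auto simp: w regular_words_def free_words_def)
    qed
  qed (use finite_free_words f0 in \<open>auto simp: regular_words_def\<close>)
  also have "\<dots> = lower_sum (2 * N + 2) r"
    by (simp add: lower_sum_def f_def)
  finally have "(\<Sum>y\<in>Y. (21 / 10 * lower_wt y) * (21 / 10 * lower_wt (rev y)) * r ^ (2 * length y +
      2))
    \<le> lower_sum (2 * N + 2) r" .
  moreover have "441 / 100 * r ^ 2 * lower_sum N (r ^ 2)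
    = (\<Sum>y\<in>Y. (21 / 10 * lower_wt y) * (21 / 10 * lower_wt (rev y)) * r ^ (2 * length y + 2))"
    unfolding lower_sum_def sum_distrib_left Y_def
    by (intro sum.cong refl) (simp add: power_add power_mult power2_eq_square)
  ultimately show ?thesis by simp
qed

text \<open>Iterated square roots, so that the inequalities link consecutive \<open>k\<close>. The
  start \<open>exp (- 2)\<close> is so small that the trivial bound \<open>2 ^ n\<close> on the
  number of words already gives a convergent series there.\<close>

definition radius :: "nat \<Rightarrow> real" where
  "radius k = exp (- 2 / 2 ^ k)"

lemma radius_Suc: "radius (Suc k) ^ 2 = radius k"
  by (simp add: radius_def flip: exp_of_nat_mult)

lemma radius_bounds: "0 < radius k" "radius k < 1"
  by (auto simp: radius_def)

lemma upper_growth: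
  obtains C where "\<And>k N. (\<Sum>n\<le>N. real (count_free n) * radius k ^ n) \<le> C * (196 / 25) ^ k"
proof -
  define B where "B = 81 * (\<Sum>n. (1 / 2 :: real) ^ n)"
  define C where "C = upper_sum 9 1"
  have e2: "(2::real) * exp (- 2) \<le> 1 / 2"
  proof -
    have "2 * 2 \<le> exp 1 * exp (1::real)"
      using exp_ge_add_one_self[of "1::real"] by (intro mult_mono) auto
    then show ?thesis by (simp add: exp_minus field_simps flip: exp_add)
  qed
  have base: "upper_sum N (radius 0) \<le> B" for N
  proof -
    have "upper_sum N (radius 0) \<le> (\<Sum>w\<in>free_words N. 81 * radius 0 ^ length w)"
      unfolding upper_sum_def
    proof (intro sum_mono mult_right_mono)
      fix w :: "bool list"
      have "upper_wt w * upper_wt (rev w) \<le> 9 * 9"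
        using upper_wt_bounds[of w] upper_wt_bounds[of "rev w"] by (intro mult_mono) auto
      then show "upper_wt w * upper_wt (rev w) \<le> 81" by simp
    qed (use radius_bounds[of 0] in auto)
    also have "\<dots> = 81 * (\<Sum>n\<le>N. real (count_free n) * radius 0 ^ n)"
      by (simp add: sum_free_words flip: sum_distrib_left)
    also have "(\<Sum>n\<le>N. real (count_free n) * radius 0 ^ n) \<le> (\<Sum>n\<le>N. (1 / 2) ^ n)"
    proof (rule sum_mono)
      fix n
      have "real (count_free n) * radius 0 ^ n \<le> 2 ^ n * radius 0 ^ n"
        using count_free_le[of n] radius_bounds[of 0] by (intro mult_right_mono) (auto simp flip:
            of_nat_le_iff)
      also have "\<dots> = (2 * exp (- 2)) ^ n" by (simp add: radius_def power_mult_distrib)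
      also have "\<dots> \<le> (1 / 2) ^ n" using e2 by (intro power_mono) auto
      finally show "real (count_free n) * radius 0 ^ n \<le> (1 / 2) ^ n" .
    qed
    also have "\<dots> \<le> (\<Sum>n. (1 / 2) ^ n)"
      by (rule sum_le_suminf) (auto intro: summable_geometric)
    finally show ?thesis by (simp add: B_def)
  qed
  have C0: "0 \<le> C"
    unfolding C_def upper_sum_def
    by (auto intro!: sum_nonneg mult_nonneg_nonneg order_trans[OF _ upper_wt_bounds(1)])
  \<comment> \<open>Subtracting \<open>C\<close> makes the induction absorb the additive constant of
    \<open>upper_sum_step\<close>, because 196/25 is at least 2.\<close>
  have "upper_sum N (radius k) \<le> (B + C) * (196 / 25) ^ k - C" for k N
  proof (induction k)
    case 0
    then show ?case using base by simp
  next
    case (Suc k)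
    have "upper_sum N (radius (Suc k)) \<le> C + 196 / 25 * upper_sum N (radius k)"
      using upper_sum_step[of "radius (Suc k)" N] radius_bounds[of "Suc k"] by (simp add:
          radius_Suc C_def)
    then show ?case using Suc C0 by simp
  qed
  moreover have "(\<Sum>n\<le>N. real (count_free n) * radius k ^ n) \<le> upper_sum N (radius k)" for k N
    unfolding sum_free_words[symmetric] upper_sum_def
  proof (rule sum_mono)
    fix w
    have "1 * 1 \<le> upper_wt w * upper_wt (rev w)"
      using upper_wt_bounds[of w] upper_wt_bounds[of "rev w"] by (intro mult_mono) auto
    from mult_right_mono[OF this, of "radius k ^ length w"]
    show "radius k ^ length w \<le> upper_wt w * upper_wt (rev w) * radius k ^ length w"
      using radius_bounds[of k] by simp
  qed
  ultimately have "(\<Sum>n\<le>N. real (count_free n) * radius k ^ n) \<le> (B + C) * (196 / 25) ^ k - C" for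
      k N
    by (rule order_trans[rotated])
  then have "(\<Sum>n\<le>N. real (count_free n) * radius k ^ n) \<le> (B + C) * (196 / 25) ^ k" for k N
    by (rule order_trans) (use C0 in simp)
  then show ?thesis by (rule that)
qed

lemma overlap_free4: "overlap_free [a, b, c, d] \<longleftrightarrow> \<not> (a = b \<and> b = c) \<and> \<not> (b = c \<and> c = d)"
proof
  assume *: "overlap_free [a, b, c, d]"
  then have "overlap_free [b, c, d]" by (rule overlap_free_ConsD)
  then show "\<not> (a = b \<and> b = c) \<and> \<not> (b = c \<and> c = d)"
    using * not_overlap_free1[of a "[d]"] not_overlap_free1[of b "[]"] by auto
next
  assume *: "\<not> (a = b \<and> b = c) \<and> \<not> (b = c \<and> c = d)"
  show "overlap_free [a, b, c, d]"
    unfolding overlap_free_def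
  proof (intro allI notI)
    fix i p assume ovl: "overlap_at [a, b, c, d] i p"
    then have "p = 1" "i = 0 \<or> i = 1" by (auto simp: overlap_at_def)
    moreover have "[a, b, c, d] ! (i + j) = [a, b, c, d] ! (i + j + p)" if "j \<le> p" for j
      using ovl that by (simp add: overlap_at_def)
    from this[of 0] this[of 1] calculation show False using * by auto
  qed
qed

lemma lower_growth:
  obtains c where "0 < c" "\<And>k. \<exists>N. c * (441 / 100) ^ k \<le> (\<Sum>n\<le>N. real (count_free n) * radius k ^ n)"
proof -
  \<comment> \<open>The seed of the iteration: even length makes it regular, and both of its ends
    can be extended, so its weights are positive.\<close>
  define w0 where "w0 = mu [False, True, True]"
  have ext: "overlap_free (e # mu [a, b, c]) \<longleftrightarrow> \<not> ((\<not> e) = a \<and> a = b) \<and> \<not> (a = b \<and> b = c)" for a b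
      c e
    by (simp only: overlap_free_Cons_mu overlap_free4)
  have w0: "w0 \<in> regular_words 6"
    using ext[of False False True True] overlap_free_ConsD[of False w0]
    by (auto simp: regular_words_def free_words_def w0_def intro!: regular_even)
  have "lower_wt w0 * lower_wt (rev w0) > 0"
    using ext[of _ False True True] ext[of _ False False True]
    by (simp add: w0_def lower_wt_def)
  then have "lower_wt w0 * lower_wt (rev w0) * radius 0 ^ length w0 > 0"
    using radius_bounds[of 0] by simp
  also have "\<dots> \<le> lower_sum 6 (radius 0)"
    unfolding lower_sum_def using w0 finite_free_words[of 6] radius_bounds[of 0]
    by (intro member_le_sum) (auto simp: regular_words_def lower_wt_bounds)
  finally have c0: "0 < lower_sum 6 (radius 0)" .
  \<comment> \<open>Step \<open>k\<close> costs the factor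
    \<open>radius (Suc k) ^ 2 = radius k\<close>. The product of these factors is the exponential
    shown, which never falls below \<open>exp (- 4)\<close>.\<close>
  have "\<exists>N. lower_sum 6 (radius 0) * exp (- 4 * (1 - 1 / 2 ^ k)) * (441 / 100) ^ k \<le> lower_sum N
      (radius k)" for k
  proof (induction k)
    case 0
    then show ?case by (intro exI[of _ 6]) simp
  next
    case (Suc k)
    then obtain N where N: "lower_sum 6 (radius 0) * exp (- 4 * (1 - 1 / 2 ^ k)) * (441 / 100) ^ k
        \<le> lower_sum N (radius k)"
      by blast
    have e: "exp (- 4 * (1 - 1 / 2 ^ Suc k)) = exp (- 4 * (1 - 1 / 2 ^ k)) * radius k"
      by (simp add: radius_def field_simps flip: exp_add)
    have "lower_sum 6 (radius 0) * exp (- 4 * (1 - 1 / 2 ^ Suc k)) * (441 / 100) ^ Suc k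
      = 441 / 100 * radius k * (lower_sum 6 (radius 0) * exp (- 4 * (1 - 1 / 2 ^ k)) * (441 / 100)
          ^ k)"
      unfolding e by simp
    also have "\<dots> \<le> 441 / 100 * radius k * lower_sum N (radius k)"
      using N radius_bounds[of k] by (intro mult_left_mono) auto
    also have "\<dots> \<le> lower_sum (2 * N + 2) (radius (Suc k))"
      using lower_sum_step[of "radius (Suc k)" N] radius_bounds[of "Suc k"] by (simp only:
          radius_Suc)
    finally show ?case by blast
  qed
  moreover have "lower_sum N (radius k) \<le> 256 * (\<Sum>n\<le>N. real (count_free n) * radius k ^ n)" for k N
  proof -
    have "lower_sum N (radius k) \<le> (\<Sum>w\<in>regular_words N. 256 * radius k ^ length w)"
      unfolding lower_sum_def
    proof (intro sum_mono mult_right_mono)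
      fix w :: "bool list"
      have "lower_wt w * lower_wt (rev w) \<le> 16 * 16"
        by (intro mult_mono lower_wt_bounds) auto
      then show "lower_wt w * lower_wt (rev w) \<le> 256" by simp
    qed (use radius_bounds[of k] in auto)
    also have "\<dots> \<le> (\<Sum>w\<in>free_words N. 256 * radius k ^ length w)"
      using radius_bounds[of k] finite_free_words by (intro sum_mono2) (auto simp:
          regular_words_def)
    finally show ?thesis by (simp add: sum_free_words flip: sum_distrib_left)
  qed
  moreover have "lower_sum 6 (radius 0) * exp (- 4) / 256 * (441 / 100) ^ k * 256
      \<le> lower_sum 6 (radius 0) * exp (- 4 * (1 - 1 / 2 ^ k)) * (441 / 100) ^ k" for k
    using c0 by (auto intro!: mult_mono)
  ultimately have "\<exists>N. lower_sum 6 (radius 0) * exp (- 4) / 256 * (441 / 100) ^ k * 256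
      \<le> 256 * (\<Sum>n\<le>N. real (count_free n) * radius k ^ n)" for k
    by (meson order_trans)
  then have "\<exists>N. lower_sum 6 (radius 0) * exp (- 4) / 256 * (441 / 100) ^ k
      \<le> (\<Sum>n\<le>N. real (count_free n) * radius k ^ n)" for k
    by (simp add: mult.commute[of 256])
  moreover have "0 < lower_sum 6 (radius 0) * exp (- 4) / 256" using c0 by simp
  ultimately show ?thesis using that by blast
qed

section \<open>Derivations and algebraic elements\<close>

definition is_subring :: "'a::comm_ring_1 set \<Rightarrow> bool" where
  "is_subring E \<longleftrightarrow> 0 \<in> E \<and> 1 \<in> E \<and> (\<forall>x\<in>E. - x \<in> E) \<and> (\<forall>x\<in>E. \<forall>y\<in>E. x + y \<in> E \<and> x * y \<in> E)"

text \<open>The values of \<open>D\<close> may lie outside \<open>E\<close>. So a derivation can be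
  extended from ring to ring without passing to fraction fields, although the value at a new
  generator is a quotient in the ambient field.\<close>

definition derivation_on :: "'a::comm_ring_1 set \<Rightarrow> ('a \<Rightarrow> 'a) \<Rightarrow> bool" where
  "derivation_on E D \<longleftrightarrow> (\<forall>x\<in>E. \<forall>y\<in>E. D (x + y) = D x + D y \<and> D (x * y) = D x * y + x * D y)"

definition polys_over :: "'a::comm_ring_1 set \<Rightarrow> 'a poly set" where
  "polys_over E = {p. \<forall>i. coeff p i \<in> E}"

definition adjoin :: "'a::comm_ring_1 set \<Rightarrow> 'a \<Rightarrow> 'a set" where
  "adjoin E t = (\<lambda>p. poly p t) ` polys_over E"

lemma subring_sum:
  assumes "is_subring E" "\<And>i. i \<in> A \<Longrightarrow> f i \<in> E"
  shows "sum f A \<in> E"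
  using assms(2) by (induction A rule: infinite_finite_induct) (use assms(1) in \<open>auto simp:
      is_subring_def\<close>)

lemma subring_prod_list:
  assumes "is_subring E" "\<And>x. x \<in> set xs \<Longrightarrow> x \<in> E"
  shows "prod_list xs \<in> E"
  using assms(2) by (induction xs) (use assms(1) in \<open>auto simp: is_subring_def\<close>)

lemma derivation_on_0:
  assumes "is_subring E" "derivation_on E D"
  shows "D 0 = 0"
proof -
  have "D (0 + 0) = D 0 + D 0" using assms by (auto simp: is_subring_def derivation_on_def)
  then show ?thesis by simp
qed

lemma derivation_on_1:
  assumes "is_subring E" "derivation_on E D"
  shows "D 1 = 0"
proof -
  have "D (1 * 1) = D 1 * 1 + 1 * D 1" using assms unfolding is_subring_def derivation_on_def by
      blast
  then show ?thesis by simp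
qed

lemma derivation_on_sum:
  assumes "is_subring E" "derivation_on E D" "\<And>i. i \<in> A \<Longrightarrow> f i \<in> E"
  shows "D (sum f A) = (\<Sum>i\<in>A. D (f i))"
  using assms(3)
proof (induction A rule: infinite_finite_induct)
  case (insert a A)
  then have "sum f A \<in> E" by (intro subring_sum assms(1)) auto
  then show ?case using insert assms(2) by (auto simp: derivation_on_def)
qed (use derivation_on_0[OF assms(1,2)] in auto)

lemma polys_over_subring:
  assumes "is_subring E"
  shows "is_subring (polys_over E)"
  using assms unfolding is_subring_def polys_over_def
  by (auto simp: coeff_mult coeff_1 intro!: subring_sum[OF assms])

lemma polys_over_smult: "is_subring E \<Longrightarrow> c \<in> E \<Longrightarrow> p \<in> polys_over E \<Longrightarrow> smult c p \<in> polys_over E"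
  by (auto simp: is_subring_def polys_over_def)

lemma polys_over_monom: "is_subring E \<Longrightarrow> c \<in> E \<Longrightarrow> monom c n \<in> polys_over E"
  by (auto simp: is_subring_def polys_over_def)

lemma polys_over_pderiv:
  assumes "is_subring E" "p \<in> polys_over E"
  shows "pderiv p \<in> polys_over E"
proof -
  have "of_nat n \<in> E" for n using assms(1) by (induction n) (auto simp: is_subring_def)
  then show ?thesis using assms by (auto simp: is_subring_def polys_over_def coeff_pderiv simp
      del: of_nat_Suc)
qed

lemma adjoin_subring:
  assumes "is_subring E"
  shows "is_subring (adjoin E t)"
proof -
  note P = polys_over_subring[OF assms, unfolded is_subring_def]
  show ?thesis unfolding is_subring_def adjoin_def
  proof (intro conjI ballI)
    show "0 \<in> (\<lambda>p. poly p t) ` polys_over E" by (rule image_eqI[of _ _ 0]) (use P in auto)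
    show "1 \<in> (\<lambda>p. poly p t) ` polys_over E" by (rule image_eqI[of _ _ 1]) (use P in auto)
  next
    fix x assume "x \<in> (\<lambda>p. poly p t) ` polys_over E"
    then obtain p where p: "p \<in> polys_over E" "x = poly p t" by blast
    then show "- x \<in> (\<lambda>p. poly p t) ` polys_over E"
      using P by (intro image_eqI[of _ _ "- p"]) simp_all
  next
    fix x y assume "x \<in> (\<lambda>p. poly p t) ` polys_over E" "y \<in> (\<lambda>p. poly p t) ` polys_over E"
    then obtain p q where pq: "p \<in> polys_over E" "x = poly p t" "q \<in> polys_over E" "y = poly q t"
        by blast
    show "x + y \<in> (\<lambda>p. poly p t) ` polys_over E"
      using P pq by (intro image_eqI[of _ _ "p + q"]) simp_all
    show "x * y \<in> (\<lambda>p. poly p t) ` polys_over E"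
      using P pq by (intro image_eqI[of _ _ "p * q"]) simp_all
  qed
qed

lemma subset_adjoin: "is_subring E \<Longrightarrow> E \<subseteq> adjoin E t"
  unfolding adjoin_def
  by (auto intro!: image_eqI[of _ _ "[:_:]"] simp: polys_over_def coeff_pCons is_subring_def
      split: nat.splits)

lemma mem_adjoin: "is_subring E \<Longrightarrow> t \<in> adjoin E t"
  unfolding adjoin_def
  by (auto intro!: image_eqI[of _ _ "[:0, 1:]"] simp: polys_over_def coeff_pCons is_subring_def
      split: nat.splits)

text \<open>The leading coefficient of \<open>m\<close> need not be invertible in \<open>E\<close>,
  so every division step first multiplies by it; the accumulated factor \<open>c\<close> is
  cancelled in the ambient domain afterwards.\<close>

lemma pseudo_division_over:
  fixes m :: "'a::idom poly"
  assumes "is_subring E" "m \<in> polys_over E" "m \<noteq> 0" "p \<in> polys_over E"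
  shows "\<exists>c\<in>E - {0}. \<exists>q\<in>polys_over E. \<exists>r\<in>polys_over E.
    smult c p = q * m + r \<and> (r = 0 \<or> degree r < degree m)"
  using assms(4)
proof (induction "degree p" arbitrary: p rule: less_induct)
  case less
  note P = polys_over_subring[OF assms(1), unfolded is_subring_def]
  show ?case
  proof (cases "p = 0 \<or> degree p < degree m")
    case True
    have "1 \<in> E - {0}" using assms(1) by (simp add: is_subring_def)
    moreover have "smult 1 p = 0 * m + p" by simp
    ultimately show ?thesis using True P less.prems by blast
  next
    case False
    define l where "l = lead_coeff m"
    have l: "l \<in> E" "l \<noteq> 0" using assms by (auto simp: l_def polys_over_def)
    define n where "n = degree p - degree m"
    define a where "a = monom (lead_coeff p) n"
    have a: "a \<in> polys_over E"
      unfolding a_def using less.prems assms(1) by (intro polys_over_monom) (auto simp: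
          polys_over_def)
    define p' where "p' = smult l p - a * m"
    have "p' = smult l p + - (a * m)" by (simp add: p'_def)
    then have p': "p' \<in> polys_over E"
      using P a assms(2) polys_over_smult[OF assms(1) l(1) less.prems] by metis
    have da: "degree a = n" "a \<noteq> 0" using False by (auto simp: a_def degree_monom_eq)
    have "degree (smult l p) = degree p" using l by simp
    moreover have "degree (a * m) = degree p"
      using False assms(3) da by (simp add: degree_mult_eq n_def)
    moreover have "coeff (smult l p) (degree p) = coeff (a * m) (degree p)"
    proof -
      have "coeff (a * m) (degree p) = lead_coeff (a * m)" using \<open>degree (a * m) = degree p\<close> by simp
      also have "\<dots> = lead_coeff p * l" unfolding lead_coeff_mult da(1) by (simp add: a_def l_def)
      finally show ?thesis by simp
    qed
    ultimately have "coeff p' (degree p) = 0" "degree p' \<le> degree p"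
      unfolding p'_def by (simp_all add: degree_diff_le)
    then have d: "p' = 0 \<or> degree p' < degree p"
      by (metis leading_coeff_0_iff order_le_less)
    have "\<exists>c\<in>E - {0}. \<exists>q\<in>polys_over E. \<exists>r\<in>polys_over E.
      smult c p' = q * m + r \<and> (r = 0 \<or> degree r < degree m)"
    proof (cases "p' = 0")
      case True
      have "1 \<in> E - {0}" using assms(1) by (simp add: is_subring_def)
      moreover have "smult 1 p' = 0 * m + 0" using True by simp
      ultimately show ?thesis using P by blast
    next
      case False
      with d have "degree p' < degree p" by simp
      from less.hyps[OF this p'] show ?thesis .
    qed
    then obtain c q r where cqr: "c \<in> E - {0}" "q \<in> polys_over E" "r \<in> polys_over E"
      "smult c p' = q * m + r" "r = 0 \<or> degree r < degree m" by blast
    have "smult (c * l) p = smult c p' + smult c (a * m)"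
      by (simp add: p'_def smult_diff_right)
    also have "\<dots> = (q + smult c a) * m + r" using cqr by (simp add: algebra_simps)
    finally have "smult (c * l) p = (q + smult c a) * m + r" .
    moreover have "c * l \<in> E - {0}" using cqr l assms(1) by (auto simp: is_subring_def)
    moreover have "q + smult c a \<in> polys_over E" using P cqr a polys_over_smult[OF assms(1)] by
        blast
    ultimately show ?thesis using cqr by blast
  qed
qed

text \<open>The value at \<open>p\<close> evaluated in \<open>t\<close> of the extension of \<open>D\<close> that sends \<open>t\<close> to \<open>s\<close>.\<close>

definition ext_deriv :: "('a::idom \<Rightarrow> 'a) \<Rightarrow> 'a \<Rightarrow> 'a \<Rightarrow> 'a poly \<Rightarrow> 'a" where
  "ext_deriv D t s p = poly (map_poly D p) t + poly (pderiv p) t * s"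

section \<open>Extending a derivation to a ring generated by one more element\<close>

lemma ext_deriv_add:
  assumes "is_subring E" "derivation_on E D" "p \<in> polys_over E" "q \<in> polys_over E"
  shows "ext_deriv D t s (p + q) = ext_deriv D t s p + ext_deriv D t s q"
proof -
  have "map_poly D (p + q) = map_poly D p + map_poly D q"
    using assms derivation_on_0[OF assms(1,2)]
    by (intro poly_eqI) (auto simp: coeff_map_poly derivation_on_def polys_over_def)
  then show ?thesis by (simp add: ext_deriv_def pderiv_add algebra_simps)
qed

lemma ext_deriv_mult:
  assumes "is_subring E" "derivation_on E D" "p \<in> polys_over E" "q \<in> polys_over E"
  shows "ext_deriv D t s (p * q) = ext_deriv D t s p * poly q t + poly p t * ext_deriv D t s q"
proof -
  note D0 = derivation_on_0[OF assms(1,2)]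
  have c: "coeff p i \<in> E" "coeff q i \<in> E" for i using assms by (auto simp: polys_over_def)
  then have "coeff p i * coeff q j \<in> E" for i j using assms(1) by (auto simp: is_subring_def)
  then have "map_poly D (p * q) = map_poly D p * q + p * map_poly D q"
    using c assms(2)
    by (intro poly_eqI)
      (auto simp: coeff_map_poly D0 coeff_mult derivation_on_sum[OF assms(1,2)] derivation_on_def
        sum.distrib)
  then show ?thesis by (simp add: ext_deriv_def pderiv_mult algebra_simps)
qed

lemma ext_deriv_const:
  assumes "is_subring E" "derivation_on E D"
  shows "ext_deriv D t s [:c:] = D c"
  using derivation_on_0[OF assms] by (simp add: ext_deriv_def map_poly_pCons)

text \<open>Two polynomials with the same value at \<open>t\<close> differ by one that vanishes
  there, so the assumption on \<open>s\<close> makes the new value independent of the representing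
  polynomial.\<close>

lemma derivation_extend:
  fixes E :: "'a::{idom,ring_char_0} set"
  assumes E: "is_subring E" and D: "derivation_on E D"
    and s: "\<And>p. p \<in> polys_over E \<Longrightarrow> poly p t = 0 \<Longrightarrow> ext_deriv D t s p = 0"
  shows "\<exists>D'. derivation_on (adjoin E t) D' \<and> (\<forall>x\<in>E. D' x = D x) \<and> D' t = s"
proof -
  note P = polys_over_subring[OF E, unfolded is_subring_def]
  note D0 = derivation_on_0[OF E D]
  define D' where "D' x = ext_deriv D t s (SOME p. p \<in> polys_over E \<and> poly p t = x)" for x
  have D': "D' (poly p t) = ext_deriv D t s p" if p: "p \<in> polys_over E" for p
  proof -
    define q where "q = (SOME q. q \<in> polys_over E \<and> poly q t = poly p t)"
    have q: "q \<in> polys_over E" "poly q t = poly p t"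
      unfolding q_def using someI[of "\<lambda>q. q \<in> polys_over E \<and> poly q t = poly p t" p] p by blast+
    have "q + - p \<in> polys_over E" using P p q by blast
    then have "ext_deriv D t s (q + - p) = 0" using q by (intro s) auto
    moreover have "ext_deriv D t s (q + - p + p) = ext_deriv D t s (q + - p) + ext_deriv D t s p"
      using \<open>q + - p \<in> polys_over E\<close> p by (intro ext_deriv_add[OF E D])
    ultimately show ?thesis by (simp add: D'_def q_def)
  qed
  have "derivation_on (adjoin E t) D'"
    unfolding derivation_on_def
  proof (intro ballI)
    fix x y assume "x \<in> adjoin E t" "y \<in> adjoin E t"
    then obtain p q where pq: "p \<in> polys_over E" "q \<in> polys_over E" "x = poly p t" "y = poly q t"
      by (auto simp: adjoin_def)
    have "D' (poly (p + q) t) = ext_deriv D t s (p + q)" "D' (poly (p * q) t) = ext_deriv D t s (p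
        * q)"
      using P pq by (intro D'; blast)+
    then show "D' (x + y) = D' x + D' y \<and> D' (x * y) = D' x * y + x * D' y"
      using pq D' ext_deriv_add[OF E D] ext_deriv_mult[OF E D] by simp
  qed
  moreover have "D' x = D x" if "x \<in> E" for x
  proof -
    have "[:x:] \<in> polys_over E" using that E by (auto simp: polys_over_def is_subring_def
        coeff_pCons split: nat.splits)
    from D'[OF this] show ?thesis by (simp add: ext_deriv_const[OF E D])
  qed
  moreover have "D' t = s"
  proof -
    have "[:0, 1:] \<in> polys_over E" using E by (auto simp: polys_over_def is_subring_def
        coeff_pCons split: nat.splits)
    from D'[OF this] show ?thesis
      by (simp add: ext_deriv_def map_poly_pCons D0 derivation_on_1[OF E D] pderiv_pCons)
  qed
  ultimately show ?thesis by blast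
qed

text \<open>If \<open>t\<close> is transcendental over \<open>E\<close>, its image can be chosen
  freely. Otherwise differentiating \<open>poly m t = 0\<close>, for an annihilating
  \<open>m\<close> of least degree, forces the image.\<close>

lemma derivation_extend_ex:
  fixes E :: "'a::{field,ring_char_0} set"
  assumes E: "is_subring E" and D: "derivation_on E D"
  shows "\<exists>D'. derivation_on (adjoin E t) D' \<and> (\<forall>x\<in>E. D' x = D x)"
proof (cases "\<exists>p\<in>polys_over E. p \<noteq> 0 \<and> poly p t = 0")
  case False
  then have "ext_deriv D t 0 p = 0" if "p \<in> polys_over E" "poly p t = 0" for p
  proof -
    from that False have "p = 0" by blast
    then show ?thesis by (simp add: ext_deriv_def)
  qed
  from derivation_extend[OF E D this] show ?thesis by blast
next
  case True
  note P = polys_over_subring[OF E, unfolded is_subring_def]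
  define Q where "Q p \<longleftrightarrow> p \<in> polys_over E \<and> p \<noteq> 0 \<and> poly p t = 0" for p
  obtain m where m: "Q m" and min: "\<And>p. Q p \<Longrightarrow> degree m \<le> degree p"
    using True ex_has_least_nat[of Q _ degree] unfolding Q_def by metis
  have "degree m \<noteq> 0"
  proof
    assume "degree m = 0"
    then obtain c where "m = [:c:]" by (rule degree_eq_zeroE)
    then show False using m by (auto simp: Q_def)
  qed
  \<comment> \<open>In characteristic 0 the derivative of \<open>m\<close> is a nonzero polynomial
    of smaller degree, so by minimality it does not vanish at \<open>t\<close>.\<close>
  have m': "poly (pderiv m) t \<noteq> 0"
  proof
    assume "poly (pderiv m) t = 0"
    moreover have "pderiv m \<noteq> 0" using \<open>degree m \<noteq> 0\<close> by (simp add: pderiv_eq_0_iff)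
    ultimately have "Q (pderiv m)" using m polys_over_pderiv[OF E, of m] by (simp add: Q_def)
    from min[OF this] show False using \<open>degree m \<noteq> 0\<close> by (simp add: degree_pderiv)
  qed
  define s where "s = - poly (map_poly D m) t / poly (pderiv m) t"
  have sm: "ext_deriv D t s m = 0" using m' by (simp add: ext_deriv_def s_def)
  \<comment> \<open>Up to a nonzero factor from \<open>E\<close>, every annihilating polynomial is a
    multiple of \<open>m\<close>.\<close>
  have "ext_deriv D t s p = 0" if p: "p \<in> polys_over E" "poly p t = 0" for p
  proof -
    obtain c q r where cqr: "c \<in> E - {0}" "q \<in> polys_over E" "r \<in> polys_over E"
      "smult c p = q * m + r" "r = 0 \<or> degree r < degree m"
      using pseudo_division_over[OF E _ _ p(1), of m] m unfolding Q_def by blast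
    have "poly (smult c p) t = poly (q * m + r) t" using cqr(4) by simp
    then have "poly r t = 0" using p m by (simp add: Q_def)
    then have "r = 0" using cqr(3,5) min[of r] unfolding Q_def by fastforce
    then have e: "[:c:] * p = q * m" using cqr(4) by simp
    have c: "[:c:] \<in> polys_over E"
      using cqr E by (auto simp: polys_over_def is_subring_def coeff_pCons split: nat.splits)
    have "c * ext_deriv D t s p = ext_deriv D t s ([:c:] * p)"
      using ext_deriv_mult[OF E D c p(1)] p by simp
    also have "\<dots> = 0"
      unfolding e using ext_deriv_mult[OF E D cqr(2), of m] m sm by (simp add: Q_def)
    finally show ?thesis using cqr by simp
  qed
  from derivation_extend[OF E D this] show ?thesis by blast
qed

lemma derivation_extend_list:
  fixes E :: "'a::{field,ring_char_0} set"
  assumes "is_subring E" "derivation_on E D"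
  shows "\<exists>E' D'. is_subring E' \<and> derivation_on E' D' \<and> E \<subseteq> E' \<and> set ys \<subseteq> E' \<and> (\<forall>x\<in>E. D' x = D x)"
  using assms
proof (induction ys arbitrary: E D)
  case (Cons y ys)
  obtain D1 where D1: "derivation_on (adjoin E y) D1" "\<forall>x\<in>E. D1 x = D x"
    using derivation_extend_ex[OF Cons.prems] by blast
  obtain E' D' where *: "is_subring E'" "derivation_on E' D'" "adjoin E y \<subseteq> E'" "set ys \<subseteq> E'"
    "\<forall>x\<in>adjoin E y. D' x = D1 x"
    using Cons.IH[OF adjoin_subring[OF Cons.prems(1)] D1(1)] by blast
  then show ?case using D1 subset_adjoin[OF Cons.prems(1), of y] mem_adjoin[OF Cons.prems(1), of y]
    by (intro exI[of _ E'] exI[of _ D']) auto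
qed auto

text \<open>If \<open>u\<close> were transcendental over \<open>E\<close>, then \<open>d/du\<close> would extend to all of the \<open>ys\<close>.\<close>

lemma algebraic_if_no_derivation:
  fixes E :: "'a::{field,ring_char_0} set"
  assumes E: "is_subring E"
    and no: "\<And>E' D. is_subring E' \<Longrightarrow> derivation_on E' D \<Longrightarrow> E \<subseteq> E' \<Longrightarrow> u \<in> E' \<Longrightarrow> set ys \<subseteq> E' \<Longrightarrow>
        (\<forall>x\<in>E. D x = 0) \<Longrightarrow> D u = 0"
  shows "\<exists>p\<in>polys_over E. p \<noteq> 0 \<and> poly p u = 0"
proof (rule ccontr)
  assume *: "\<not> ?thesis"
  have d0: "derivation_on E (\<lambda>_. 0)" by (simp add: derivation_on_def)
  have "ext_deriv (\<lambda>_. 0) u 1 p = 0" if "p \<in> polys_over E" "poly p u = 0" for p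
  proof -
    from that * have "p = 0" by blast
    then show ?thesis by (simp add: ext_deriv_def)
  qed
  from derivation_extend[OF E d0 this]
  obtain D1 where D1: "derivation_on (adjoin E u) D1" "\<forall>x\<in>E. D1 x = 0" "D1 u = 1" by blast
  obtain E' D' where "is_subring E'" "derivation_on E' D'" "adjoin E u \<subseteq> E'" "set ys \<subseteq> E'"
    "\<forall>x\<in>adjoin E u. D' x = D1 x"
    using derivation_extend_list[OF adjoin_subring[OF E] D1(1)] by blast
  moreover note subset_adjoin[OF E, of u] mem_adjoin[OF E, of u]
  ultimately have "D' u = D1 u" "E \<subseteq> E'" "u \<in> E'" "\<forall>x\<in>E. D' x = 0" using D1(2) by auto
  then have "D' u = 0" using no[of E' D'] \<open>is_subring E'\<close> \<open>derivation_on E' D'\<close> \<open>set ys \<subseteq> E'\<close> by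
      blast
  with \<open>D' u = D1 u\<close> D1(3) show False by simp
qed

section \<open>Generating functions of unambiguous grammars\<close>

text \<open>Meaningful only if the fibres are finite, as the cardinality of an infinite set is \<open>0\<close>.\<close>

definition gf :: "('x \<Rightarrow> nat) \<Rightarrow> 'x set \<Rightarrow> complex fps" where
  "gf s X = Abs_fps (\<lambda>n. of_nat (card {x \<in> X. s x = n}))"

definition fibres_finite :: "('x \<Rightarrow> nat) \<Rightarrow> 'x set \<Rightarrow> bool" where
  "fibres_finite s X \<longleftrightarrow> (\<forall>n. finite {x \<in> X. s x = n})"

lemma gf_image:
  assumes "inj_on h X" "\<And>x. x \<in> X \<Longrightarrow> s (h x) = t x"
  shows "gf s (h ` X) = gf t X"
proof -
  have "card {x \<in> h ` X. s x = n} = card {x \<in> X. t x = n}" for n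
  proof -
    have "{x \<in> h ` X. s x = n} = h ` {x \<in> X. t x = n}" using assms(2) by auto
    moreover have "inj_on h {x \<in> X. t x = n}" using assms(1) by (rule inj_on_subset) auto
    ultimately show ?thesis by (simp add: card_image)
  qed
  then show ?thesis by (simp add: gf_def)
qed

lemma gf_UN:
  assumes "finite I" "\<And>i. i \<in> I \<Longrightarrow> fibres_finite s (X i)"
    "\<And>i j. i \<in> I \<Longrightarrow> j \<in> I \<Longrightarrow> i \<noteq> j \<Longrightarrow> X i \<inter> X j = {}"
  shows "gf s (\<Union>i\<in>I. X i) = (\<Sum>i\<in>I. gf s (X i))"
proof -
  have "card {x \<in> (\<Union>i\<in>I. X i). s x = n} = (\<Sum>i\<in>I. card {x \<in> X i. s x = n})" for n
  proof -
    have "{x \<in> (\<Union>i\<in>I. X i). s x = n} = (\<Union>i\<in>I. {x \<in> X i. s x = n})" by auto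
    moreover have "card (\<Union>i\<in>I. {x \<in> X i. s x = n}) = (\<Sum>i\<in>I. card {x \<in> X i. s x = n})"
    proof (rule card_UN_disjoint[OF assms(1)])
      show "\<forall>i\<in>I. \<forall>j\<in>I. i \<noteq> j \<longrightarrow> {x \<in> X i. s x = n} \<inter> {x \<in> X j. s x = n} = {}"
        using assms(3) by blast
    qed (use assms(2) in \<open>simp add: fibres_finite_def\<close>)
    ultimately show ?thesis by simp
  qed
  then show ?thesis by (intro fps_ext) (simp add: gf_def fps_sum_nth)
qed

lemma gf_Times:
  assumes "fibres_finite s X" "fibres_finite t Y"
  shows "gf (\<lambda>(x, y). s x + t y) (X \<times> Y) = gf s X * gf t Y"
proof (rule fps_ext)
  fix n
  have "{p \<in> X \<times> Y. (case p of (x, y) \<Rightarrow> s x + t y) = n}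
      = (\<Union>i\<in>{0..n}. {x \<in> X. s x = i} \<times> {y \<in> Y. t y = n - i})" by auto
  moreover have "card (\<Union>i\<in>{0..n}. {x \<in> X. s x = i} \<times> {y \<in> Y. t y = n - i})
      = (\<Sum>i\<in>{0..n}. card ({x \<in> X. s x = i} \<times> {y \<in> Y. t y = n - i}))"
    using assms by (intro card_UN_disjoint) (auto simp: fibres_finite_def)
  ultimately show "gf (\<lambda>(x, y). s x + t y) (X \<times> Y) $ n = (gf s X * gf t Y) $ n"
    by (simp add: gf_def fps_mult_nth card_cartesian_product)
qed

lemma fibres_finite_Times:
  assumes "fibres_finite s X" "fibres_finite t Y"
  shows "fibres_finite (\<lambda>(x, y). s x + t y) (X \<times> Y)"
  unfolding fibres_finite_def
proof
  fix n
  have "{p \<in> X \<times> Y. (case p of (x, y) \<Rightarrow> s x + t y) = n}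
      \<subseteq> (\<Union>i\<in>{0..n}. {x \<in> X. s x = i} \<times> {y \<in> Y. t y = n - i})" by auto
  then show "finite {p \<in> X \<times> Y. (case p of (x, y) \<Rightarrow> s x + t y) = n}"
    by (rule finite_subset) (use assms in \<open>auto simp: fibres_finite_def\<close>)
qed

lemma fibres_finite_image:
  assumes "fibres_finite t X" "\<And>x. x \<in> X \<Longrightarrow> s (h x) = t x"
  shows "fibres_finite s (h ` X)"
  unfolding fibres_finite_def
proof
  fix n
  have "{x \<in> h ` X. s x = n} \<subseteq> h ` {x \<in> X. t x = n}" using assms(2) by auto
  then show "finite {x \<in> h ` X. s x = n}"
    using assms(1) unfolding fibres_finite_def by (meson finite_imageI finite_subset)
qed

definition choices :: "('a \<Rightarrow> 'x set) \<Rightarrow> 'a list \<Rightarrow> 'x list set" where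
  "choices X as = {xs. list_all2 (\<lambda>x a. x \<in> X a) xs as}"

lemma choices_Cons: "choices X (a # as) = (\<lambda>(x, xs). x # xs) ` (X a \<times> choices X as)"
  by (auto simp: choices_def list_all2_Cons2)

lemma gf_choices:
  assumes "\<And>a. a \<in> set as \<Longrightarrow> fibres_finite s (X a)"
  shows "gf (\<lambda>xs. sum_list (map s xs)) (choices X as) = (\<Prod>a\<leftarrow>as. gf s (X a)) \<and>
    fibres_finite (\<lambda>xs. sum_list (map s xs)) (choices X as)"
  using assms
proof (induction as)
  case Nil
  have "{xs \<in> choices X []. sum_list (map s xs) = n} = (if n = 0 then {[]} else {})" for n
    by (auto simp: choices_def)
  then show ?case
    by (auto simp: gf_def fibres_finite_def fps_eq_iff)
next
  case (Cons a as)
  let ?t = "\<lambda>xs. sum_list (map s xs)"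
  have IH: "gf ?t (choices X as) = (\<Prod>a\<leftarrow>as. gf s (X a))" "fibres_finite ?t (choices X as)"
    using Cons by auto
  have a: "fibres_finite s (X a)" using Cons.prems by simp
  have "inj_on (\<lambda>(x, xs). x # xs) (X a \<times> choices X as)" by (auto simp: inj_on_def)
  then have "gf ?t (choices X (a # as)) = gf (\<lambda>(x, xs). s x + ?t xs) (X a \<times> choices X as)"
    unfolding choices_Cons by (intro gf_image) auto
  also have "\<dots> = gf s (X a) * gf ?t (choices X as)"
    by (rule gf_Times[OF a IH(2)])
  finally have 1: "gf ?t (choices X (a # as)) = (\<Prod>a\<leftarrow>a # as. gf s (X a))" using IH(1) by simp
  have "fibres_finite ?t (choices X (a # as))"
    unfolding choices_Cons
    by (rule fibres_finite_image[OF fibres_finite_Times[OF a IH(2)]]) auto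
  with 1 show ?case by blast
qed

lemma gf_nth_0_iff:
  assumes "fibres_finite s X"
  shows "gf s X $ 0 \<noteq> 0 \<longleftrightarrow> (\<exists>x\<in>X. s x = 0)"
proof -
  have "finite {x \<in> X. s x = 0}" using assms by (simp add: fibres_finite_def)
  then show ?thesis by (auto simp: gf_def card_eq_0_iff)
qed

text \<open>A derivation on Laurent series may take values with poles, so the lowest exponent
  \<open>m\<close> is an arbitrary integer.\<close>

lemma fls_nth_mult_fps:
  fixes v :: "'a::idom fls"
  assumes "\<And>n. n < m \<Longrightarrow> v $$ n = 0"
  shows "(fps_to_fls p * v) $$ m = p $ 0 * v $$ m"
proof (cases "v = 0 \<or> p = 0")
  case False
  then have v: "m \<le> fls_subdegree v" using assms by (intro fls_subdegree_geI) auto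
  have p: "0 \<le> fls_subdegree (fps_to_fls p)" by (simp add: fls_subdegree_fls_to_fps)
  show ?thesis
  proof (cases "fls_subdegree v = m \<and> fls_subdegree (fps_to_fls p) = 0")
    case True
    then show ?thesis by (subst fls_times_nth(2)) simp
  next
    case c: False
    then have "m < fls_subdegree (fps_to_fls p) + fls_subdegree v" using v p by linarith
    then have "(fps_to_fls p * v) $$ m = 0" by (rule fls_times_nth_eq0)
    moreover have "p $ 0 = 0 \<or> v $$ m = 0"
    proof (cases "fls_subdegree v = m")
      case True
      then have "0 < fls_subdegree (fps_to_fls p)" using c p by simp
      then have "fps_to_fls p $$ 0 = 0" by (rule fls_eq0_below_subdegree)
      then show ?thesis by simp
    next
      case False
      then show ?thesis using v by (intro disjI2 fls_eq0_below_subdegree) simp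
    qed
    ultimately show ?thesis by auto
  qed
qed auto

lemma fls_nth_sum: "sum f A $$ n = (\<Sum>x\<in>A. f x $$ n)"
  by (induction A rule: infinite_finite_induct) auto

lemma derivation_on_prod_list:
  assumes E: "is_subring E" and D: "derivation_on E D" and "\<And>x. x \<in> set xs \<Longrightarrow> f x \<in> E"
  shows "D (prod_list (map f xs))
    = (\<Sum>i<length xs. prod_list (map f (take i xs @ drop (Suc i) xs)) * D (f (xs ! i)))"
  using assms(3)
proof (induction xs)
  case Nil
  then show ?case by (simp add: derivation_on_1[OF E D])
next
  case (Cons x xs)
  have m: "f x \<in> E" "prod_list (map f xs) \<in> E"
    using Cons.prems by (auto intro!: subring_prod_list[OF E])
  then have "D (f x * prod_list (map f xs)) = D (f x) * prod_list (map f xs) + f x * D (prod_list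
      (map f xs))"
    using D by (auto simp: derivation_on_def)
  then show ?case using Cons
    by (simp add: sum.lessThan_Suc_shift sum_distrib_left mult_ac del: sum.lessThan_Suc)
qed

lemma prod_list_nth_0: "prod_list xs $ 0 = prod_list (map (\<lambda>x :: 'a::comm_semiring_1 fps. x $ 0)
    xs)"
  by (induction xs) auto

lemma fps_to_fls_prod_list:
  "fps_to_fls (prod_list xs) = prod_list (map fps_to_fls (xs :: 'a::comm_semiring_1 fps list))"
  by (induction xs) (auto simp: fls_times_fps_to_fls)

lemma fps_to_fls_sum: "fps_to_fls (sum f A) = (\<Sum>x\<in>A. fps_to_fls (f x))"
  by (induction A rule: infinite_finite_induct) auto

section \<open>Derivation trees of an unambiguous grammar\<close>

definition trees :: "('n, 't) cfg \<Rightarrow> ('n, 't) symbol \<Rightarrow> ('n, 't) tree set" where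
  "trees G s = {t. conforms G t \<and> Defs.root t = s}"

abbreviation yield_length :: "('n, 't) tree \<Rightarrow> nat" where
  "yield_length t \<equiv> length (Defs.frontier t)"

definition prod_rhs :: "('n, 't) cfg \<Rightarrow> 'n \<Rightarrow> ('n, 't) symbol list set" where
  "prod_rhs G A = {\<alpha>. (A, \<alpha>) \<in> rules G \<and> (\<forall>s \<in> set \<alpha>. trees G s \<noteq> {})}"

text \<open>Unambiguity says nothing about nonterminals that occur in no tree of a generated word;
  such a nonterminal may even have infinitely many trees with one frontier. Hence the restriction to
  those reached from the start symbol through productive rules.\<close>

inductive useful :: "('n, 't) cfg \<Rightarrow> 'n \<Rightarrow> bool" for G where
  start: "useful G (start G)"
| step: "useful G A \<Longrightarrow> \<alpha> \<in> prod_rhs G A \<Longrightarrow> NT B \<in> set \<alpha> \<Longrightarrow> useful G B"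

lemma choices_trees: "choices (trees G) \<alpha> = {ts. map Defs.root ts = \<alpha> \<and> (\<forall>t\<in>set ts. conforms G t)}"
proof -
  have "list_all2 (\<lambda>t s. t \<in> trees G s) ts \<alpha> \<longleftrightarrow> map Defs.root ts = \<alpha> \<and> (\<forall>t\<in>set ts. conforms G t)"
      for ts
    by (induction ts arbitrary: \<alpha>) (auto simp: trees_def list_all2_Cons1)
  then show ?thesis by (simp add: choices_def)
qed

lemma choices_nonempty: "(\<forall>s\<in>set \<alpha>. X s \<noteq> {}) \<Longrightarrow> choices X \<alpha> \<noteq> {}"
proof (induction \<alpha>)
  case Nil
  then show ?case by (auto simp: choices_def)
next
  case (Cons s \<alpha>)
  then show ?case by (auto simp: choices_Cons)
qed

lemma trees_NT: "trees G (NT A) = (\<Union>\<alpha>\<in>prod_rhs G A. Node A ` choices (trees G) \<alpha>)"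
proof
  show "trees G (NT A) \<subseteq> (\<Union>\<alpha>\<in>prod_rhs G A. Node A ` choices (trees G) \<alpha>)"
  proof
    fix t assume "t \<in> trees G (NT A)"
    then obtain ts where t: "t = Node A ts" "(A, map Defs.root ts) \<in> rules G" "\<forall>t\<in>set ts. conforms
        G t"
      by (cases t) (auto simp: trees_def)
    then have "map Defs.root ts \<in> prod_rhs G A" by (auto simp: prod_rhs_def trees_def)
    with t show "t \<in> (\<Union>\<alpha>\<in>prod_rhs G A. Node A ` choices (trees G) \<alpha>)"
      by (auto simp: choices_trees)
  qed
  show "(\<Union>\<alpha>\<in>prod_rhs G A. Node A ` choices (trees G) \<alpha>) \<subseteq> trees G (NT A)"
    by (auto simp: prod_rhs_def choices_trees trees_def)
qed

lemma frontier_terminals: "conforms G t \<Longrightarrow> set (Defs.frontier t) \<subseteq> terminals G"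
  by (induction t) auto

context
  fixes G :: "('n, 't) cfg"
  assumes wf: "wf_cfg G" and unamb: "unambiguous G"
begin

lemma useful_nonterminal: "useful G A \<Longrightarrow> A \<in> nonterminals G"
  by (induction rule: useful.induct) (use wf in \<open>auto simp: wf_cfg_def prod_rhs_def\<close>)

text \<open>Ambiguity propagates upwards: filling the siblings of \<open>B\<close> with fixed trees
  embeds the trees with root \<open>B\<close> into those with root \<open>A\<close>, and equal
  frontiers stay equal.\<close>

lemma useful_inj: "useful G A \<Longrightarrow> inj_on Defs.frontier (trees G (NT A))"
proof (induction rule: useful.induct)
  case start
  show ?case
  proof (rule inj_onI)
    fix t u assume "t \<in> trees G (NT (start G))" "u \<in> trees G (NT (start G))" "Defs.frontier t =
        Defs.frontier u"
    then have *: "derivation_tree G (Defs.frontier t) t" "derivation_tree G (Defs.frontier t) u"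
      by (auto simp: derivation_tree_def trees_def)
    then have "Defs.frontier t \<in> cfg_lang G" using cfg_lang_iff_derivation_tree[OF wf] by blast
    with * show "t = u" using unamb unfolding unambiguous_def by blast
  qed
next
  case (step A \<alpha> B)
  obtain \<alpha>1 \<alpha>2 where \<alpha>: "\<alpha> = \<alpha>1 @ NT B # \<alpha>2" using step.hyps(3) by (meson split_list)
  have "choices (trees G) \<alpha>1 \<noteq> {}" "choices (trees G) \<alpha>2 \<noteq> {}"
    using step.hyps(2) by (auto simp: prod_rhs_def \<alpha> intro!: choices_nonempty)
  then obtain ts1 ts2 where ts: "ts1 \<in> choices (trees G) \<alpha>1" "ts2 \<in> choices (trees G) \<alpha>2" by blast
  show ?case
  proof (rule inj_onI)
    fix t u assume tu: "t \<in> trees G (NT B)" "u \<in> trees G (NT B)" "Defs.frontier t = Defs.frontier u"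
    have "Node A (ts1 @ t # ts2) \<in> trees G (NT A)" "Node A (ts1 @ u # ts2) \<in> trees G (NT A)"
      using ts tu step.hyps(2) by (auto simp: trees_def choices_trees prod_rhs_def \<alpha>)
    moreover have "Defs.frontier (Node A (ts1 @ t # ts2)) = Defs.frontier (Node A (ts1 @ u #
        ts2))" using tu by simp
    ultimately have "Node A (ts1 @ t # ts2) = Node A (ts1 @ u # ts2)" by (rule inj_onD[OF step.IH,
        rotated])
    then show "t = u" by simp
  qed
qed

lemma fibres_finite_Tm: "fibres_finite yield_length (trees G (Tm a))"
proof -
  have "trees G (Tm a) \<subseteq> {Leaf a}"
  proof
    fix t assume "t \<in> trees G (Tm a)"
    then show "t \<in> {Leaf a}" by (cases t) (auto simp: trees_def)
  qed
  then show ?thesis unfolding fibres_finite_def by (auto intro: finite_subset)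
qed

text \<open>With an injective frontier there are at most as many trees of a given yield length as
  words of that length over the finite set of terminals.\<close>

lemma fibres_finite_useful:
  assumes "useful G A"
  shows "fibres_finite yield_length (trees G (NT A))"
  unfolding fibres_finite_def
proof
  fix n
  have 1: "Defs.frontier ` {t \<in> trees G (NT A). yield_length t = n} \<subseteq> {w. set w \<subseteq> terminals G \<and>
      length w = n}"
    using frontier_terminals by (force simp: trees_def)
  have 2: "finite {w. set w \<subseteq> terminals G \<and> length w = n}"
    using wf by (intro finite_lists_length_eq) (simp add: wf_cfg_def)
  have 3: "inj_on Defs.frontier {t \<in> trees G (NT A). yield_length t = n}"
    using useful_inj[OF assms] by (rule inj_on_subset) auto
  show "finite {t \<in> trees G (NT A). yield_length t = n}"
    by (rule finite_imageD[OF finite_subset[OF 1 2] 3])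
qed

definition tree_gf :: "('n, 't) symbol \<Rightarrow> complex fps" where
  "tree_gf s = gf yield_length (trees G s)"

lemma rhs_fibres_finite:
  assumes "useful G A" "\<alpha> \<in> prod_rhs G A" "s \<in> set \<alpha>"
  shows "fibres_finite yield_length (trees G s)"
proof (cases s)
  case (NT B)
  then show ?thesis using assms by (auto intro: fibres_finite_useful useful.step)
qed (simp add: fibres_finite_Tm)

lemma finite_prod_rhs: "finite (prod_rhs G A)"
proof -
  have "prod_rhs G A \<subseteq> snd ` rules G" by (force simp: prod_rhs_def)
  then show ?thesis using wf by (meson finite_imageI finite_subset wf_cfg_def)
qed

lemma tree_gf_eq:
  assumes "useful G A"
  shows "tree_gf (NT A) = (\<Sum>\<alpha>\<in>prod_rhs G A. \<Prod>s\<leftarrow>\<alpha>. tree_gf s)"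
proof -
  have ch: "gf (\<lambda>ts. sum_list (map yield_length ts)) (choices (trees G) \<alpha>) = (\<Prod>s\<leftarrow>\<alpha>. tree_gf s) \<and>
     fibres_finite (\<lambda>ts. sum_list (map yield_length ts)) (choices (trees G) \<alpha>)" if "\<alpha> \<in> prod_rhs G
         A" for \<alpha>
    unfolding tree_gf_def using rhs_fibres_finite[OF assms that] by (intro gf_choices) auto
  have sz: "yield_length (Node A ts) = sum_list (map yield_length ts)" for ts :: "('n, 't) tree
      list"
    by (simp add: length_concat comp_def)
  have "tree_gf (NT A) = (\<Sum>\<alpha>\<in>prod_rhs G A. gf yield_length (Node A ` choices (trees G) \<alpha>))"
    unfolding tree_gf_def trees_NT
  proof (rule gf_UN[OF finite_prod_rhs])
    fix \<alpha> assume "\<alpha> \<in> prod_rhs G A"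
    then show "fibres_finite yield_length (Node A ` choices (trees G) \<alpha>)"
      using ch by (intro fibres_finite_image[of "\<lambda>ts. sum_list (map yield_length ts)"] sz) auto
  qed (auto simp: choices_trees)
  also have "\<dots> = (\<Sum>\<alpha>\<in>prod_rhs G A. \<Prod>s\<leftarrow>\<alpha>. tree_gf s)"
  proof (rule sum.cong)
    fix \<alpha> assume "\<alpha> \<in> prod_rhs G A"
    then have "(\<Prod>s\<leftarrow>\<alpha>. tree_gf s) = gf (\<lambda>ts. sum_list (map yield_length ts)) (choices (trees G) \<alpha>)"
      using ch by simp
    also have "\<dots> = gf yield_length (Node A ` choices (trees G) \<alpha>)"
      by (intro gf_image[symmetric] sz) (simp add: inj_on_def)
    finally show "gf yield_length (Node A ` choices (trees G) \<alpha>) = (\<Prod>s\<leftarrow>\<alpha>. tree_gf s)" by simp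
  qed simp
  finally show ?thesis .
qed

lemma tree_gf_Tm: "tree_gf (Tm a) = (if a \<in> terminals G then fps_X else 0)"
proof -
  have T: "t \<in> trees G (Tm a) \<longleftrightarrow> a \<in> terminals G \<and> t = Leaf a" for t
    by (cases t) (auto simp: trees_def)
  have "card {t \<in> trees G (Tm a). yield_length t = n} = (if a \<in> terminals G \<and> n = 1 then 1 else
      0)" for n
  proof -
    have "{t \<in> trees G (Tm a). yield_length t = n} = (if a \<in> terminals G \<and> n = 1 then {Leaf a}
        else {})"
      unfolding T by auto
    then show ?thesis by simp
  qed
  then show ?thesis by (simp add: tree_gf_def gf_def fps_eq_iff)
qed

text \<open>\<open>B\<close> derives from \<open>A\<close> inside an otherwise empty context. Unambiguity makes this acyclic,
  which is what makes the Jacobian of the system invertible.\<close>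

definition unit_rel :: "('n \<times> 'n) set" where
  "unit_rel = {(B, A). useful G A \<and> useful G B \<and> trees G (NT B) \<noteq> {} \<and>
     (\<exists>ts1 ts2. (\<forall>t\<in>set (ts1 @ ts2). conforms G t \<and> Defs.frontier t = []) \<and>
        (A, map Defs.root ts1 @ NT B # map Defs.root ts2) \<in> rules G)}"

lemma unit_rel_tree:
  assumes "(B, A) \<in> unit_rel\<^sup>+" "t \<in> trees G (NT B)"
  shows "\<exists>t'\<in>trees G (NT A). Defs.frontier t' = Defs.frontier t \<and> size t < size t'"
  using assms
proof (induction arbitrary: rule: trancl_induct)
  have one: "\<exists>t'\<in>trees G (NT A). Defs.frontier t' = Defs.frontier t \<and> size t < size t'"
    if "(B, A) \<in> unit_rel" "t \<in> trees G (NT B)" for A B t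
  proof -
    from that obtain ts1 ts2 where ts: "\<forall>t\<in>set (ts1 @ ts2). conforms G t \<and> Defs.frontier t = []"
        "(A, map Defs.root ts1 @ NT B # map Defs.root ts2) \<in> rules G"
      by (auto simp: unit_rel_def)
    then have c: "concat (map Defs.frontier ts1) = []" "concat (map Defs.frontier ts2) = []"
      by (simp_all add: concat_eq_Nil_conv)
    show ?thesis using ts that(2)
      by (intro bexI[of _ "Node A (ts1 @ t # ts2)"]) (auto simp: trees_def c)
  qed
  {
    case (base A)
    then show ?case using one by blast
  next
    case (step A C)
    then obtain t' where "t' \<in> trees G (NT A)" "Defs.frontier t' = Defs.frontier t" "size t < size
        t'" by blast
    moreover from this obtain t'' where "t'' \<in> trees G (NT C)" "Defs.frontier t'' = Defs.frontier
        t'" "size t' < size t''"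
      using one[OF step.hyps(2)] by blast
    ultimately show ?case by (intro bexI[of _ t'']) auto
  }
qed

text \<open>A cycle would turn a tree into a larger one with the same root and frontier, against
  \<open>useful_inj\<close>.\<close>

lemma wf_unit_rel: "wf unit_rel"
proof (rule finite_acyclic_wf)
  have "unit_rel \<subseteq> nonterminals G \<times> nonterminals G"
    using useful_nonterminal by (auto simp: unit_rel_def)
  then show "finite unit_rel" using wf by (meson finite_SigmaI finite_subset wf_cfg_def)
  show "acyclic unit_rel"
    unfolding acyclic_def
  proof (intro allI notI)
    fix A assume A: "(A, A) \<in> unit_rel\<^sup>+"
    then obtain B where "(A, B) \<in> unit_rel" by (meson tranclD)
    then obtain t where t: "t \<in> trees G (NT A)" and u: "useful G A" by (auto simp: unit_rel_def)
    obtain t' where "t' \<in> trees G (NT A)" "Defs.frontier t' = Defs.frontier t" "size t < size t'"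
      using unit_rel_tree[OF A t] by blast
    then show False using useful_inj[OF u] t by (metis inj_onD less_irrefl)
  qed
qed

text \<open>Comparison of lowest coefficients: \<open>m\<close> is the least order among the nonzero
  derivatives \<open>v A\<close>. In the differentiated system the coefficient at \<open>m\<close>
  receives contributions only from occurrences of \<open>B\<close> whose siblings all derive the
  empty word, that is, from pairs in \<open>unit_rel\<close>. For a \<open>unit_rel\<close>-minimal
  nonterminal with nonzero coefficient at \<open>m\<close> these contributions vanish, a
  contradiction.\<close>

lemma derivation_tree_gf:
  assumes E: "is_subring E" and D: "derivation_on E D"
    and X: "fls_X \<in> E" "D fls_X = 0"
    and Y: "\<And>A. useful G A \<Longrightarrow> fps_to_fls (tree_gf (NT A)) \<in> E"
    and A: "useful G A"
  shows "D (fps_to_fls (tree_gf (NT A))) = 0"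
proof (rule ccontr)
  define v where "v A = D (fps_to_fls (tree_gf (NT A)))" for A
  assume "D (fps_to_fls (tree_gf (NT A))) \<noteq> 0"
  then have vA: "v A \<noteq> 0" by (simp add: v_def)
  define M where "M = (\<lambda>A. fls_subdegree (v A)) ` {A. useful G A \<and> v A \<noteq> 0}"
  have "finite {A. useful G A \<and> v A \<noteq> 0}"
    by (rule finite_subset[of _ "nonterminals G"]) (use wf useful_nonterminal in \<open>auto simp:
        wf_cfg_def\<close>)
  then have fM: "finite M" by (simp add: M_def)
  define m where "m = Min M"
  have "m \<in> M" unfolding m_def using fM vA A by (intro Min_in) (auto simp: M_def)
  then obtain A0 where A0: "useful G A0" "v A0 \<noteq> 0" "fls_subdegree (v A0) = m" by (auto simp: M_def)
  have below: "v B $$ n = 0" if "useful G B" "n < m" for B n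
  proof (cases "v B = 0")
    case False
    then have "m \<le> fls_subdegree (v B)" unfolding m_def using fM that by (intro Min_le) (auto
        simp: M_def)
    then show ?thesis using that by (intro fls_eq0_below_subdegree) simp
  qed simp
  define Q where "Q = {A. useful G A \<and> v A $$ m \<noteq> 0}"
  have "A0 \<in> Q" using A0 nth_fls_subdegree_nonzero[of "v A0"] by (auto simp: Q_def)
  then obtain A1 where A1: "A1 \<in> Q" and min: "\<And>B. (B, A1) \<in> unit_rel \<Longrightarrow> B \<notin> Q"
    using wfE_min[OF wf_unit_rel] by metis
  have u1: "useful G A1" using A1 by (simp add: Q_def)
  have Ys: "fps_to_fls (tree_gf s) \<in> E" if "\<alpha> \<in> prod_rhs G A1" "s \<in> set \<alpha>" for \<alpha> s
  proof (cases s)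
    case (NT B)
    then have "useful G B" using useful.step[OF u1 that(1)] that(2) by simp
    then show ?thesis unfolding NT by (rule Y)
  next
    case (Tm a)
    then show ?thesis using X E by (simp add: tree_gf_Tm is_subring_def)
  qed
  have eq: "fps_to_fls (tree_gf (NT A1)) = (\<Sum>\<alpha>\<in>prod_rhs G A1. \<Prod>s\<leftarrow>\<alpha>. fps_to_fls (tree_gf s))"
    by (simp add: tree_gf_eq[OF u1] fps_to_fls_sum fps_to_fls_prod_list comp_def)
  have "v A1 = (\<Sum>\<alpha>\<in>prod_rhs G A1. D (\<Prod>s\<leftarrow>\<alpha>. fps_to_fls (tree_gf s)))"
    unfolding v_def eq using Ys by (intro derivation_on_sum[OF E D] subring_prod_list[OF E]) auto
  also have "\<dots> = (\<Sum>\<alpha>\<in>prod_rhs G A1. \<Sum>i<length \<alpha>.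
      fps_to_fls (\<Prod>s\<leftarrow>take i \<alpha> @ drop (Suc i) \<alpha>. tree_gf s) * D (fps_to_fls (tree_gf (\<alpha> ! i))))"
    by (intro sum.cong refl)
      (simp add: derivation_on_prod_list[OF E D] Ys fps_to_fls_prod_list fls_times_fps_to_fls
          comp_def)
  finally have "v A1 $$ m = (\<Sum>\<alpha>\<in>prod_rhs G A1. \<Sum>i<length \<alpha>.
      (fps_to_fls (\<Prod>s\<leftarrow>take i \<alpha> @ drop (Suc i) \<alpha>. tree_gf s) * D (fps_to_fls (tree_gf (\<alpha> ! i)))) $$
          m)"
    by (simp add: fls_nth_sum)
  also have "\<dots> = 0"
  proof (intro sum.neutral ballI)
    fix \<alpha> i assume \<alpha>: "\<alpha> \<in> prod_rhs G A1" and "i \<in> {..<length \<alpha>}"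
    then have i: "i < length \<alpha>" by simp
    define p where "p = (\<Prod>s\<leftarrow>take i \<alpha> @ drop (Suc i) \<alpha>. tree_gf s)"
    show "(fps_to_fls (\<Prod>s\<leftarrow>take i \<alpha> @ drop (Suc i) \<alpha>. tree_gf s) * D (fps_to_fls (tree_gf (\<alpha> !
        i)))) $$ m = 0"
      unfolding p_def[symmetric]
    proof (cases "\<alpha> ! i")
      case (Tm a)
      then have "D (fps_to_fls (tree_gf (\<alpha> ! i))) = 0"
        using X derivation_on_0[OF E D] by (simp add: tree_gf_Tm)
      then show "(fps_to_fls p * D (fps_to_fls (tree_gf (\<alpha> ! i)))) $$ m = 0" by simp
    next
      case (NT B)
      have split: "\<alpha> = take i \<alpha> @ NT B # drop (Suc i) \<alpha>" using i NT by (metis id_take_nth_drop)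
      have inB: "NT B \<in> set \<alpha>" using i NT by (metis nth_mem)
      have uB: "useful G B" using useful.step[OF u1 \<alpha> inB] .
      have "(fps_to_fls p * v B) $$ m = p $ 0 * v B $$ m"
        using below[OF uB] by (intro fls_nth_mult_fps) auto
      moreover have "v B $$ m = 0" if "p $ 0 \<noteq> 0"
      proof -
        have "\<exists>t\<in>trees G s. Defs.frontier t = []" if s: "s \<in> set (take i \<alpha> @ drop (Suc i) \<alpha>)" for s
        proof -
          have "s \<in> set \<alpha>" using s by (auto dest: in_set_takeD in_set_dropD)
          have "tree_gf s $ 0 \<noteq> 0"
            using \<open>p $ 0 \<noteq> 0\<close> s unfolding p_def prod_list_nth_0 by (force simp: prod_list_zero_iff)
          then show ?thesis
            using gf_nth_0_iff[OF rhs_fibres_finite[OF u1 \<alpha> \<open>s \<in> set \<alpha>\<close>]] by (simp add: tree_gf_def)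
        qed
        then obtain f where f: "\<And>s. s \<in> set (take i \<alpha> @ drop (Suc i) \<alpha>) \<Longrightarrow> f s \<in> trees G s \<and>
            Defs.frontier (f s) = []"
          by metis
        have r: "map Defs.root (map f (take i \<alpha>)) = take i \<alpha>" "map Defs.root (map f (drop (Suc i)
            \<alpha>)) = drop (Suc i) \<alpha>"
          using f by (auto simp: trees_def intro!: map_idI)
        have "\<forall>t\<in>set (map f (take i \<alpha>) @ map f (drop (Suc i) \<alpha>)). conforms G t \<and> Defs.frontier t =
            []"
          using f by (auto simp: trees_def)
        moreover have "(A1, map Defs.root (map f (take i \<alpha>)) @ NT B # map Defs.root (map f (drop
            (Suc i) \<alpha>))) \<in> rules G"
          unfolding r split[symmetric] using \<alpha> by (simp add: prod_rhs_def)
        moreover have "trees G (NT B) \<noteq> {}" using \<alpha> inB by (simp add: prod_rhs_def)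
        ultimately have "(B, A1) \<in> unit_rel" unfolding unit_rel_def using u1 uB by blast
        then have "B \<notin> Q" by (rule min)
        then show ?thesis using uB by (simp add: Q_def)
      qed
      ultimately show "(fps_to_fls p * D (fps_to_fls (tree_gf (\<alpha> ! i)))) $$ m = 0"
        by (auto simp: v_def NT)
    qed
  qed
  finally show False using A1 by (simp add: Q_def)
qed

end

section \<open>Algebraic series with integer coefficients\<close>

lemma sum_root_of_unity:
  assumes "n < M" "m < M"
  shows "(\<Sum>j<M. cis (2 * pi * real j / real M) ^ n * cnj (cis (2 * pi * real j / real M)) ^ m)
    = (if n = m then of_nat M else 0)"
proof -
  define q where "q = cis (2 * pi * (real n - real m) / real M)"
  have M: "M > 0" using assms by simp
  have "cis (2 * pi * real j / real M) ^ n * cnj (cis (2 * pi * real j / real M)) ^ m = q ^ j" for j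
    unfolding q_def cis_cnj Complex.DeMoivre cis_mult by (intro arg_cong[of _ _ cis]) (simp add:
        algebra_simps diff_divide_distrib)
  then have s: "(\<Sum>j<M. cis (2 * pi * real j / real M) ^ n * cnj (cis (2 * pi * real j / real M)) ^
      m) = (\<Sum>j<M. q ^ j)"
    by simp
  show ?thesis
  proof (cases "n = m")
    case True
    then show ?thesis unfolding s by (simp add: q_def)
  next
    case False
    have "q \<noteq> 1"
    proof
      assume "q = 1"
      then have "cos (2 * pi * (real n - real m) / real M) = 1" by (simp add: q_def complex_eq_iff)
      then obtain k :: int where "2 * pi * (real n - real m) / real M = real_of_int k * 2 * pi"
        using cos_one_2pi_int by blast
      then have "(2 * pi) * (real n - real m) = (2 * pi) * (real_of_int k * real M)"
        using M by (simp add: field_simps)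
      then have "real n - real m = real_of_int k * real M" by (simp only: mult_cancel_left) simp
      then have "real_of_int (int n - int m) = real_of_int (k * int M)" by simp
      then have "int n - int m = k * int M" by (simp only: of_int_eq_iff)
      moreover have "\<bar>int n - int m\<bar> < int M" using assms by linarith
      ultimately have "\<bar>k\<bar> * int M < 1 * int M" by (simp add: abs_mult)
      then have "k = 0" using M by (simp only: mult_less_cancel_right) auto
      then show False using \<open>int n - int m = k * int M\<close> False by simp
    qed
    moreover have "q ^ M = 1"
      using M cis_multiple_2pi[of "real n - real m"] by (simp add: q_def Complex.DeMoivre mult_ac)
    ultimately show ?thesis unfolding s using False by (simp add: sum_gp_strict)
  qed
qed

text \<open>For polynomials of degree below \<open>M\<close>, averaging over the \<open>M\<close>-th
  roots of unity is as good as integrating over the circle.\<close>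

lemma discrete_parseval:
  "(\<Sum>j<M. (norm (\<Sum>n<M. c n * cis (2 * pi * real j / real M) ^ n))\<^sup>2) = real M * (\<Sum>n<M. (norm (c
      n))\<^sup>2)"
proof -
  let ?w = "\<lambda>j. cis (2 * pi * real j / real M)"
  have "complex_of_real (\<Sum>j<M. (norm (\<Sum>n<M. c n * ?w j ^ n))\<^sup>2)
    = (\<Sum>j<M. (\<Sum>n<M. c n * ?w j ^ n) * cnj (\<Sum>m<M. c m * ?w j ^ m))"
    by (simp only: of_real_sum complex_norm_square)
  also have "\<dots> = (\<Sum>j<M. \<Sum>n<M. \<Sum>m<M. (c n * cnj (c m)) * (?w j ^ n * cnj (?w j) ^ m))"
    by (simp add: sum_product mult_ac)
  also have "\<dots> = (\<Sum>n<M. \<Sum>j<M. \<Sum>m<M. (c n * cnj (c m)) * (?w j ^ n * cnj (?w j) ^ m))"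
    by (rule sum.swap)
  also have "\<dots> = (\<Sum>n<M. \<Sum>m<M. \<Sum>j<M. (c n * cnj (c m)) * (?w j ^ n * cnj (?w j) ^ m))"
    by (intro sum.cong refl sum.swap)
  also have "\<dots> = (\<Sum>n<M. \<Sum>m<M. (c n * cnj (c m)) * (if n = m then of_nat M else 0))"
    by (intro sum.cong refl) (simp only: sum_root_of_unity lessThan_iff flip: sum_distrib_left)
  also have "\<dots> = (\<Sum>n<M. c n * cnj (c n) * of_nat M)"
    by (simp add: if_distrib cong: if_cong)
  also have "\<dots> = complex_of_real (real M * (\<Sum>n<M. (norm (c n))\<^sup>2))"
    by (simp only: of_real_mult of_real_sum complex_norm_square sum_distrib_left of_real_of_nat_eq
        mult_ac)
  finally show ?thesis by (simp only: of_real_eq_iff)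
qed

text \<open>Cutting off after \<open>M\<close> terms changes the sum by at most the tail
  \<open>\<tau> M\<close>, uniformly on the circle, so the discrete identity applies to the
  truncation before \<open>M\<close> tends to infinity.\<close>

lemma parseval_le:
  fixes g :: "nat \<Rightarrow> complex"
  assumes r: "0 \<le> r" and sm: "summable (\<lambda>n. norm (g n) * r ^ n)"
    and bd: "\<And>z. norm z = r \<Longrightarrow> norm (\<Sum>n. g n * z ^ n) \<le> C"
  shows "(\<Sum>n<N. (norm (g n))\<^sup>2 * (r ^ n)\<^sup>2) \<le> C\<^sup>2"
proof -
  define S where "S = (\<Sum>n. norm (g n) * r ^ n)"
  define \<tau> where "\<tau> M = S - (\<Sum>n<M. norm (g n) * r ^ n)" for M
  have \<tau>: "\<tau> \<longlonglongrightarrow> 0"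
  proof -
    have "(\<lambda>M. S - (\<Sum>n<M. norm (g n) * r ^ n)) \<longlonglongrightarrow> S - S"
      unfolding S_def by (intro tendsto_diff tendsto_const summable_LIMSEQ[OF sm])
    then show ?thesis by (simp add: \<tau>_def[abs_def])
  qed
  have "(\<Sum>n<N. (norm (g n))\<^sup>2 * (r ^ n)\<^sup>2) \<le> (C + \<tau> M)\<^sup>2" if M: "M \<ge> max N 1" for M
  proof -
    let ?w = "\<lambda>j. cis (2 * pi * real j / real M)"
    define c where "c n = g n * of_real (r ^ n)" for n
    have T: "norm (\<Sum>n<M. c n * ?w j ^ n) \<le> C + \<tau> M" for j
    proof -
      define z where "z = of_real r * ?w j"
      have nz: "norm z = r" using r by (simp add: z_def norm_mult)
      have nn: "norm (g n * z ^ n) = norm (g n) * r ^ n" for n by (simp add: norm_mult norm_power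
          nz)
      have sz: "summable (\<lambda>n. g n * z ^ n)" by (rule summable_norm_cancel) (simp add: nn sm)
      have "(\<Sum>n. g n * z ^ n) = (\<Sum>n. g (n + M) * z ^ (n + M)) + (\<Sum>n<M. g n * z ^ n)"
        by (rule suminf_split_initial_segment[OF sz])
      moreover have "norm (\<Sum>n. g (n + M) * z ^ (n + M)) \<le> (\<Sum>n. norm (g (n + M) * z ^ (n + M)))"
        using summable_ignore_initial_segment[OF sm, of M] by (intro summable_norm) (simp add: nn)
      moreover have "(\<Sum>n. norm (g (n + M) * z ^ (n + M))) = \<tau> M"
        unfolding nn \<tau>_def S_def using suminf_split_initial_segment[OF sm, of M] by simp
      moreover have "norm (\<Sum>n. g n * z ^ n) \<le> C" by (rule bd[OF nz])
      moreover have "(\<Sum>n<M. c n * ?w j ^ n) = (\<Sum>n<M. g n * z ^ n)"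
        by (simp add: c_def z_def power_mult_distrib mult_ac)
      ultimately show ?thesis
        using norm_triangle_ineq4[of "\<Sum>n. g n * z ^ n" "\<Sum>n. g (n + M) * z ^ (n + M)"] by simp
    qed
    have "real M * (\<Sum>n<M. (norm (c n))\<^sup>2) = (\<Sum>j<M. (norm (\<Sum>n<M. c n * ?w j ^ n))\<^sup>2)"
      by (rule discrete_parseval[symmetric])
    also have "\<dots> \<le> (\<Sum>j<M. (C + \<tau> M)\<^sup>2)"
      using T by (intro sum_mono power_mono) auto
    also have "\<dots> = real M * (C + \<tau> M)\<^sup>2" by simp
    finally have "(\<Sum>n<M. (norm (c n))\<^sup>2) \<le> (C + \<tau> M)\<^sup>2" using M by simp
    moreover have "(norm (c n))\<^sup>2 = (norm (g n))\<^sup>2 * (r ^ n)\<^sup>2" for n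
      using r by (simp add: c_def norm_mult norm_power power_mult_distrib)
    moreover have "(\<Sum>n<N. (norm (c n))\<^sup>2) \<le> (\<Sum>n<M. (norm (c n))\<^sup>2)"
      using M by (intro sum_mono2) auto
    ultimately show ?thesis by simp
  qed
  then have "\<exists>M0. \<forall>M\<ge>M0. (\<Sum>n<N. (norm (g n))\<^sup>2 * (r ^ n)\<^sup>2) \<le> (C + \<tau> M)\<^sup>2" by blast
  moreover have "(\<lambda>M. (C + \<tau> M)\<^sup>2) \<longlonglongrightarrow> (C + 0)\<^sup>2" by (intro tendsto_intros \<tau>)
  ultimately show ?thesis using LIMSEQ_le_const by fastforce
qed

text \<open>Parseval bounds the sum of the squares of the coefficients, and a nonzero integer
  contributes at least 1.\<close>

lemma bounded_integer_series_finite: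
  fixes g :: "nat \<Rightarrow> int"
  assumes sm: "\<And>r. 0 \<le> r \<Longrightarrow> r < 1 \<Longrightarrow> summable (\<lambda>n. \<bar>real_of_int (g n)\<bar> * r ^ n)"
    and bd: "\<And>z :: complex. norm z < 1 \<Longrightarrow> norm (\<Sum>n. of_int (g n) * z ^ n) \<le> C"
  shows "finite {n. g n \<noteq> 0}"
proof -
  have le: "(\<Sum>n<N. (real_of_int (g n))\<^sup>2) \<le> C\<^sup>2" for N
  proof -
    have "(\<Sum>n<N. (real_of_int (g n))\<^sup>2 * (r ^ n)\<^sup>2) \<le> C\<^sup>2" if r: "0 \<le> r" "r < 1" for r
      using parseval_le[of r "\<lambda>n. of_int (g n)" C N] sm[OF r] bd r by simp
    then have "\<forall>\<^sub>F r in at_left (1::real). (\<Sum>n<N. (real_of_int (g n))\<^sup>2 * (r ^ n)\<^sup>2) \<le> C\<^sup>2"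
      by (intro eventually_at_leftI[of 0]) auto
    moreover have "((\<lambda>r. \<Sum>n<N. (real_of_int (g n))\<^sup>2 * (r ^ n)\<^sup>2) \<longlongrightarrow>
        (\<Sum>n<N. (real_of_int (g n))\<^sup>2 * (1 ^ n)\<^sup>2)) (at_left (1::real))"
      by (intro tendsto_intros)
    ultimately have "(\<Sum>n<N. (real_of_int (g n))\<^sup>2 * (1 ^ n)\<^sup>2) \<le> C\<^sup>2"
      by (intro tendsto_upperbound[OF _ _ trivial_limit_at_left_real])
    then show ?thesis by simp
  qed
  have "card F \<le> nat \<lfloor>C\<^sup>2\<rfloor>" if F: "F \<subseteq> {n. g n \<noteq> 0}" "finite F" for F
  proof -
    obtain N where N: "F \<subseteq> {..<N}" using F(2) finite_nat_iff_bounded by blast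
    have "real (card F) = (\<Sum>n\<in>F. 1)" by simp
    also have "\<dots> \<le> (\<Sum>n\<in>F. (real_of_int (g n))\<^sup>2)"
    proof (rule sum_mono)
      fix n assume "n \<in> F"
      then have "1 \<le> \<bar>g n\<bar>" using F by auto
      then have "1\<^sup>2 \<le> (g n)\<^sup>2" by (subst abs_le_square_iff[symmetric]) simp
      then show "1 \<le> (real_of_int (g n))\<^sup>2" by (metis of_int_1_le_iff of_int_power one_power2)
    qed
    also have "\<dots> \<le> (\<Sum>n<N. (real_of_int (g n))\<^sup>2)" using N by (intro sum_mono2) auto
    also have "\<dots> \<le> C\<^sup>2" by (rule le)
    finally show ?thesis by (simp add: le_nat_floor)
  qed
  then show ?thesis using finite_if_finite_subsets_card_bdd[of "{n. g n \<noteq> 0}"] by blast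
qed

section \<open>Integral equations over the polynomials and Fatou's lemma\<close>

lemma norm_poly_le:
  fixes p :: "'a::real_normed_field poly"
  assumes "norm z \<le> 1"
  shows "norm (poly p z) \<le> (\<Sum>k\<le>degree p. norm (coeff p k))"
proof -
  have "norm (poly p z) \<le> (\<Sum>k\<le>degree p. norm (coeff p k * z ^ k))"
    unfolding poly_altdef by (rule norm_sum)
  also have "\<dots> \<le> (\<Sum>k\<le>degree p. norm (coeff p k) * 1)"
    unfolding norm_mult norm_power using assms by (intro sum_mono mult_left_mono power_le_one) auto
  finally show ?thesis by simp
qed

text \<open>For \<open>norm s > 1\<close> every power in the sum is at most
  \<open>norm s ^ (d - 1)\<close>, which can be cancelled.\<close>

lemma monic_root_bound:
  fixes s :: "'a::real_normed_field"
  assumes "s ^ d = - (\<Sum>i<d. b i * s ^ i)" "0 < d" "\<And>i. i < d \<Longrightarrow> norm (b i) \<le> B i"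
  shows "norm s \<le> 1 + (\<Sum>i<d. B i)"
proof (cases "norm s \<le> 1")
  case True
  have "0 \<le> (\<Sum>i<d. B i)" using assms(3) by (intro sum_nonneg) (meson lessThan_iff norm_ge_zero
      order_trans)
  with True show ?thesis by simp
next
  case False
  have "norm s ^ d = norm (\<Sum>i<d. b i * s ^ i)" by (metis assms(1) norm_minus_cancel norm_power)
  also have "\<dots> \<le> (\<Sum>i<d. norm (b i * s ^ i))" by (rule norm_sum)
  also have "\<dots> \<le> (\<Sum>i<d. B i * norm s ^ (d - 1))"
    unfolding norm_mult norm_power
  proof (intro sum_mono mult_mono power_increasing)
    fix i assume "i \<in> {..<d}"
    then have i: "i < d" by simp
    show "norm (b i) \<le> B i" using assms(3)[OF i] .
    then show "0 \<le> B i" by (rule order_trans[OF norm_ge_zero])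
    show "i \<le> d - 1" using i by simp
  qed (use False in auto)
  also have "\<dots> = (\<Sum>i<d. B i) * norm s ^ (d - 1)" by (simp add: sum_distrib_right)
  finally have "norm s * norm s ^ (d - 1) \<le> (\<Sum>i<d. B i) * norm s ^ (d - 1)"
    using assms(2) by (cases d) auto
  moreover have "0 < norm s ^ (d - 1)" using False by (intro zero_less_power) linarith
  ultimately show ?thesis by simp
qed

lemma eval_fps_sum:
  fixes f :: "'i \<Rightarrow> 'a::{banach, real_normed_div_algebra} fps"
  assumes "\<And>i. i \<in> A \<Longrightarrow> ereal (norm z) < fps_conv_radius (f i)"
  shows "eval_fps (sum f A) z = (\<Sum>i\<in>A. eval_fps (f i) z) \<and> (ereal (norm z) < fps_conv_radius (sum
      f A))"
  using assms
proof (induction A rule: infinite_finite_induct)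
  case (insert i A)
  then have "ereal (norm z) < min (fps_conv_radius (f i)) (fps_conv_radius (sum f A))" by simp
  also have "\<dots> \<le> fps_conv_radius (f i + sum f A)" by (rule fps_conv_radius_add)
  finally show ?case using insert by (simp add: eval_fps_add)
qed auto

abbreviation int_poly :: "int poly \<Rightarrow> complex poly" where
  "int_poly \<equiv> map_poly of_int"

text \<open>Fatou's lemma for algebraic series: multiplied by the leading coefficient, the series becomes
  integral over the polynomials, hence bounded on the unit disc, hence square summable.\<close>

lemma algebraic_integer_series_rational:
  fixes u :: "nat \<Rightarrow> int"
  assumes sm: "\<And>r. 0 \<le> r \<Longrightarrow> r < 1 \<Longrightarrow> summable (\<lambda>n. \<bar>real_of_int (u n)\<bar> * r ^ n)"
    and rel: "(\<Sum>i\<le>d. fps_of_poly (int_poly (a i)) * Abs_fps (\<lambda>n. of_int (u n)) ^ i) = 0"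
    and ad: "a d \<noteq> 0"
  shows "\<exists>h. fps_of_poly (int_poly (a d)) * Abs_fps (\<lambda>n. of_int (u n)) = fps_of_poly (int_poly h)"
proof -
  define U :: "complex fps" where "U = Abs_fps (\<lambda>n. of_int (u n))"
  have Ur: "1 \<le> fps_conv_radius U"
    unfolding fps_conv_radius_def
  proof (rule conv_radius_geI_ex)
    fix r :: real assume r: "0 < r" "ereal r < 1"
    then have "summable (\<lambda>n. \<bar>real_of_int (u n)\<bar> * r ^ n)" by (intro sm) auto
    then have "summable (\<lambda>n. U $ n * complex_of_real r ^ n)"
      using r by (intro summable_norm_cancel[of "\<lambda>n. U $ n * complex_of_real r ^ n"]) (simp add:
          U_def norm_mult norm_power)
    then show "\<exists>z. norm z = r \<and> summable (\<lambda>n. U $ n * z ^ n)"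
      using r by (intro exI[of _ "complex_of_real r"]) auto
  qed
  have a_inj: "int_poly p = 0 \<longleftrightarrow> p = 0" for p by (simp add: poly_eq_iff coeff_map_poly)
  have d: "0 < d"
  proof (rule ccontr)
    assume "\<not> 0 < d"
    then have "fps_of_poly (int_poly (a d)) = 0" using rel by simp
    then have "int_poly (a d) = 0" using fps_of_poly_eq_iff[of "int_poly (a d)" 0] by simp
    with ad a_inj show False by blast
  qed
  define \<alpha> where "\<alpha> i z = poly (int_poly (a i)) z" for i z
  define A where "A i = (\<Sum>k\<le>degree (int_poly (a i)). norm (coeff (int_poly (a i)) k))" for i
  define g where "g n = (\<Sum>i=0..n. coeff (a d) i * u (n - i))" for n
  have gU: "fps_of_poly (int_poly (a d)) * U = Abs_fps (\<lambda>n. of_int (g n))"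
    by (intro fps_ext) (simp add: fps_mult_nth U_def g_def coeff_map_poly)
  have gr: "1 \<le> fps_conv_radius (Abs_fps (\<lambda>n. complex_of_int (g n)))"
    unfolding gU[symmetric]
    by (rule order_trans[OF _ fps_conv_radius_mult]) (simp add: Ur)
  have lt: "ereal (norm z) < fps_conv_radius f" if "norm z < 1" "1 \<le> fps_conv_radius f" for z ::
      complex and f :: "complex fps"
    using that by (metis ereal_less(3) less_le_trans)
  have "finite {n. g n \<noteq> 0}"
  proof (rule bounded_integer_series_finite)
    fix r :: real assume r: "0 \<le> r" "r < 1"
    have "summable (\<lambda>n. norm (of_int (g n) * complex_of_real r ^ n))"
      using lt[OF _ gr, of "complex_of_real r"] r
      by (intro abs_summable_in_conv_radius) (simp add: fps_conv_radius_def)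
    then show "summable (\<lambda>n. \<bar>real_of_int (g n)\<bar> * r ^ n)" using r by (simp add: norm_mult
        norm_power)
  next
    fix z :: complex assume z: "norm z < 1"
    define w where "w = eval_fps U z"
    define s where "s = \<alpha> d z * w"
    have ev: "eval_fps (fps_of_poly (int_poly (a i)) * U ^ i) z = \<alpha> i z * w ^ i"
      and evr: "ereal (norm z) < fps_conv_radius (fps_of_poly (int_poly (a i)) * U ^ i)" for i
    proof -
      have Ui: "1 \<le> fps_conv_radius (U ^ i)" by (rule order_trans[OF Ur fps_conv_radius_power])
      show "ereal (norm z) < fps_conv_radius (fps_of_poly (int_poly (a i)) * U ^ i)"
        by (rule lt[OF z]) (rule order_trans[OF _ fps_conv_radius_mult], simp add: Ui)
      show "eval_fps (fps_of_poly (int_poly (a i)) * U ^ i) z = \<alpha> i z * w ^ i"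
        using lt[OF z Ur] lt[OF z Ui]
        by (simp add: eval_fps_mult eval_fps_power \<alpha>_def w_def)
    qed
    have "(\<Sum>i\<le>d. \<alpha> i z * w ^ i) = eval_fps (\<Sum>i\<le>d. fps_of_poly (int_poly (a i)) * U ^ i) z"
      using eval_fps_sum[of "{..d}" z "\<lambda>i. fps_of_poly (int_poly (a i)) * U ^ i"] ev evr by simp
    also have "\<dots> = 0" using rel by (simp add: U_def)
    \<comment> \<open>This factor turns the relation into a monic equation for
      \<open>s = \<alpha> d z * w\<close>, with coefficients that are bounded on the unit
      disc.\<close>
    finally have "0 = \<alpha> d z ^ (d - 1) * (\<Sum>i\<le>d. \<alpha> i z * w ^ i)" by simp
    also have "\<dots> = \<alpha> d z ^ (d - 1) * (\<alpha> d z * w ^ d) + \<alpha> d z ^ (d - 1) * (\<Sum>i<d. \<alpha> i z * w ^ i)"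
      by (simp add: lessThan_Suc_atMost[symmetric] algebra_simps)
    also have "\<alpha> d z ^ (d - 1) * (\<alpha> d z * w ^ d) = s ^ d"
      using d by (cases d) (auto simp: s_def power_mult_distrib mult_ac)
    also have "\<alpha> d z ^ (d - 1) * (\<Sum>i<d. \<alpha> i z * w ^ i) = (\<Sum>i<d. (\<alpha> i z * \<alpha> d z ^ (d - 1 - i)) * s
        ^ i)"
      unfolding sum_distrib_left
    proof (intro sum.cong refl)
      fix i assume "i \<in> {..<d}"
      then have "\<alpha> d z ^ (d - 1) = \<alpha> d z ^ (d - 1 - i) * \<alpha> d z ^ i"
        by (simp flip: power_add)
      then show "\<alpha> d z ^ (d - 1) * (\<alpha> i z * w ^ i) = \<alpha> i z * \<alpha> d z ^ (d - 1 - i) * s ^ i"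
        by (simp add: s_def power_mult_distrib mult_ac)
    qed
    finally have eq: "s ^ d = - (\<Sum>i<d. (\<alpha> i z * \<alpha> d z ^ (d - 1 - i)) * s ^ i)"
      by (simp add: eq_neg_iff_add_eq_0)
    have \<alpha>A: "norm (\<alpha> i z) \<le> A i" for i unfolding \<alpha>_def A_def using z by (intro norm_poly_le) simp
    have "norm s \<le> 1 + (\<Sum>i<d. A i * A d ^ (d - 1 - i))"
    proof (rule monic_root_bound[OF eq d])
      fix i assume "i < d"
      show "norm (\<alpha> i z * \<alpha> d z ^ (d - 1 - i)) \<le> A i * A d ^ (d - 1 - i)"
        unfolding norm_mult norm_power using \<alpha>A
        by (intro mult_mono power_mono) (auto intro: order_trans[OF norm_ge_zero])
    qed
    moreover have "s = eval_fps (fps_of_poly (int_poly (a d)) * U) z"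
      using ev[of d] lt[OF z Ur] by (simp add: eval_fps_mult s_def w_def \<alpha>_def)
    ultimately show "norm (\<Sum>n. complex_of_int (g n) * z ^ n) \<le> 1 + (\<Sum>i<d. A i * A d ^ (d - 1 - i))"
      by (simp add: gU eval_fps_def)
  qed
  then obtain K where K: "{n. g n \<noteq> 0} \<subseteq> {..<K}" using finite_nat_iff_bounded by blast
  define h where "h = (\<Sum>n<K. monom (g n) n)"
  have "coeff h n = g n" for n
    using K by (auto simp: h_def coeff_sum)
  then have "fps_of_poly (int_poly h) = Abs_fps (\<lambda>n. of_int (g n))"
    by (intro fps_ext) (simp add: coeff_map_poly)
  then show ?thesis using gU by (intro exI[of _ h]) (simp add: U_def)
qed

section \<open>The generating function of the overlap-free words\<close>

lemma fps_one_minus_2X: "(1 - 2 * fps_X) * Abs_fps (\<lambda>n. 2 ^ n) = (1 :: complex fps)"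
proof (rule fps_ext)
  fix n
  show "((1 - 2 * fps_X) * Abs_fps (\<lambda>n. 2 ^ n)) $ n = (1 :: complex fps) $ n"
    by (cases n) (simp_all add: left_diff_distrib mult.assoc numeral_fps_const)
qed

lemma card_overlap_words:
  "card {w \<in> L_o 2. length w = n} + count_free n = 2 ^ n"
proof -
  define W where "W = {w :: nat list. set w \<subseteq> {..<2} \<and> length w = n}"
  define F where "F = {w \<in> W. overlap_free w}"
  have W: "finite W" "card W = 2 ^ n"
    unfolding W_def using finite_lists_length_eq[of "{..<2::nat}" n] card_lists_length_eq[of
        "{..<2::nat}" n]
    by simp_all
  have "{w \<in> L_o 2. length w = n} = W - F"
    by (auto simp: L_o_def W_def F_def overlap_free_iff_no_overlap)
  moreover have "F \<subseteq> W" by (auto simp: F_def)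
  moreover have "card F = count_free n"
  proof -
    have inj: "inj (of_bool :: bool \<Rightarrow> nat)" by (rule injI) (simp add: of_bool_eq_iff)
    have "F = map of_bool ` {w :: bool list. length w = n \<and> overlap_free w}"
    proof
      show "F \<subseteq> map of_bool ` {w :: bool list. length w = n \<and> overlap_free w}"
      proof
        fix w assume w: "w \<in> F"
        define v where "v = map (\<lambda>x. x = (1::nat)) w"
        have "map of_bool v = w"
          unfolding v_def map_map using w by (intro map_idI) (force simp: F_def W_def)
        moreover from this have "overlap_free v" using w overlap_free_map_inj[OF inj, of v] by
            (simp add: F_def)
        ultimately show "w \<in> map of_bool ` {w :: bool list. length w = n \<and> overlap_free w}"
          using w by (intro image_eqI[of _ _ v]) (auto simp: v_def F_def W_def)
      qed
      show "map of_bool ` {w :: bool list. length w = n \<and> overlap_free w} \<subseteq> F"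
        by (auto simp: F_def W_def overlap_free_map_inj[OF inj])
    qed
    moreover have "inj_on (map of_bool :: bool list \<Rightarrow> nat list) {w. length w = n \<and> overlap_free w}"
      by (rule inj_on_subset[OF inj_mapI[OF inj] subset_UNIV])
    ultimately show ?thesis by (simp only: card_image count_free_def)
  qed
  moreover have "card F \<le> card W" using W(1) by (intro card_mono) (auto simp: F_def)
  moreover have "finite F" using W(1) by (simp add: F_def)
  ultimately show ?thesis using W by (simp add: card_Diff_subset)
qed

lemma int_poly_hom:
  "int_poly 0 = 0" "int_poly 1 = 1" "int_poly (p + q) = int_poly p + int_poly q"
  "int_poly (- p) = - int_poly p" "int_poly (p * q) = int_poly p * int_poly q"
  by (auto intro!: poly_eqI simp: coeff_map_poly coeff_mult)

definition int_poly_fls :: "int poly \<Rightarrow> complex fls" where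
  "int_poly_fls p = fps_to_fls (fps_of_poly (int_poly p))"

lemma int_poly_fls_subring: "is_subring (range int_poly_fls)"
proof -
  have hom: "int_poly_fls 0 = 0" "int_poly_fls 1 = 1" "int_poly_fls (p + q) = int_poly_fls p +
      int_poly_fls q"
    "int_poly_fls (- p) = - int_poly_fls p" "int_poly_fls (p * q) = int_poly_fls p * int_poly_fls
        q" for p q
    by (simp_all add: int_poly_fls_def int_poly_hom fps_of_poly_add fps_of_poly_mult
        fps_of_poly_uminus fls_times_fps_to_fls)
  show ?thesis
    unfolding is_subring_def by (auto simp flip: hom)
qed

definition free_gf :: "complex fps" where
  "free_gf = Abs_fps (\<lambda>n. of_nat (count_free n))"

text \<open>\<open>free_gf\<close> is the rational series \<open>P\<close> minus the series of the
  start symbol. A derivation that vanishes on the integer polynomials kills both: the latter by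
  \<open>derivation_tree_gf\<close>, and \<open>P\<close> because it is the inverse of the
  polynomial \<open>q\<close>.\<close>

lemma free_gf_algebraic:
  assumes "unambiguously_context_free (L_o 2)"
  shows "\<exists>p\<in>polys_over (range int_poly_fls). p \<noteq> 0 \<and> poly p (fps_to_fls free_gf) = 0"
proof -
  obtain G :: "(nat, nat) cfg" where G: "wf_cfg G" "unambiguous G" "cfg_lang G = L_o 2"
    using assms by (auto simp: unambiguously_context_free_def)
  define ys where "ys = map (\<lambda>A. fps_to_fls (tree_gf G (NT A))) (sorted_list_of_set (nonterminals
      G))"
  define P where "P = Abs_fps (\<lambda>n. 2 ^ n :: complex)"
  have "free_gf + tree_gf G (NT (start G)) = P"
  proof (rule fps_ext)
    fix n
    have 1: "Defs.frontier ` {t \<in> trees G (NT (start G)). yield_length t = n} = {w \<in> L_o 2. length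
        w = n}"
      using cfg_lang_iff_derivation_tree[OF G(1)] unfolding G(3)
      by (force simp: trees_def derivation_tree_def)
    have 2: "inj_on Defs.frontier {t \<in> trees G (NT (start G)). yield_length t = n}"
      using useful_inj[OF G(1,2) useful.start] by (rule inj_on_subset) auto
    have "card {t \<in> trees G (NT (start G)). yield_length t = n} + count_free n = 2 ^ n"
      unfolding card_image[OF 2, symmetric] 1 by (rule card_overlap_words)
    from arg_cong[OF this, of "of_nat :: nat \<Rightarrow> complex"]
    show "(free_gf + tree_gf G (NT (start G))) $ n = P $ n"
      by (simp add: free_gf_def tree_gf_def[OF G(1,2)] gf_def P_def add.commute)
  qed
  then have sum: "fps_to_fls free_gf + fps_to_fls (tree_gf G (NT (start G))) = fps_to_fls P"
    by (simp flip: fps_to_fls_plus)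
  define q where "q = int_poly_fls [:1, -2:]"
  have "fps_of_poly (int_poly [:1, -2:]) = 1 - 2 * fps_X"
    by (rule fps_ext) (simp add: map_poly_pCons coeff_pCons numeral_fps_const split: nat.split)
  then have "fps_of_poly (int_poly [:1, -2:]) * P = 1"
    unfolding P_def by (simp only: fps_one_minus_2X)
  then have qP: "q * fps_to_fls P = 1"
    unfolding q_def int_poly_fls_def by (simp flip: fls_times_fps_to_fls)
  show ?thesis
  proof (rule algebraic_if_no_derivation[OF int_poly_fls_subring, where ys = ys])
    fix E D
    assume E: "is_subring E" and D: "derivation_on E D" and "range int_poly_fls \<subseteq> E"
      and u: "fps_to_fls free_gf \<in> E" and ys: "set ys \<subseteq> E" and D0: "\<forall>x\<in>range int_poly_fls. D x = 0"
    have X: "fls_X = int_poly_fls [:0, 1:]"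
      by (simp add: int_poly_fls_def map_poly_pCons fps_of_poly_pCons)
    have Y: "fps_to_fls (tree_gf G (NT A)) \<in> E" if "useful G A" for A
      using useful_nonterminal[OF G(1,2) that] ys G(1) by (auto simp: ys_def wf_cfg_def)
    have "D (fps_to_fls (tree_gf G (NT (start G)))) = 0"
      by (rule derivation_tree_gf[OF G(1,2) E D _ _ Y useful.start])
        (use \<open>range int_poly_fls \<subseteq> E\<close> D0 in \<open>auto simp: X\<close>)
    then have 1: "D (fps_to_fls free_gf) = D (fps_to_fls P)"
      using D u Y[OF useful.start] unfolding derivation_on_def sum[symmetric] by auto
    have "fps_to_fls P \<in> E" using E u Y[OF useful.start] unfolding sum[symmetric] by (auto simp:
        is_subring_def)
    moreover have "q \<in> E" "D q = 0" using \<open>range int_poly_fls \<subseteq> E\<close> D0 by (auto simp: q_def)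
    ultimately have "D (q * fps_to_fls P) = q * D (fps_to_fls P)" using D by (auto simp:
        derivation_on_def)
    then have "q * D (fps_to_fls P) = 0" using derivation_on_1[OF E D] by (simp add: qP)
    moreover have "q \<noteq> 0" using qP by auto
    ultimately show "D (fps_to_fls free_gf) = 0" using 1 by simp
  qed
qed

section \<open>Behaviour near one, and the contradiction with rational growth\<close>

lemma radius_tendsto: "radius \<longlonglongrightarrow> 1"
proof -
  have "(\<lambda>k. exp (- 2 * (1 / 2) ^ k)) \<longlonglongrightarrow> exp (- 2 * (0::real))"
    by (intro tendsto_intros LIMSEQ_power_zero) simp
  then show ?thesis by (simp add: radius_def[abs_def] power_divide)
qed

lemma radius_gap: "2 / 3 / 2 ^ k \<le> 1 - radius k" "1 - radius k \<le> 2 / 2 ^ k"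
proof -
  define x :: real where "x = 2 / 2 ^ k"
  have x: "0 < x" "x \<le> 2" by (auto simp: x_def divide_le_eq)
  have r: "radius k = exp (- x)" by (simp add: radius_def x_def)
  show "1 - radius k \<le> 2 / 2 ^ k" using exp_ge_add_one_self[of "- x"] by (simp add: r
      x_def[symmetric])
  have "exp (- x) \<le> 1 / (1 + x)"
    using exp_ge_add_one_self[of x] x by (simp add: exp_minus field_simps)
  \<comment> \<open>For positive \<open>x\<close> this is equivalent to
    \<open>x \<le> 2\<close>.\<close>
  also have "\<dots> \<le> 1 - x / 3" using x by (simp add: field_simps power2_eq_square mult_left_le)
  finally show "2 / 3 / 2 ^ k \<le> 1 - radius k" by (simp add: r x_def)
qed

lemma free_summable:
  assumes "0 \<le> r" "r < 1"
  shows "summable (\<lambda>n. real (count_free n) * r ^ n)"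
proof -
  obtain C where C: "\<And>k N. (\<Sum>n\<le>N. real (count_free n) * radius k ^ n) \<le> C * (196 / 25) ^ k"
    using upper_growth by blast
  obtain k where k: "r < radius k"
    using order_tendstoD(1)[OF radius_tendsto assms(2)] by (auto simp: eventually_sequentially)
  show ?thesis
  proof (rule summableI_nonneg_bounded)
    fix N
    have "(\<Sum>n<N. real (count_free n) * r ^ n) \<le> (\<Sum>n\<le>N. real (count_free n) * r ^ n)"
      using assms by (intro sum_mono2) auto
    also have "\<dots> \<le> (\<Sum>n\<le>N. real (count_free n) * radius k ^ n)"
      using assms k by (intro sum_mono mult_left_mono power_mono) auto
    also have "\<dots> \<le> C * (196 / 25) ^ k" by (rule C)
    finally show "(\<Sum>n<N. real (count_free n) * r ^ n) \<le> C * (196 / 25) ^ k" .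
  qed (use assms in auto)
qed

text \<open>If \<open>p\<close> and \<open>h\<close> vanish at 1 to the orders \<open>a\<close> and
  \<open>b\<close>, then \<open>S k\<close> behaves like \<open>t k\<close> to the power
  \<open>b - a\<close>, where \<open>t k\<close> is of order \<open>1 / 2 ^ k\<close>. For
  \<open>a - b\<close> at most 2 the growth is at most of order \<open>4 ^ k\<close>, too slow for
  441/100; from 3 on it is at least of order \<open>8 ^ k\<close>, too fast for 196/25.\<close>

lemma rational_growth_contradiction:
  fixes p h :: "complex poly"
  assumes p: "p \<noteq> 0"
    and eq: "\<And>k. norm (poly p (of_real (radius k))) * S k = norm (poly h (of_real (radius k)))"
    and c: "0 < c" and lower: "\<And>k. c * (441 / 100) ^ k \<le> S k"
    and upper: "\<And>k. S k \<le> C * (196 / 25) ^ k"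
  shows False
proof -
  define t where "t k = 1 - radius k" for k
  have t: "0 < t k" "t k < 1" for k using radius_bounds[of k] by (auto simp: t_def)
  have S: "0 < S k" for k
    using lower[of k] c by (meson less_le_trans mult_pos_pos zero_less_power divide_pos_pos
        zero_less_numeral)
  have lim: "(\<lambda>k. norm (poly q (of_real (radius k)))) \<longlonglongrightarrow> norm (poly q 1)" for q :: "complex poly"
  proof -
    have "(\<lambda>k. complex_of_real (radius k)) \<longlonglongrightarrow> 1"
      using tendsto_of_real[OF radius_tendsto, where ?'a = complex] by simp
    then show ?thesis by (intro tendsto_norm isCont_tendsto_compose[OF poly_isCont])
  qed
  have split: "\<exists>n (q1 :: complex poly). (\<forall>k. norm (poly q (of_real (radius k))) = t k ^ n * norm
      (poly q1 (of_real (radius k)))) \<and> poly q1 1 \<noteq> 0"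
    if q0: "q \<noteq> 0" for q :: "complex poly"
  proof -
    obtain q1 where q1: "q = [:-1, 1:] ^ order 1 q * q1" "\<not> [:-1, 1:] dvd q1"
      using order_decomp[OF q0, of 1] by auto
    have "norm (complex_of_real (radius k) - 1) = t k" for k
      using t[of k] norm_of_real[of "radius k - 1", where ?'a = complex] by (simp add: t_def)
    then have "norm (poly q (of_real (radius k))) = t k ^ order 1 q * norm (poly q1 (of_real
        (radius k)))" for k
      by (subst q1(1)) (simp add: norm_mult norm_power)
    moreover have "poly q1 1 \<noteq> 0" using q1(2) by (simp add: poly_eq_0_iff_dvd)
    ultimately show ?thesis by blast
  qed
  obtain a and p1 :: "complex poly" where p1: "\<And>k. norm (poly p (of_real (radius k))) = t k ^ a *
      norm (poly p1 (of_real (radius k)))" "poly p1 1 \<noteq> 0"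
    using split[OF p] by auto
  define P where "P k = norm (poly p1 (of_real (radius k)))" for k
  have P: "P \<longlonglongrightarrow> norm (poly p1 1)" "0 < norm (poly p1 1)" "\<And>k. 0 \<le> P k"
    unfolding P_def using lim p1(2) by auto
  have "h \<noteq> 0"
  proof
    assume "h = 0"
    then have "P k = 0" for k using eq[of k] S[of k] t[of k] by (auto simp: p1(1) P_def)
    then have "P = (\<lambda>_. 0)" by (rule ext)
    then have "norm (poly p1 1) = 0" using LIMSEQ_unique[OF P(1)] tendsto_const by blast
    then show False using P(2) by simp
  qed
  then obtain b and h1 :: "complex poly" where h1: "\<And>k. norm (poly h (of_real (radius k))) = t k ^
      b * norm (poly h1 (of_real (radius k)))" "poly h1 1 \<noteq> 0"
    using split[of h] by auto
  define H where "H k = norm (poly h1 (of_real (radius k)))" for k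
  have H: "H \<longlonglongrightarrow> norm (poly h1 1)" "0 < norm (poly h1 1)" "\<And>k. 0 \<le> H k"
    unfolding H_def using lim h1(2) by auto
  have e: "t k ^ a * (P k * S k) = t k ^ b * H k" for k
    using eq[of k] by (simp add: p1(1) h1(1) P_def H_def)
  show False
  proof (cases "a \<le> b + 2")
    case True
    \<comment> \<open>400/441 is 4 divided by 441/100, so the right-hand side tends to 0 while the
      left-hand side has a positive limit.\<close>
    have "c * (4 / 9) * P k \<le> H k * (400 / 441) ^ k" for k
    proof -
      have "t k ^ a * (t k ^ 2 * (P k * S k)) = t k ^ 2 * (t k ^ a * (P k * S k))"
        by (simp only: mult_ac)
      also have "\<dots> = t k ^ (b + 2) * H k"
        unfolding e by (simp only: power_add mult_ac)
      also have "\<dots> \<le> t k ^ a * H k"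
        using True t[of k] H(3)[of k] by (intro mult_right_mono power_decreasing) auto
      finally have "t k ^ 2 * (P k * S k) \<le> H k" using t[of k] by simp
      moreover have "(2 / 3 / 2 ^ k) ^ 2 * (P k * (c * (441 / 100) ^ k)) \<le> t k ^ 2 * (P k * S k)"
        using radius_gap(1)[of k] lower[of k] P(3)[of k] c unfolding t_def
        by (intro mult_mono power_mono mult_nonneg_nonneg) auto
      moreover have "(2 / 3 / 2 ^ k) ^ 2 * (P k * (c * (441 / 100) ^ k)) = c * (4 / 9) * P k *
          (441 / 400) ^ k"
      proof -
        have 1: "(2 / 3 / 2 ^ k) ^ 2 = (4 / 9 :: real) * (1 / 4) ^ k"
          by (simp add: power_divide power2_eq_square flip: power_mult_distrib)
        have 2: "(1 / 4 :: real) ^ k * (441 / 100) ^ k = (441 / 400) ^ k"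
          by (simp flip: power_mult_distrib)
        show ?thesis unfolding 1 2[symmetric] by (simp only: mult_ac)
      qed
      ultimately have "c * (4 / 9) * P k * (441 / 400) ^ k \<le> H k" by linarith
      then have "c * (4 / 9) * P k * (441 / 400) ^ k * (400 / 441) ^ k \<le> H k * (400 / 441) ^ k"
        by (intro mult_right_mono) auto
      then show ?thesis by (simp add: mult.assoc flip: power_mult_distrib)
    qed
    moreover have "(\<lambda>k. H k * (400 / 441) ^ k) \<longlonglongrightarrow> norm (poly h1 1) * 0"
      by (intro tendsto_mult H LIMSEQ_power_zero) simp
    moreover have "(\<lambda>k. c * (4 / 9) * P k) \<longlonglongrightarrow> c * (4 / 9) * norm (poly p1 1)"
      by (intro tendsto_intros P)
    ultimately have "c * (4 / 9) * norm (poly p1 1) \<le> norm (poly h1 1) * 0"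
      by (intro LIMSEQ_le) auto
    moreover have "0 < c * (4 / 9) * norm (poly p1 1)" using c P(2) by simp
    ultimately show False by simp
  next
    case False
    \<comment> \<open>49/50 is 196/25 divided by 8, so here the right-hand side tends to 0 and
      \<open>H\<close> does not.\<close>
    have "H k \<le> 8 * C * (49 / 50) ^ k * P k" for k
    proof -
      have "t k ^ b * H k = t k ^ a * (P k * S k)" by (rule e[symmetric])
      also have "\<dots> \<le> t k ^ (b + 3) * (P k * S k)"
        using False t[of k] P(3)[of k] S[of k] by (intro mult_right_mono power_decreasing) auto
      finally have "t k ^ b * H k \<le> t k ^ b * (t k ^ 3 * (P k * S k))" by (simp only: power_add
          mult_ac)
      then have "H k \<le> t k ^ 3 * (P k * S k)" using t[of k] by simp
      also have "\<dots> \<le> (2 / 2 ^ k) ^ 3 * (P k * (C * (196 / 25) ^ k))"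
        using radius_gap(2)[of k] upper[of k] P(3)[of k] S[of k] t[of k] unfolding t_def
        by (intro mult_mono power_mono mult_nonneg_nonneg) auto
      also have "\<dots> = 8 * C * (49 / 50) ^ k * P k"
      proof -
        have 1: "(2 / 2 ^ k) ^ 3 = (8::real) * (1 / 8) ^ k"
          by (simp add: power_divide power3_eq_cube flip: power_mult_distrib)
        have 2: "(1 / 8 :: real) ^ k * (196 / 25) ^ k = (49 / 50) ^ k"
          by (simp flip: power_mult_distrib)
        show ?thesis unfolding 1 2[symmetric] by (simp only: mult_ac)
      qed
      finally show ?thesis .
    qed
    moreover have "(\<lambda>k. 8 * C * (49 / 50) ^ k * P k) \<longlonglongrightarrow> 8 * C * 0 * norm (poly p1 1)"
      by (intro tendsto_mult tendsto_const P LIMSEQ_power_zero) simp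
    ultimately have "norm (poly h1 1) \<le> 8 * C * 0 * norm (poly p1 1)"
      by (intro LIMSEQ_le[OF H(1)]) auto
    then show False using H(2) by simp
  qed
qed

lemma free_gf_not_algebraic:
  assumes "p \<in> polys_over (range int_poly_fls)" "p \<noteq> 0" "poly p (fps_to_fls free_gf) = 0"
  shows False
proof -
  have "\<exists>a. \<forall>i. coeff p i = int_poly_fls (a i)"
    using assms(1) unfolding polys_over_def by (intro choice) blast
  then obtain a where a: "\<And>i. coeff p i = int_poly_fls (a i)" by blast
  define d where "d = degree p"
  have ad: "a d \<noteq> 0"
    using assms(2) a[of d] by (auto simp: d_def int_poly_fls_def)
  have fg: "free_gf = Abs_fps (\<lambda>n. of_int (int (count_free n)))" by (simp add: free_gf_def)
  have "fps_to_fls (\<Sum>i\<le>d. fps_of_poly (int_poly (a i)) * free_gf ^ i) = poly p (fps_to_fls free_gf)"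
    by (simp add: poly_altdef a d_def int_poly_fls_def fps_to_fls_sum fls_times_fps_to_fls
        fps_to_fls_power)
  then have rel: "(\<Sum>i\<le>d. fps_of_poly (int_poly (a i)) * Abs_fps (\<lambda>n. of_int (int (count_free n)))
      ^ i) = 0"
    using assms(3) unfolding fg by (simp only: fps_to_fls_eq_0_iff)
  obtain h where h: "fps_of_poly (int_poly (a d)) * free_gf = fps_of_poly (int_poly h)"
    using algebraic_integer_series_rational[OF _ rel ad] free_summable unfolding fg by auto
  define S where "S k = (\<Sum>n. real (count_free n) * radius k ^ n)" for k
  have sm: "summable (\<lambda>n. real (count_free n) * radius k ^ n)" for k
    using radius_bounds[of k] by (intro free_summable) auto
  have eq: "norm (poly (int_poly (a d)) (of_real (radius k))) * S k = norm (poly (int_poly h)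
      (of_real (radius k)))" for k
  proof -
    let ?z = "complex_of_real (radius k)"
    have conv: "ereal (norm ?z) < fps_conv_radius free_gf"
    proof -
      \<comment> \<open>Summability at a point bounds the radius of convergence only weakly, so a
        point beyond \<open>radius k\<close> is used to get the strict inequality.\<close>
      define r where "r = (radius k + 1) / 2"
      have r: "radius k < r" "0 \<le> r" "r < 1" using radius_bounds[of k] by (auto simp: r_def)
      have "summable (\<lambda>n. free_gf $ n * complex_of_real r ^ n)"
        using free_summable[OF r(2,3)] r(2)
        by (intro summable_norm_cancel[of "\<lambda>n. free_gf $ n * complex_of_real r ^ n"])
          (simp add: free_gf_def norm_mult norm_power)
      then have "ereal (norm (complex_of_real r)) \<le> fps_conv_radius free_gf"
        unfolding fps_conv_radius_def by (rule conv_radius_geI)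
      moreover have "ereal (norm ?z) < ereal (norm (complex_of_real r))" using r radius_bounds[of
          k] by simp
      ultimately show ?thesis by (rule less_le_trans[rotated])
    qed
    have "eval_fps free_gf ?z = (\<Sum>n. complex_of_real (real (count_free n) * radius k ^ n))"
      by (simp add: eval_fps_def free_gf_def)
    also have "\<dots> = complex_of_real (S k)" unfolding S_def by (rule suminf_of_real[OF sm, symmetric])
    finally have ev: "eval_fps free_gf ?z = complex_of_real (S k)" .
    have "0 \<le> S k" unfolding S_def using sm radius_bounds[of k] by (intro suminf_nonneg) auto
    moreover have "poly (int_poly (a d)) ?z * complex_of_real (S k) = poly (int_poly h) ?z"
      using arg_cong[OF h, of "\<lambda>f. eval_fps f ?z"] conv by (simp add: eval_fps_mult ev)
    from arg_cong[OF this, of norm] show ?thesis using calculation by (simp add: norm_mult)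
  qed
  obtain C where C: "\<And>k N. (\<Sum>n\<le>N. real (count_free n) * radius k ^ n) \<le> C * (196 / 25) ^ k"
    using upper_growth by blast
  have upper: "S k \<le> C * (196 / 25) ^ k" for k
    unfolding S_def
  proof (rule suminf_le_const[OF sm])
    fix N
    have "(\<Sum>n<N. real (count_free n) * radius k ^ n) \<le> (\<Sum>n\<le>N. real (count_free n) * radius k ^ n)"
      using radius_bounds[of k] by (intro sum_mono2) auto
    with C show "(\<Sum>n<N. real (count_free n) * radius k ^ n) \<le> C * (196 / 25) ^ k" by (rule
        order_trans[rotated])
  qed
  obtain c where c: "0 < c" "\<And>k. \<exists>N. c * (441 / 100) ^ k \<le> (\<Sum>n\<le>N. real (count_free n) * radius k ^
      n)"
    using lower_growth by blast
  have lower: "c * (441 / 100) ^ k \<le> S k" for k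
  proof -
    obtain N where "c * (441 / 100) ^ k \<le> (\<Sum>n\<le>N. real (count_free n) * radius k ^ n)" using c(2)
        by blast
    also have "\<dots> \<le> S k"
      unfolding S_def using radius_bounds[of k] by (intro sum_le_suminf[OF sm]) auto
    finally show ?thesis .
  qed
  have "int_poly (a d) \<noteq> 0" using ad by (auto simp: poly_eq_iff coeff_map_poly)
  then show False by (rule rational_growth_contradiction[OF _ eq c(1) lower upper])
qed

theorem theorem1: "\<not> unambiguously_context_free (L_o 2)"
  using free_gf_algebraic free_gf_not_algebraic by blast

end
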